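(* Let $P:\mathcal{C}^{op}\to\mathbf{InfSL}$ be an existential elementary doctrine. Then the elementary quotient completion $\overline{P}:\mathcal{Q}_P^{op}\to\mathbf{InfSL}$ is existential, and the pair $(J,j):P\to\overline{P}$ is a 1-arrow between elementary existential doctrines that preserves the left adjoints along projections.
   Context: A primary doctrine is a functor $P:\mathcal{C}^{op}\to\mathbf{InfSL}$ where $\mathcal{C}$ has finite products, each $P(A)$ is a poset with finite meets ($\wedge$, top $\top_A$), and each $P_f$ preserves finite meets. Write $f\times f'=\langle f\circ pr_1,f'\circ pr_2\rangle$, $\Delta_A=\langle id_A,id_A\rangle$. $P$ is elementary if each $P_{id_C\times\Delta_A}:P(C\times(A\times A))\to P(C\times A)$ has a left adjoint $\exists_{id_C\times\Delta_A}$ satisfying Frobenius reciprocity $\exists(P_{id_C\times\Delta_A}(\alpha)\wedge\beta)=\alpha\wedge\exists(\beta)$; $\delta_A=\exists_{\Delta_A}(\top_A)$. $P$ is existential if for every product projection $pr:A_1\times A_2\to A_i$, $P_{pr}$ has a left adjoint $\exists_{pr}$, satisfying Beck–Chevalley (for every pullback square of a projection $pr:X\to A$ along $f:A'\to A$, with $pr':X'\to A'$, $f':X'\to X$, one has $\exists_{pr'}P_{f'}(\beta)=P_f\exists_{pr}(\beta)$) and Frobenius reciprocity ($\exists_{pr}(P_{pr}(\alpha)\wedge\beta)=\alpha\wedge\exists_{pr}(\beta)$). A $P$-equivalence relation on $A$ is $\rho\in P(A\times A)$ that is reflexive ($\delta_A\le\rho$), symmetric ($\rho\le P_{\langle pr_2,pr_1\rangle}(\rho)$)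 and transitive ($P_{\langle pr_1,pr_2\rangle}(\rho)\wedge P_{\langle pr_2,pr_3\rangle}(\rho)\le P_{\langle pr_1,pr_3\rangle}(\rho)$). $\mathrm{des}(\rho)$ is the subposet of $\alpha\in P(A)$ with $P_{pr_1}(\alpha)\wedge\rho\le P_{pr_2}(\alpha)$. Elementary quotient completion: $\mathcal{Q}_P$ has objects $(A,\rho)$ with $\rho$ a $P$-equivalence relation on $A$; arrows $(A,\rho)\to(B,\sigma)$ are classes $[f]$ of $f:A\to B$ with $\rho\le P_{f\times f}(\sigma)$, modulo $f\sim g$ iff $\rho\le P_{f\times g}(\sigma)$. $\overline{P}(A,\rho)=\mathrm{des}(\rho)$, $\overline{P}_{[f]}=P_f$. $J(A)=(A,\delta_A)$, $J(f)=[f]$, and $j_A:P(A)\to\overline{P}(A,\delta_A)=P(A)$ is the identity. A 1-arrow $(F,b)$ of elementary doctrines is a finite-product-preserving functor $F$ with a natural transformation $b:P\Rightarrow R\circ F^{op}$ whose components preserve finite meets and satisfy $b_{A\times A}(\delta_A)=R_{\langle F pr_1,F pr_2\rangle}(\delta_{FA})$.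
   Formalization: "Elementary" here also requires the left adjoint along id_C×Δ_A to send ⊤ to P_{pr_2}(δ_A) (Beck–Chevalley); without this clause J need not preserve binary products, so the statement fails. The clause is also proved for the quotient completion. *)

theory Defs
  imports "HOL-Algebra.Galois_Connection"
begin

section \<open>Categories with finite products\<close>

record ('o, 'm) cat =
  Obj :: "'o set"
  Arr :: "'m set"
  Dom :: "'m \<Rightarrow> 'o"
  Cod :: "'m \<Rightarrow> 'o"
  Ident :: "'o \<Rightarrow> 'm"
  Comp :: "'m \<Rightarrow> 'm \<Rightarrow> 'm"  \<comment> \<open>\<open>Comp C g f\<close> is g after f\<close>

definition Hom :: "('o, 'm, 'z) cat_scheme \<Rightarrow> 'o \<Rightarrow> 'o \<Rightarrow> 'm set" where
  "Hom C A B = {f \<in> Arr C. Dom C f = A \<and> Cod C f = B}"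

locale category =
  fixes C :: "('o, 'm, 'z) cat_scheme"
  assumes dom_obj: "f \<in> Arr C \<Longrightarrow> Dom C f \<in> Obj C"
    and cod_obj: "f \<in> Arr C \<Longrightarrow> Cod C f \<in> Obj C"
    and ident_hom: "A \<in> Obj C \<Longrightarrow> Ident C A \<in> Hom C A A"
    and comp_hom: "f \<in> Hom C A B \<Longrightarrow> g \<in> Hom C B D \<Longrightarrow> Comp C g f \<in> Hom C A D"
    and comp_ident_right: "f \<in> Hom C A B \<Longrightarrow> Comp C f (Ident C A) = f"
    and comp_ident_left: "f \<in> Hom C A B \<Longrightarrow> Comp C (Ident C B) f = f"
    and comp_assoc: "f \<in> Hom C A B \<Longrightarrow> g \<in> Hom C B D \<Longrightarrow> h \<in> Hom C D E \<Longrightarrow>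
      Comp C h (Comp C g f) = Comp C (Comp C h g) f"

definition is_terminal :: "('o, 'm, 'z) cat_scheme \<Rightarrow> 'o \<Rightarrow> bool" where
  "is_terminal C T \<longleftrightarrow> T \<in> Obj C \<and> (\<forall>A \<in> Obj C. \<exists>!h. h \<in> Hom C A T)"

definition is_product :: "('o, 'm, 'z) cat_scheme \<Rightarrow> 'o \<Rightarrow> 'o \<Rightarrow> 'o \<Rightarrow> 'm \<Rightarrow> 'm \<Rightarrow> bool" where
  "is_product C A B X p q \<longleftrightarrow>
     A \<in> Obj C \<and> B \<in> Obj C \<and> X \<in> Obj C \<and> p \<in> Hom C X A \<and> q \<in> Hom C X B \<and>
     (\<forall>Y \<in> Obj C. \<forall>f \<in> Hom C Y A. \<forall>g \<in> Hom C Y B.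
        \<exists>!h. h \<in> Hom C Y X \<and> Comp C p h = f \<and> Comp C q h = g)"

text \<open>The square with sides \<open>p : X \<rightarrow> A\<close>, \<open>f : A' \<rightarrow> A\<close>, \<open>p' : X' \<rightarrow> A'\<close>,
  \<open>f' : X' \<rightarrow> X\<close> is a pullback of \<open>p\<close> along \<open>f\<close>.\<close>

definition is_pullback :: "('o, 'm, 'z) cat_scheme \<Rightarrow> 'm \<Rightarrow> 'm \<Rightarrow> 'm \<Rightarrow> 'm \<Rightarrow> bool" where
  "is_pullback C p f p' f' \<longleftrightarrow>
     p \<in> Arr C \<and> f \<in> Arr C \<and> Cod C f = Cod C p \<and>
     p' \<in> Hom C (Dom C f') (Dom C f) \<and> f' \<in> Hom C (Dom C p') (Dom C p) \<and>
     Comp C p f' = Comp C f p' \<and>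
     (\<forall>Y \<in> Obj C. \<forall>u \<in> Hom C Y (Dom C p). \<forall>v \<in> Hom C Y (Dom C f).
        Comp C p u = Comp C f v \<longrightarrow>
        (\<exists>!h. h \<in> Hom C Y (Dom C p') \<and> Comp C f' h = u \<and> Comp C p' h = v))"

text \<open>A product projection is a leg of an arbitrary product diagram, so that the notion is
  stable under isomorphism and under pullback.\<close>

definition is_projection :: "('o, 'm, 'z) cat_scheme \<Rightarrow> 'm \<Rightarrow> bool" where
  "is_projection C p \<longleftrightarrow>
     (\<exists>A1 A2 X p1 p2. is_product C A1 A2 X p1 p2 \<and> (p = p1 \<or> p = p2))"

record ('o, 'm) fpcat = "('o, 'm) cat" +
  One :: "'o"
  Prod :: "'o \<Rightarrow> 'o \<Rightarrow> 'o"
  Pr1 :: "'o \<Rightarrow> 'o \<Rightarrow> 'm"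
  Pr2 :: "'o \<Rightarrow> 'o \<Rightarrow> 'm"

locale fp_category = category C for C :: "('o, 'm, 'z) fpcat_scheme" +
  assumes one_terminal: "is_terminal C (One C)"
    and prod_product: "A \<in> Obj C \<Longrightarrow> B \<in> Obj C \<Longrightarrow>
      is_product C A B (Prod C A B) (Pr1 C A B) (Pr2 C A B)"

definition tuple :: "('o, 'm, 'z) fpcat_scheme \<Rightarrow> 'm \<Rightarrow> 'm \<Rightarrow> 'm" where
  "tuple C f g = (THE h. h \<in> Hom C (Dom C f) (Prod C (Cod C f) (Cod C g)) \<and>
     Comp C (Pr1 C (Cod C f) (Cod C g)) h = f \<and> Comp C (Pr2 C (Cod C f) (Cod C g)) h = g)"

definition times_arr :: "('o, 'm, 'z) fpcat_scheme \<Rightarrow> 'm \<Rightarrow> 'm \<Rightarrow> 'm" where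
  "times_arr C f g = tuple C (Comp C f (Pr1 C (Dom C f) (Dom C g))) (Comp C g (Pr2 C (Dom C f) (Dom C g)))"

definition diag :: "('o, 'm, 'z) fpcat_scheme \<Rightarrow> 'o \<Rightarrow> 'm" where
  "diag C A = tuple C (Ident C A) (Ident C A)"

text \<open>The three projections from \<open>A \<times> (A \<times> A)\<close>.\<close>

definition tpr1 :: "('o, 'm, 'z) fpcat_scheme \<Rightarrow> 'o \<Rightarrow> 'm" where
  "tpr1 C A = Pr1 C A (Prod C A A)"

definition tpr2 :: "('o, 'm, 'z) fpcat_scheme \<Rightarrow> 'o \<Rightarrow> 'm" where
  "tpr2 C A = Comp C (Pr1 C A A) (Pr2 C A (Prod C A A))"

definition tpr3 :: "('o, 'm, 'z) fpcat_scheme \<Rightarrow> 'o \<Rightarrow> 'm" where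
  "tpr3 C A = Comp C (Pr2 C A A) (Pr2 C A (Prod C A A))"

locale fp_functor =
  source: fp_category C + target: fp_category D
  for C :: "('o, 'm, 'z) fpcat_scheme" and D :: "('o2, 'm2, 'z2) fpcat_scheme" +
  fixes Fo :: "'o \<Rightarrow> 'o2" and Fa :: "'m \<Rightarrow> 'm2"
  assumes map_obj: "A \<in> Obj C \<Longrightarrow> Fo A \<in> Obj D"
    and map_hom: "f \<in> Hom C A B \<Longrightarrow> Fa f \<in> Hom D (Fo A) (Fo B)"
    and map_ident: "A \<in> Obj C \<Longrightarrow> Fa (Ident C A) = Ident D (Fo A)"
    and map_comp: "f \<in> Hom C A B \<Longrightarrow> g \<in> Hom C B E \<Longrightarrow>
      Fa (Comp C g f) = Comp D (Fa g) (Fa f)"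
    and map_terminal: "is_terminal C T \<Longrightarrow> is_terminal D (Fo T)"
    and map_product: "is_product C A B X p q \<Longrightarrow>
      is_product D (Fo A) (Fo B) (Fo X) (Fa p) (Fa q)"


section \<open>Doctrines\<close>

locale inf_sl = lower_semilattice L + weak_partial_order_top L for L (structure)

definition inf_sl_hom :: "'p gorder \<Rightarrow> 'q gorder \<Rightarrow> ('p \<Rightarrow> 'q) \<Rightarrow> bool" where
  "inf_sl_hom L M h \<longleftrightarrow>
     h \<in> carrier L \<rightarrow> carrier M \<and> h \<top>\<^bsub>L\<^esub> = \<top>\<^bsub>M\<^esub> \<and>
     (\<forall>x \<in> carrier L. \<forall>y \<in> carrier L. h (x \<sqinter>\<^bsub>L\<^esub> y) = h x \<sqinter>\<^bsub>M\<^esub> h y)"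

record ('o, 'm, 'p) doctrine =
  Base :: "('o, 'm) fpcat"
  Fib :: "'o \<Rightarrow> 'p gorder"
  Reidx :: "'m \<Rightarrow> 'p \<Rightarrow> 'p"

locale primary_doctrine =
  fixes P :: "('o, 'm, 'p) doctrine"
  assumes base_fp: "fp_category (Base P)"
    and fib_inf_sl: "A \<in> Obj (Base P) \<Longrightarrow> inf_sl (Fib P A)"
    and reidx_hom: "f \<in> Hom (Base P) A B \<Longrightarrow> inf_sl_hom (Fib P B) (Fib P A) (Reidx P f)"
    and reidx_ident: "A \<in> Obj (Base P) \<Longrightarrow> \<alpha> \<in> carrier (Fib P A) \<Longrightarrow>
      Reidx P (Ident (Base P) A) \<alpha> = \<alpha>"
    and reidx_comp: "f \<in> Hom (Base P) A B \<Longrightarrow> g \<in> Hom (Base P) B D \<Longrightarrow>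
      \<alpha> \<in> carrier (Fib P D) \<Longrightarrow>
      Reidx P (Comp (Base P) g f) \<alpha> = Reidx P f (Reidx P g \<alpha>)"

definition is_left_adjoint :: "('o, 'm, 'p) doctrine \<Rightarrow> 'm \<Rightarrow> ('p \<Rightarrow> 'p) \<Rightarrow> bool" where
  "is_left_adjoint P f E \<longleftrightarrow>
     galois_connection \<lparr> orderA = Fib P (Dom (Base P) f), orderB = Fib P (Cod (Base P) f),
       lower = E, upper = Reidx P f \<rparr>"

definition has_left_adjoint :: "('o, 'm, 'p) doctrine \<Rightarrow> 'm \<Rightarrow> bool" where
  "has_left_adjoint P f \<longleftrightarrow> (\<exists>E. is_left_adjoint P f E)"

text \<open>Left adjoints between posets are unique on the carrier, so the choice below is
  immaterial whenever a left adjoint exists.\<close>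

definition ex_along :: "('o, 'm, 'p) doctrine \<Rightarrow> 'm \<Rightarrow> 'p \<Rightarrow> 'p" where
  "ex_along P f = (SOME E. is_left_adjoint P f E)"

definition frobenius :: "('o, 'm, 'p) doctrine \<Rightarrow> 'm \<Rightarrow> bool" where
  "frobenius P f \<longleftrightarrow>
     (\<forall>\<alpha> \<in> carrier (Fib P (Cod (Base P) f)). \<forall>\<beta> \<in> carrier (Fib P (Dom (Base P) f)).
        ex_along P f (Reidx P f \<alpha> \<sqinter>\<^bsub>Fib P (Dom (Base P) f)\<^esub> \<beta>)
          = \<alpha> \<sqinter>\<^bsub>Fib P (Cod (Base P) f)\<^esub> ex_along P f \<beta>)"

definition eq_pred :: "('o, 'm, 'p) doctrine \<Rightarrow> 'o \<Rightarrow> 'p" where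
  "eq_pred P A = ex_along P (diag (Base P) A) \<top>\<^bsub>Fib P A\<^esub>"

definition id_times_diag :: "('o, 'm, 'z) fpcat_scheme \<Rightarrow> 'o \<Rightarrow> 'o \<Rightarrow> 'm" where
  "id_times_diag C D A = times_arr C (Ident C D) (diag C A)"

text \<open>The clause \<open>eq_weakening\<close> is the Beck-Chevalley condition for the left adjoints along
  \<open>id \<times> \<Delta>\<close>. Given \<open>eq_frobenius\<close>, it says that all of them are determined by the fibred
  equality \<open>\<delta>\<close> of \<open>A\<close>, through \<open>\<exists>(\<beta>) = P_{<pr1,pr2>}(\<beta>) \<and> P_{<pr2,pr3>}(\<delta>)\<close>, which is how
  Maietti and Rosolini define elementary doctrines. It is often left implicit, but it does not
  follow from \<open>eq_left_adjoint\<close> and \<open>eq_frobenius\<close>, not even for existential doctrines; without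
  it \<open>\<delta>\<close> of a product need not be the product of the \<open>\<delta>\<close>s, and the functor \<open>J\<close> into the quotient
  completion need not preserve binary products.\<close>

locale elementary_doctrine = primary_doctrine +
  assumes eq_left_adjoint: "D \<in> Obj (Base P) \<Longrightarrow> A \<in> Obj (Base P) \<Longrightarrow>
      has_left_adjoint P (id_times_diag (Base P) D A)"
    and eq_frobenius: "D \<in> Obj (Base P) \<Longrightarrow> A \<in> Obj (Base P) \<Longrightarrow>
      frobenius P (id_times_diag (Base P) D A)"
    and eq_weakening: "D \<in> Obj (Base P) \<Longrightarrow> A \<in> Obj (Base P) \<Longrightarrow>
      ex_along P (id_times_diag (Base P) D A) \<top>\<^bsub>Fib P (Prod (Base P) D A)\<^esub>
        = Reidx P (Pr2 (Base P) D (Prod (Base P) A A)) (eq_pred P A)"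

locale existential_doctrine = primary_doctrine +
  assumes proj_left_adjoint: "is_projection (Base P) p \<Longrightarrow> has_left_adjoint P p"
    and proj_beck_chevalley: "is_projection (Base P) p \<Longrightarrow> is_pullback (Base P) p f p' f' \<Longrightarrow>
      \<beta> \<in> carrier (Fib P (Dom (Base P) p)) \<Longrightarrow>
      ex_along P p' (Reidx P f' \<beta>) = Reidx P f (ex_along P p \<beta>)"
    and proj_frobenius: "is_projection (Base P) p \<Longrightarrow> frobenius P p"

locale doctrine_arrow =
  source: elementary_doctrine P + target: elementary_doctrine R +
  fp_functor "Base P" "Base R" Fo Fa
  for P :: "('o, 'm, 'p) doctrine" and R :: "('o2, 'm2, 'q) doctrine"
    and Fo :: "'o \<Rightarrow> 'o2" and Fa :: "'m \<Rightarrow> 'm2" +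
  fixes b :: "'o \<Rightarrow> 'p \<Rightarrow> 'q"
  assumes component_hom: "A \<in> Obj (Base P) \<Longrightarrow> inf_sl_hom (Fib P A) (Fib R (Fo A)) (b A)"
    and natural: "f \<in> Hom (Base P) A B \<Longrightarrow> \<alpha> \<in> carrier (Fib P B) \<Longrightarrow>
      b A (Reidx P f \<alpha>) = Reidx R (Fa f) (b B \<alpha>)"
    and component_eq_pred: "A \<in> Obj (Base P) \<Longrightarrow>
      b (Prod (Base P) A A) (eq_pred P A)
        = Reidx R (tuple (Base R) (Fa (Pr1 (Base P) A A)) (Fa (Pr2 (Base P) A A)))
            (eq_pred R (Fo A))"

definition preserves_proj_adjoints ::
  "('o, 'm, 'p) doctrine \<Rightarrow> ('o2, 'm2, 'q) doctrine \<Rightarrow> ('m \<Rightarrow> 'm2) \<Rightarrow> ('o \<Rightarrow> 'p \<Rightarrow> 'q) \<Rightarrow> bool" where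
  "preserves_proj_adjoints P R Fa b \<longleftrightarrow>
     (\<forall>p \<beta>. is_projection (Base P) p \<longrightarrow> \<beta> \<in> carrier (Fib P (Dom (Base P) p)) \<longrightarrow>
        b (Cod (Base P) p) (ex_along P p \<beta>) = ex_along R (Fa p) (b (Dom (Base P) p) \<beta>))"


section \<open>The elementary quotient completion\<close>

definition equiv_rel :: "('o, 'm, 'p) doctrine \<Rightarrow> 'o \<Rightarrow> 'p \<Rightarrow> bool" where
  "equiv_rel P A \<rho> \<longleftrightarrow>
     (let C = Base P; AA = Prod C A A; AAA = Prod C A AA in
       \<rho> \<in> carrier (Fib P AA) \<and>
       eq_pred P A \<sqsubseteq>\<^bsub>Fib P AA\<^esub> \<rho> \<and>
       \<rho> \<sqsubseteq>\<^bsub>Fib P AA\<^esub> Reidx P (tuple C (Pr2 C A A) (Pr1 C A A)) \<rho> \<and>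
       Reidx P (tuple C (tpr1 C A) (tpr2 C A)) \<rho>
         \<sqinter>\<^bsub>Fib P AAA\<^esub> Reidx P (tuple C (tpr2 C A) (tpr3 C A)) \<rho>
         \<sqsubseteq>\<^bsub>Fib P AAA\<^esub> Reidx P (tuple C (tpr1 C A) (tpr3 C A)) \<rho>)"

definition des :: "('o, 'm, 'p) doctrine \<Rightarrow> 'o \<Rightarrow> 'p \<Rightarrow> 'p set" where
  "des P A \<rho> = {\<alpha> \<in> carrier (Fib P A).
     Reidx P (Pr1 (Base P) A A) \<alpha> \<sqinter>\<^bsub>Fib P (Prod (Base P) A A)\<^esub> \<rho>
       \<sqsubseteq>\<^bsub>Fib P (Prod (Base P) A A)\<^esub> Reidx P (Pr2 (Base P) A A) \<alpha>}"

definition q_maps :: "('o, 'm, 'p) doctrine \<Rightarrow> 'o \<times> 'p \<Rightarrow> 'o \<times> 'p \<Rightarrow> 'm set" where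
  "q_maps P x y = {f \<in> Hom (Base P) (fst x) (fst y).
     snd x \<sqsubseteq>\<^bsub>Fib P (Prod (Base P) (fst x) (fst x))\<^esub> Reidx P (times_arr (Base P) f f) (snd y)}"

definition q_sim :: "('o, 'm, 'p) doctrine \<Rightarrow> 'o \<times> 'p \<Rightarrow> 'o \<times> 'p \<Rightarrow> ('m \<times> 'm) set" where
  "q_sim P x y = {(f, g). f \<in> q_maps P x y \<and> g \<in> q_maps P x y \<and>
     snd x \<sqsubseteq>\<^bsub>Fib P (Prod (Base P) (fst x) (fst x))\<^esub> Reidx P (times_arr (Base P) f g) (snd y)}"

text \<open>Arrows of the completion carry their source and target explicitly, since a class of
  arrows of the base does not determine the equivalence relations.\<close>

type_synonym ('o, 'm, 'p) q_arr = "('o \<times> 'p) \<times> ('o \<times> 'p) \<times> 'm set"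

definition q_class :: "('o, 'm, 'p) doctrine \<Rightarrow> 'o \<times> 'p \<Rightarrow> 'o \<times> 'p \<Rightarrow> 'm \<Rightarrow> ('o, 'm, 'p) q_arr" where
  "q_class P x y f = (x, y, q_sim P x y `` {f})"

definition q_rep :: "('o, 'm, 'p) q_arr \<Rightarrow> 'm" where
  "q_rep \<phi> = (SOME f. f \<in> snd (snd \<phi>))"

definition q_obj :: "('o, 'm, 'p) doctrine \<Rightarrow> ('o \<times> 'p) set" where
  "q_obj P = {(A, \<rho>). A \<in> Obj (Base P) \<and> equiv_rel P A \<rho>}"

definition box_rel :: "('o, 'm, 'p) doctrine \<Rightarrow> 'o \<times> 'p \<Rightarrow> 'o \<times> 'p \<Rightarrow> 'p" where
  "box_rel P x y =
     (let C = Base P; A = fst x; B = fst y; p = Pr1 C A B; q = Pr2 C A B in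
       Reidx P (times_arr C p p) (snd x)
         \<sqinter>\<^bsub>Fib P (Prod C (Prod C A B) (Prod C A B))\<^esub> Reidx P (times_arr C q q) (snd y))"

definition q_prod :: "('o, 'm, 'p) doctrine \<Rightarrow> 'o \<times> 'p \<Rightarrow> 'o \<times> 'p \<Rightarrow> 'o \<times> 'p" where
  "q_prod P x y = (Prod (Base P) (fst x) (fst y), box_rel P x y)"

definition q_cat :: "('o, 'm, 'p) doctrine \<Rightarrow> ('o \<times> 'p, ('o, 'm, 'p) q_arr) fpcat" where
  "q_cat P =
     \<lparr> Obj = q_obj P,
       Arr = {(x, y, F). x \<in> q_obj P \<and> y \<in> q_obj P \<and> F \<in> q_maps P x y // q_sim P x y},
       Dom = fst,
       Cod = (\<lambda>\<phi>. fst (snd \<phi>)),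
       Ident = (\<lambda>x. q_class P x x (Ident (Base P) (fst x))),
       Comp = (\<lambda>\<psi> \<phi>. q_class P (fst \<phi>) (fst (snd \<psi>)) (Comp (Base P) (q_rep \<psi>) (q_rep \<phi>))),
       One = (One (Base P), eq_pred P (One (Base P))),
       Prod = q_prod P,
       Pr1 = (\<lambda>x y. q_class P (q_prod P x y) x (Pr1 (Base P) (fst x) (fst y))),
       Pr2 = (\<lambda>x y. q_class P (q_prod P x y) y (Pr2 (Base P) (fst x) (fst y))) \<rparr>"

definition quotient_completion ::
  "('o, 'm, 'p) doctrine \<Rightarrow> ('o \<times> 'p, ('o, 'm, 'p) q_arr, 'p) doctrine" where
  "quotient_completion P =
     \<lparr> Base = q_cat P,
       Fib = (\<lambda>x. (Fib P (fst x))\<lparr>carrier := des P (fst x) (snd x)\<rparr>),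
       Reidx = (\<lambda>\<phi>. Reidx P (q_rep \<phi>)) \<rparr>"

definition J_obj :: "('o, 'm, 'p) doctrine \<Rightarrow> 'o \<Rightarrow> 'o \<times> 'p" where
  "J_obj P A = (A, eq_pred P A)"

definition J_arr :: "('o, 'm, 'p) doctrine \<Rightarrow> 'm \<Rightarrow> ('o, 'm, 'p) q_arr" where
  "J_arr P f = q_class P (J_obj P (Dom (Base P) f)) (J_obj P (Cod (Base P) f)) f"

definition j_comp :: "'o \<Rightarrow> 'p \<Rightarrow> 'p" where
  "j_comp A = (\<lambda>\<alpha>. \<alpha>)"

end

theory Submission
  imports Defs
begin


text \<open>Predicates are handled through their generalized elements (Kripke--Joyal semantics), so that a
  \<open>P\<close>-equivalence relation \<open>\<rho>\<close> on \<open>A\<close> becomes an ordinary equivalence relation on the arrows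
  \<open>X \<rightarrow> A\<close>, at each stage. For \<^emph>\<open>every\<close> arrow \<open>[f] : (A, \<rho>) \<rightarrow> (B, \<sigma>)\<close> of the
  completion, \<open>\<beta> \<mapsto> \<exists>a. \<beta> a \<and> \<sigma> (f a, b)\<close> lands in the descent data and is left adjoint to
  reindexing, with Frobenius reciprocity. Along \<open>id \<times> \<Delta>\<close> it shows that the equality predicate of
  \<open>(A, \<rho>)\<close> is \<open>\<rho>\<close>. Beck--Chevalley holds for projections because the legs of a product
  jointly reflect the equivalence relations: given \<open>y\<close> and \<open>z'\<close> with \<open>p y \<sim> f z'\<close>, replace
  \<open>y\<close> by the pair of \<open>f z'\<close> and the other component of \<open>y\<close>, which is equivalent to \<open>y\<close> and lies
  over \<open>f z'\<close> on the nose, so that the pullback property applies to it. The embedding \<open>J\<close> preserves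
  products since fibred equality is substitutive in context, and it preserves \<open>\<exists>\<close> along projections
  by uniqueness of adjoints.\<close>

section \<open>Categories with finite products\<close>

text \<open>Beck-Chevalley does not transfer directly, for two reasons. A square that commutes in
  the completion commutes in the base only up to an equivalence relation, so its representatives
  need not form a square to which the condition of \<open>P\<close> applies. And a hypothesis such
  as p y ~ f z' holds only at a stage, while the pullback property speaks of arrows of the
  completion: no object carved out by a predicate is available as the domain of such an arrow.
  Replacing y by a pair answers the second point: the pair makes sense for all y and z', so the
  pullback property is applied to it over the product of the two objects, and the hypothesis enters
  only afterwards, to compare the pair with y. The adjoint is built for every arrow because a
  projection of the completion is a leg of an arbitrary product diagram, and its representatives
  need not be projections of the base. Its factor \<sigma> (f a, b) closes the image under \<sigma>:
  the image computed in \<open>P\<close> alone need not be descent data.\<close>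

context category
begin

text \<open>The axioms are phrased with \<open>Hom\<close>, whose objects would have to be guessed.
  Side conditions on \<open>Arr\<close>, \<open>Dom\<close> and \<open>Cod\<close> can be computed
  by the simplifier, so that typing is automatic from here on; composites are normalized by nesting
  them to the right.\<close>

lemma arr_comp [simp]: "f \<in> Arr C \<Longrightarrow> g \<in> Arr C \<Longrightarrow> Cod C f = Dom C g \<Longrightarrow> Comp C g f \<in> Arr C"
  and dom_comp [simp]: "f \<in> Arr C \<Longrightarrow> g \<in> Arr C \<Longrightarrow> Cod C f = Dom C g \<Longrightarrow> Dom C (Comp C g f) = Dom C f"
  and cod_comp [simp]: "f \<in> Arr C \<Longrightarrow> g \<in> Arr C \<Longrightarrow> Cod C f = Dom C g \<Longrightarrow> Cod C (Comp C g f) = Cod C g"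
  using comp_hom[of f "Dom C f" "Cod C f" g "Cod C g"] by (simp_all add: Hom_def)

lemma arr_ident [simp]: "A \<in> Obj C \<Longrightarrow> Ident C A \<in> Arr C"
  and dom_ident [simp]: "A \<in> Obj C \<Longrightarrow> Dom C (Ident C A) = A"
  and cod_ident [simp]: "A \<in> Obj C \<Longrightarrow> Cod C (Ident C A) = A"
  using ident_hom[of A] by (simp_all add: Hom_def)

lemma comp_ident_dom [simp]: "f \<in> Arr C \<Longrightarrow> Dom C f = A \<Longrightarrow> Comp C f (Ident C A) = f"
  and comp_ident_cod [simp]: "f \<in> Arr C \<Longrightarrow> Cod C f = A \<Longrightarrow> Comp C (Ident C A) f = f"
  by (auto intro!: comp_ident_right comp_ident_left simp: Hom_def)

lemma comp_assoc_arr [simp]: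
  "f \<in> Arr C \<Longrightarrow> g \<in> Arr C \<Longrightarrow> h \<in> Arr C \<Longrightarrow> Cod C f = Dom C g \<Longrightarrow> Cod C g = Dom C h \<Longrightarrow>
    Comp C (Comp C h g) f = Comp C h (Comp C g f)"
  using comp_assoc[of f "Dom C f" "Cod C f" g "Cod C g" h "Cod C h"] by (simp add: Hom_def)

declare dom_obj [simp] cod_obj [simp]

end

context fp_category
begin

lemma one_obj [simp]: "One C \<in> Obj C"
  using one_terminal by (simp add: is_terminal_def)

lemma prod_obj [simp]: "A \<in> Obj C \<Longrightarrow> B \<in> Obj C \<Longrightarrow> Prod C A B \<in> Obj C"
  and pr1_arr [simp]: "A \<in> Obj C \<Longrightarrow> B \<in> Obj C \<Longrightarrow> Pr1 C A B \<in> Arr C"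
  and pr1_dom [simp]: "A \<in> Obj C \<Longrightarrow> B \<in> Obj C \<Longrightarrow> Dom C (Pr1 C A B) = Prod C A B"
  and pr1_cod [simp]: "A \<in> Obj C \<Longrightarrow> B \<in> Obj C \<Longrightarrow> Cod C (Pr1 C A B) = A"
  and pr2_arr [simp]: "A \<in> Obj C \<Longrightarrow> B \<in> Obj C \<Longrightarrow> Pr2 C A B \<in> Arr C"
  and pr2_dom [simp]: "A \<in> Obj C \<Longrightarrow> B \<in> Obj C \<Longrightarrow> Dom C (Pr2 C A B) = Prod C A B"
  and pr2_cod [simp]: "A \<in> Obj C \<Longrightarrow> B \<in> Obj C \<Longrightarrow> Cod C (Pr2 C A B) = B"
  using prod_product[of A B] by (simp_all add: is_product_def Hom_def)

lemma tuple_the: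
  assumes "f \<in> Arr C" "g \<in> Arr C" "Dom C f = Dom C g"
  shows "tuple C f g \<in> Hom C (Dom C f) (Prod C (Cod C f) (Cod C g)) \<and>
    Comp C (Pr1 C (Cod C f) (Cod C g)) (tuple C f g) = f \<and>
    Comp C (Pr2 C (Cod C f) (Cod C g)) (tuple C f g) = g"
  unfolding tuple_def
  by (rule theI') (use prod_product[of "Cod C f" "Cod C g"] assms in \<open>simp add: is_product_def Hom_def\<close>)

lemma tuple_arr [simp]: "f \<in> Arr C \<Longrightarrow> g \<in> Arr C \<Longrightarrow> Dom C f = Dom C g \<Longrightarrow> tuple C f g \<in> Arr C"
  and tuple_dom [simp]: "f \<in> Arr C \<Longrightarrow> g \<in> Arr C \<Longrightarrow> Dom C f = Dom C g \<Longrightarrow> Dom C (tuple C f g) = Dom C f"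
  and tuple_cod [simp]: "f \<in> Arr C \<Longrightarrow> g \<in> Arr C \<Longrightarrow> Dom C f = Dom C g \<Longrightarrow>
    Cod C (tuple C f g) = Prod C (Cod C f) (Cod C g)"
  and pr1_tuple [simp]: "f \<in> Arr C \<Longrightarrow> g \<in> Arr C \<Longrightarrow> Dom C f = Dom C g \<Longrightarrow>
    Cod C f = A \<Longrightarrow> Cod C g = B \<Longrightarrow> Comp C (Pr1 C A B) (tuple C f g) = f"
  and pr2_tuple [simp]: "f \<in> Arr C \<Longrightarrow> g \<in> Arr C \<Longrightarrow> Dom C f = Dom C g \<Longrightarrow>
    Cod C f = A \<Longrightarrow> Cod C g = B \<Longrightarrow> Comp C (Pr2 C A B) (tuple C f g) = g"
  using tuple_the[of f g] by (auto simp: Hom_def)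

lemma prod_ext:
  assumes "u \<in> Arr C" "v \<in> Arr C" "Dom C u = Dom C v"
    "Cod C u = Prod C A B" "Cod C v = Prod C A B" "A \<in> Obj C" "B \<in> Obj C"
    "Comp C (Pr1 C A B) u = Comp C (Pr1 C A B) v" "Comp C (Pr2 C A B) u = Comp C (Pr2 C A B) v"
  shows "u = v"
proof -
  have "\<exists>!h. h \<in> Hom C (Dom C v) (Prod C A B) \<and> Comp C (Pr1 C A B) h = Comp C (Pr1 C A B) v \<and>
      Comp C (Pr2 C A B) h = Comp C (Pr2 C A B) v"
    using prod_product[of A B] assms by (simp add: is_product_def Hom_def)
  then show ?thesis
    using assms by (auto simp: Hom_def)
qed

lemma tuple_pr_comp [simp]:
  "u \<in> Arr C \<Longrightarrow> Cod C u = Prod C A B \<Longrightarrow> A \<in> Obj C \<Longrightarrow> B \<in> Obj C \<Longrightarrow>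
    tuple C (Comp C (Pr1 C A B) u) (Comp C (Pr2 C A B) u) = u"
  by (rule prod_ext[of _ _ A B]) simp_all

lemma tuple_pr [simp]:
  "A \<in> Obj C \<Longrightarrow> B \<in> Obj C \<Longrightarrow> tuple C (Pr1 C A B) (Pr2 C A B) = Ident C (Prod C A B)"
  by (rule prod_ext[of _ _ A B]) simp_all

lemma comp_tuple [simp]:
  "f \<in> Arr C \<Longrightarrow> g \<in> Arr C \<Longrightarrow> h \<in> Arr C \<Longrightarrow> Dom C f = Dom C g \<Longrightarrow> Cod C h = Dom C f \<Longrightarrow>
    Comp C (tuple C f g) h = tuple C (Comp C f h) (Comp C g h)"
  by (rule prod_ext[of _ _ "Cod C f" "Cod C g"]) (simp_all flip: comp_assoc_arr)

lemma prod_arrE: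
  assumes "u \<in> Arr C" "Cod C u = Prod C A B" "A \<in> Obj C" "B \<in> Obj C"
  obtains a b where "a \<in> Arr C" "b \<in> Arr C" "Dom C a = Dom C u" "Dom C b = Dom C u"
    "Cod C a = A" "Cod C b = B" "u = tuple C a b"
  using assms by (intro that[of "Comp C (Pr1 C A B) u" "Comp C (Pr2 C A B) u"]) simp_all

text \<open>This lemma and the next two evaluate the structural maps on pairs. With them, a
  predicate reindexed along such a map simplifies to the predicate at the expected tuple of
  terms.\<close>

lemma diag_comp [simp]:
  "A \<in> Obj C \<Longrightarrow> diag C A \<in> Arr C" "A \<in> Obj C \<Longrightarrow> Dom C (diag C A) = A"
  "A \<in> Obj C \<Longrightarrow> Cod C (diag C A) = Prod C A A"
  "a \<in> Arr C \<Longrightarrow> Cod C a = A \<Longrightarrow> Comp C (diag C A) a = tuple C a a"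
  by (auto simp: diag_def)

lemma id_times_diag_comp [simp]:
  "D \<in> Obj C \<Longrightarrow> A \<in> Obj C \<Longrightarrow> id_times_diag C D A \<in> Arr C"
  "D \<in> Obj C \<Longrightarrow> A \<in> Obj C \<Longrightarrow> Dom C (id_times_diag C D A) = Prod C D A"
  "D \<in> Obj C \<Longrightarrow> A \<in> Obj C \<Longrightarrow> Cod C (id_times_diag C D A) = Prod C D (Prod C A A)"
  "d \<in> Arr C \<Longrightarrow> a \<in> Arr C \<Longrightarrow> Dom C d = Dom C a \<Longrightarrow> Cod C d = D \<Longrightarrow> Cod C a = A \<Longrightarrow>
    Comp C (id_times_diag C D A) (tuple C d a) = tuple C d (tuple C a a)"
  by (auto simp: id_times_diag_def times_arr_def)

lemma times_arr_comp [simp]: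
  "f \<in> Arr C \<Longrightarrow> g \<in> Arr C \<Longrightarrow> times_arr C f g \<in> Arr C"
  "f \<in> Arr C \<Longrightarrow> g \<in> Arr C \<Longrightarrow> Dom C (times_arr C f g) = Prod C (Dom C f) (Dom C g)"
  "f \<in> Arr C \<Longrightarrow> g \<in> Arr C \<Longrightarrow> Cod C (times_arr C f g) = Prod C (Cod C f) (Cod C g)"
  "f \<in> Arr C \<Longrightarrow> g \<in> Arr C \<Longrightarrow> a \<in> Arr C \<Longrightarrow> b \<in> Arr C \<Longrightarrow> Dom C a = Dom C b \<Longrightarrow>
    Cod C a = Dom C f \<Longrightarrow> Cod C b = Dom C g \<Longrightarrow>
    Comp C (times_arr C f g) (tuple C a b) = tuple C (Comp C f a) (Comp C g b)"
  by (auto simp: times_arr_def)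

text \<open>This square substitutes the term \<open>a\<close> for the free variable of a quantified
  predicate. It is the shape of square at which the Beck-Chevalley condition of \<open>P\<close> is
  applied.\<close>

lemma pullback_pr2:
  assumes "Y \<in> Obj C" "a \<in> Arr C"
  shows "is_pullback C (Pr2 C Y (Cod C a)) a (Pr2 C Y (Dom C a))
    (tuple C (Pr1 C Y (Dom C a)) (Comp C a (Pr2 C Y (Dom C a))))" (is "is_pullback C ?p a ?p' ?f'")
  unfolding is_pullback_def
proof (intro conjI ballI impI)
  fix Z u v
  assume Z: "Z \<in> Obj C" and u: "u \<in> Hom C Z (Dom C ?p)" and v: "v \<in> Hom C Z (Dom C a)"
    and uv: "Comp C ?p u = Comp C a v"
  have "u \<in> Arr C" "Cod C u = Prod C Y (Cod C a)" "Cod C a \<in> Obj C"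
    using u assms by (simp_all add: Hom_def)
  moreover have "Dom C u = Z" using u by (simp add: Hom_def)
  ultimately obtain b c where b: "b \<in> Arr C" "Dom C b = Z" "Cod C b = Y"
    and c: "c \<in> Arr C" "Dom C c = Z" "Cod C c = Cod C a" and bc: "u = tuple C b c"
    using assms(1) prod_arrE[of u Y "Cod C a" thesis] by blast
  have v': "v \<in> Arr C" "Dom C v = Z" "Cod C v = Dom C a" using v by (simp_all add: Hom_def)
  have "c = Comp C a v"
    using uv b c assms unfolding bc by simp
  show "\<exists>!h. h \<in> Hom C Z (Dom C ?p') \<and> Comp C ?f' h = u \<and> Comp C ?p' h = v"
  proof (rule ex1I[of _ "tuple C b v"])
    show "tuple C b v \<in> Hom C Z (Dom C ?p') \<and> Comp C ?f' (tuple C b v) = u \<and> Comp C ?p' (tuple C b v) = v"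
      unfolding bc using v' b c \<open>c = Comp C a v\<close> assms by (simp add: Hom_def)
  next
    fix h
    assume h: "h \<in> Hom C Z (Dom C ?p') \<and> Comp C ?f' h = u \<and> Comp C ?p' h = v"
    have h': "h \<in> Arr C" "Dom C h = Z" "Cod C h = Prod C Y (Dom C a)"
      using h assms by (simp_all add: Hom_def)
    have "Comp C (Pr1 C Y (Cod C a)) (Comp C ?f' h) = Comp C (Pr1 C Y (Cod C a)) (tuple C b c)"
      using h bc by simp
    then have "Comp C (Pr1 C Y (Dom C a)) h = b"
      using h' assms b c by simp
    then show "h = tuple C b v"
      using h h' assms tuple_pr_comp[of h Y "Dom C a"] by simp
  qed
qed (use assms in \<open>simp_all add: Hom_def\<close>)

lemma projection_pr2: "A \<in> Obj C \<Longrightarrow> B \<in> Obj C \<Longrightarrow> is_projection C (Pr2 C A B)"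
  unfolding is_projection_def using prod_product by blast

end

section \<open>Forcing in a primary doctrine\<close>

sublocale primary_doctrine \<subseteq> base: fp_category "Base P"
  by (rule base_fp)

context primary_doctrine
begin

abbreviation C where "C \<equiv> Base P"

abbreviation preds where "preds A \<equiv> carrier (Fib P A)"

section \<open>The fibres as posets with finite meets\<close>

lemma fib_partial_order: "A \<in> Obj C \<Longrightarrow> partial_order (Fib P A)"
  using fib_inf_sl unfolding inf_sl_def lower_semilattice_def by blast

lemma fib_lower_semilattice: "A \<in> Obj C \<Longrightarrow> weak_lower_semilattice (Fib P A)"
proof -
  assume "A \<in> Obj C"
  then interpret inf_sl "Fib P A" by (rule fib_inf_sl)
  show ?thesis ..
qed

lemma fib_top: "A \<in> Obj C \<Longrightarrow> weak_partial_order_top (Fib P A)"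
  using fib_inf_sl unfolding inf_sl_def by blast

lemma fib_weak: "A \<in> Obj C \<Longrightarrow> weak_partial_order (Fib P A)"
  using fib_partial_order unfolding partial_order_def by blast

lemma fib_refl [simp]: "A \<in> Obj C \<Longrightarrow> \<alpha> \<in> preds A \<Longrightarrow> \<alpha> \<sqsubseteq>\<^bsub>Fib P A\<^esub> \<alpha>"
  by (simp add: fib_weak weak_partial_order.le_refl)

lemma fib_trans:
  "A \<in> Obj C \<Longrightarrow> \<alpha> \<sqsubseteq>\<^bsub>Fib P A\<^esub> \<beta> \<Longrightarrow> \<beta> \<sqsubseteq>\<^bsub>Fib P A\<^esub> \<gamma> \<Longrightarrow> \<alpha> \<in> preds A \<Longrightarrow> \<beta> \<in> preds A \<Longrightarrow> \<gamma> \<in> preds A \<Longrightarrow>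
    \<alpha> \<sqsubseteq>\<^bsub>Fib P A\<^esub> \<gamma>"
  by (rule weak_partial_order.le_trans[OF fib_weak])

lemma fib_antisym:
  "A \<in> Obj C \<Longrightarrow> \<alpha> \<sqsubseteq>\<^bsub>Fib P A\<^esub> \<beta> \<Longrightarrow> \<beta> \<sqsubseteq>\<^bsub>Fib P A\<^esub> \<alpha> \<Longrightarrow> \<alpha> \<in> preds A \<Longrightarrow> \<beta> \<in> preds A \<Longrightarrow> \<alpha> = \<beta>"
  by (rule partial_order.le_antisym[OF fib_partial_order])

lemma top_closed [simp]: "A \<in> Obj C \<Longrightarrow> \<top>\<^bsub>Fib P A\<^esub> \<in> preds A"
  by (rule weak_partial_order_top.top_closed[OF fib_top])

lemma le_top [simp]: "A \<in> Obj C \<Longrightarrow> \<alpha> \<in> preds A \<Longrightarrow> \<alpha> \<sqsubseteq>\<^bsub>Fib P A\<^esub> \<top>\<^bsub>Fib P A\<^esub>"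
  by (rule weak_partial_order_top.top_higher[OF fib_top])

lemma meet_closed [simp]:
  "A \<in> Obj C \<Longrightarrow> \<alpha> \<in> preds A \<Longrightarrow> \<beta> \<in> preds A \<Longrightarrow> \<alpha> \<sqinter>\<^bsub>Fib P A\<^esub> \<beta> \<in> preds A"
  by (rule weak_lower_semilattice.meet_closed[OF fib_lower_semilattice])

lemma le_meet_iff:
  assumes "A \<in> Obj C" "\<alpha> \<in> preds A" "\<beta> \<in> preds A" "\<gamma> \<in> preds A"
  shows "\<gamma> \<sqsubseteq>\<^bsub>Fib P A\<^esub> \<alpha> \<sqinter>\<^bsub>Fib P A\<^esub> \<beta> \<longleftrightarrow> \<gamma> \<sqsubseteq>\<^bsub>Fib P A\<^esub> \<alpha> \<and> \<gamma> \<sqsubseteq>\<^bsub>Fib P A\<^esub> \<beta>"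
proof -
  interpret weak_lower_semilattice "Fib P A" using assms(1) by (rule fib_lower_semilattice)
  show ?thesis
    using assms meet_le meet_left meet_right meet_closed le_trans by meson
qed

lemma meet_le1 [simp]: "A \<in> Obj C \<Longrightarrow> \<alpha> \<in> preds A \<Longrightarrow> \<beta> \<in> preds A \<Longrightarrow> \<alpha> \<sqinter>\<^bsub>Fib P A\<^esub> \<beta> \<sqsubseteq>\<^bsub>Fib P A\<^esub> \<alpha>"
  and meet_le2 [simp]: "A \<in> Obj C \<Longrightarrow> \<alpha> \<in> preds A \<Longrightarrow> \<beta> \<in> preds A \<Longrightarrow> \<alpha> \<sqinter>\<^bsub>Fib P A\<^esub> \<beta> \<sqsubseteq>\<^bsub>Fib P A\<^esub> \<beta>"
  using le_meet_iff[of A \<alpha> \<beta> "\<alpha> \<sqinter>\<^bsub>Fib P A\<^esub> \<beta>"] by simp_all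

lemma reidx_closed [simp]:
  "f \<in> Arr C \<Longrightarrow> \<alpha> \<in> preds (Cod C f) \<Longrightarrow> Dom C f = A \<Longrightarrow> Reidx P f \<alpha> \<in> preds A"
  using reidx_hom[of f "Dom C f" "Cod C f"] by (auto simp: inf_sl_hom_def Hom_def)

lemma reidx_meet:
  "f \<in> Arr C \<Longrightarrow> Cod C f = A \<Longrightarrow> \<alpha> \<in> preds A \<Longrightarrow> \<beta> \<in> preds A \<Longrightarrow>
    Reidx P f (\<alpha> \<sqinter>\<^bsub>Fib P A\<^esub> \<beta>) = Reidx P f \<alpha> \<sqinter>\<^bsub>Fib P (Dom C f)\<^esub> Reidx P f \<beta>"
  using reidx_hom[of f "Dom C f" "Cod C f"] by (auto simp: inf_sl_hom_def Hom_def)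

lemma reidx_top [simp]:
  "f \<in> Arr C \<Longrightarrow> Cod C f = A \<Longrightarrow> Reidx P f \<top>\<^bsub>Fib P A\<^esub> = \<top>\<^bsub>Fib P (Dom C f)\<^esub>"
  using reidx_hom[of f "Dom C f" "Cod C f"] by (auto simp: inf_sl_hom_def Hom_def)

text \<open>Monotonicity comes from preservation of meets: \<alpha> \<sqsubseteq> \<beta> amounts to
  the equation \<alpha> \<sqinter> \<beta> = \<alpha>, which reindexing respects.\<close>

lemma reidx_mono:
  assumes "f \<in> Arr C" "Cod C f = A" "\<alpha> \<in> preds A" "\<beta> \<in> preds A" "\<alpha> \<sqsubseteq>\<^bsub>Fib P A\<^esub> \<beta>" "Dom C f = B"
  shows "Reidx P f \<alpha> \<sqsubseteq>\<^bsub>Fib P B\<^esub> Reidx P f \<beta>"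
proof -
  have "A \<in> Obj C" using assms by auto
  then have "\<alpha> \<sqinter>\<^bsub>Fib P A\<^esub> \<beta> = \<alpha>"
    using assms le_meet_iff[of A \<alpha> \<beta>] by (intro fib_antisym[of A]) auto
  then have "Reidx P f \<alpha> \<sqsubseteq>\<^bsub>Fib P B\<^esub> Reidx P f \<alpha> \<sqinter>\<^bsub>Fib P B\<^esub> Reidx P f \<beta>"
    using reidx_meet[of f A \<alpha> \<beta>] assms by auto
  then show ?thesis
    using le_meet_iff[of B "Reidx P f \<alpha>" "Reidx P f \<beta>" "Reidx P f \<alpha>"] assms by auto
qed

lemma reidx_reidx [simp]:
  "f \<in> Arr C \<Longrightarrow> g \<in> Arr C \<Longrightarrow> Cod C f = Dom C g \<Longrightarrow> \<alpha> \<in> preds (Cod C g) \<Longrightarrow>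
    Reidx P f (Reidx P g \<alpha>) = Reidx P (Comp C g f) \<alpha>"
  using reidx_comp[of f "Dom C f" "Cod C f" g "Cod C g"] by (simp add: Hom_def)

declare reidx_ident [simp]

text \<open>Kripke--Joyal semantics: \<open>forces \<xi> a \<alpha>\<close> says that \<open>\<alpha>\<close> holds of the generalized element
  \<open>a\<close> at the stage \<open>\<xi>\<close>, a predicate on the domain of \<open>a\<close>. It reduces inequalities between
  predicates to first-order reasoning about generalized elements.\<close>

definition forces :: "'p \<Rightarrow> 'm \<Rightarrow> 'p \<Rightarrow> bool" where
  "forces \<xi> a \<alpha> \<longleftrightarrow> a \<in> Arr C \<and> \<alpha> \<in> preds (Cod C a) \<and> \<xi> \<in> preds (Dom C a) \<and>
    \<xi> \<sqsubseteq>\<^bsub>Fib P (Dom C a)\<^esub> Reidx P a \<alpha>"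

lemma forces_typing:
  "forces \<xi> a \<alpha> \<Longrightarrow> a \<in> Arr C" "forces \<xi> a \<alpha> \<Longrightarrow> \<alpha> \<in> preds (Cod C a)"
  "forces \<xi> a \<alpha> \<Longrightarrow> \<xi> \<in> preds (Dom C a)"
  by (auto simp: forces_def)

text \<open>Reindexing is substitution: as a simp rule, it moves every reindexing from the predicate
  into the element.\<close>

lemma forces_reidx [simp]:
  "a \<in> Arr C \<Longrightarrow> f \<in> Arr C \<Longrightarrow> Cod C a = Dom C f \<Longrightarrow> \<alpha> \<in> preds (Cod C f) \<Longrightarrow>
    forces \<xi> a (Reidx P f \<alpha>) \<longleftrightarrow> forces \<xi> (Comp C f a) \<alpha>"
  by (simp add: forces_def)

lemma forces_meet [simp]:
  "Cod C a = A \<Longrightarrow> \<alpha> \<in> preds A \<Longrightarrow> \<beta> \<in> preds A \<Longrightarrow>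
    forces \<xi> a (\<alpha> \<sqinter>\<^bsub>Fib P A\<^esub> \<beta>) \<longleftrightarrow> forces \<xi> a \<alpha> \<and> forces \<xi> a \<beta>"
  by (auto simp: forces_def reidx_meet le_meet_iff)

lemma forces_top [simp]:
  "a \<in> Arr C \<Longrightarrow> Cod C a = A \<Longrightarrow> forces \<xi> a \<top>\<^bsub>Fib P A\<^esub> \<longleftrightarrow> \<xi> \<in> preds (Dom C a)"
  by (auto simp: forces_def)

lemma forces_ident: "A \<in> Obj C \<Longrightarrow> \<alpha> \<in> preds A \<Longrightarrow> forces \<xi> (Ident C A) \<alpha> \<longleftrightarrow> \<xi> \<in> preds A \<and> \<xi> \<sqsubseteq>\<^bsub>Fib P A\<^esub> \<alpha>"
  by (auto simp: forces_def)

text \<open>Kripke monotonicity. The arrow \<open>h\<close> is a change of stage, and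
  \<open>forces \<xi>' h \<xi>\<close> says that \<xi>' lies over \<xi> along it.\<close>

lemma forces_stage:
  assumes "forces \<xi>' h \<xi>" "forces \<xi> a \<alpha>" "Cod C h = Dom C a"
  shows "forces \<xi>' (Comp C a h) \<alpha>"
proof -
  have h: "h \<in> Arr C" "\<xi> \<in> preds (Cod C h)" "\<xi>' \<in> preds (Dom C h)"
    "\<xi>' \<sqsubseteq>\<^bsub>Fib P (Dom C h)\<^esub> Reidx P h \<xi>"
    using assms(1) unfolding forces_def by blast+
  have a: "a \<in> Arr C" "\<alpha> \<in> preds (Cod C a)" "\<xi> \<sqsubseteq>\<^bsub>Fib P (Dom C a)\<^esub> Reidx P a \<alpha>"
    using assms(2) unfolding forces_def by blast+
  have "Reidx P h \<xi> \<sqsubseteq>\<^bsub>Fib P (Dom C h)\<^esub> Reidx P h (Reidx P a \<alpha>)"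
    using a h assms(3) by (intro reidx_mono[where A = "Dom C a"]) simp_all
  then have "\<xi>' \<sqsubseteq>\<^bsub>Fib P (Dom C h)\<^esub> Reidx P (Comp C a h) \<alpha>"
    using a h assms(3) fib_trans[of "Dom C h" \<xi>' "Reidx P h \<xi>"] by simp
  then show ?thesis
    using a h assms(3) by (simp add: forces_def)
qed

text \<open>The inequality says that the generic element of \<alpha>, the identity at stage
  \<alpha>, satisfies \<beta>. Any other element that satisfies \<alpha> is obtained from the
  generic one by a change of stage.\<close>

lemma forces_mono:
  assumes "\<alpha> \<sqsubseteq>\<^bsub>Fib P A\<^esub> \<beta>" "\<beta> \<in> preds A" "Cod C a = A" "forces \<xi> a \<alpha>"
  shows "forces \<xi> a \<beta>"
proof -
  have "a \<in> Arr C" "\<alpha> \<in> preds A" "A \<in> Obj C"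
    using assms(3) forces_typing[OF assms(4)] by auto
  moreover from this have "forces \<alpha> (Ident C A) \<beta>"
    using assms by (simp add: forces_ident)
  ultimately show ?thesis
    using forces_stage[OF assms(4), of "Ident C A" \<beta>] assms(3) by simp
qed

text \<open>Instantiating the premise at the generic element, the identity at stage \<alpha>, gives
  back the inequality.\<close>

lemma le_forcesI:
  assumes "\<alpha> \<in> preds A" "\<beta> \<in> preds A" "A \<in> Obj C"
    and "\<And>a \<xi>. a \<in> Arr C \<Longrightarrow> Cod C a = A \<Longrightarrow> \<xi> \<in> preds (Dom C a) \<Longrightarrow> forces \<xi> a \<alpha> \<Longrightarrow> forces \<xi> a \<beta>"
  shows "\<alpha> \<sqsubseteq>\<^bsub>Fib P A\<^esub> \<beta>"
  using assms(4)[of "Ident C A" \<alpha>] assms(1-3) by (simp add: forces_ident)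

lemma le_forces_prodI:
  assumes "\<alpha> \<in> preds (Prod C A B)" "\<beta> \<in> preds (Prod C A B)" "A \<in> Obj C" "B \<in> Obj C"
    and "\<And>a b \<xi>. a \<in> Arr C \<Longrightarrow> b \<in> Arr C \<Longrightarrow> Dom C a = Dom C b \<Longrightarrow> Cod C a = A \<Longrightarrow> Cod C b = B \<Longrightarrow>
      \<xi> \<in> preds (Dom C b) \<Longrightarrow> forces \<xi> (tuple C a b) \<alpha> \<Longrightarrow> forces \<xi> (tuple C a b) \<beta>"
  shows "\<alpha> \<sqsubseteq>\<^bsub>Fib P (Prod C A B)\<^esub> \<beta>"
proof (rule le_forcesI)
  fix u \<xi> assume u: "u \<in> Arr C" "Cod C u = Prod C A B" "\<xi> \<in> preds (Dom C u)" "forces \<xi> u \<alpha>"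
  then show "forces \<xi> u \<beta>"
    using assms(3,4) assms(5)[of "Comp C (Pr1 C A B) u" "Comp C (Pr2 C A B) u" \<xi>] by simp
qed (use assms in auto)

section \<open>Left adjoints to reindexing and their uniqueness\<close>

lemma is_left_adjoint_iff:
  assumes "f \<in> Arr C"
  shows "is_left_adjoint P f E \<longleftrightarrow> E \<in> preds (Dom C f) \<rightarrow> preds (Cod C f) \<and>
    (\<forall>\<beta> \<in> preds (Dom C f). \<forall>\<alpha> \<in> preds (Cod C f).
      E \<beta> \<sqsubseteq>\<^bsub>Fib P (Cod C f)\<^esub> \<alpha> \<longleftrightarrow> \<beta> \<sqsubseteq>\<^bsub>Fib P (Dom C f)\<^esub> Reidx P f \<alpha>)"
  using assms fib_partial_order
  by (auto simp: is_left_adjoint_def galois_connection_def galois_connection_axioms_def connection_def)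

text \<open>Each of the two values lies below the other, by transposing the unit of the other
  adjunction.\<close>

lemma ex_along_eq:
  assumes "f \<in> Arr C" "is_left_adjoint P f E" "\<beta> \<in> preds (Dom C f)"
  shows "ex_along P f \<beta> = E \<beta>"
proof -
  have E: "is_left_adjoint P f (ex_along P f)"
    unfolding ex_along_def using assms(2) by (rule someI[of "is_left_adjoint P f"])
  then have cl: "ex_along P f \<beta> \<in> preds (Cod C f)" "E \<beta> \<in> preds (Cod C f)"
    using assms by (auto simp: is_left_adjoint_iff)
  then have "\<beta> \<sqsubseteq>\<^bsub>Fib P (Dom C f)\<^esub> Reidx P f (E \<beta>)" "\<beta> \<sqsubseteq>\<^bsub>Fib P (Dom C f)\<^esub> Reidx P f (ex_along P f \<beta>)"
    using E assms fib_refl[of "Cod C f"] is_left_adjoint_iff[OF assms(1)] base.cod_obj by blast+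
  then show ?thesis
    using E assms cl by (intro fib_antisym[of "Cod C f"]) (simp_all add: is_left_adjoint_iff)
qed

lemma ex_along_adjoint:
  assumes "f \<in> Arr C" "has_left_adjoint P f"
  shows "\<beta> \<in> preds (Dom C f) \<Longrightarrow> ex_along P f \<beta> \<in> preds (Cod C f)"
    and "\<beta> \<in> preds (Dom C f) \<Longrightarrow> \<alpha> \<in> preds (Cod C f) \<Longrightarrow>
      ex_along P f \<beta> \<sqsubseteq>\<^bsub>Fib P (Cod C f)\<^esub> \<alpha> \<longleftrightarrow> \<beta> \<sqsubseteq>\<^bsub>Fib P (Dom C f)\<^esub> Reidx P f \<alpha>"
proof -
  have "is_left_adjoint P f (ex_along P f)"
    unfolding ex_along_def using assms(2)[unfolded has_left_adjoint_def] by (rule someI_ex[of "is_left_adjoint P f"])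
  then show "\<beta> \<in> preds (Dom C f) \<Longrightarrow> ex_along P f \<beta> \<in> preds (Cod C f)"
    and "\<beta> \<in> preds (Dom C f) \<Longrightarrow> \<alpha> \<in> preds (Cod C f) \<Longrightarrow>
      ex_along P f \<beta> \<sqsubseteq>\<^bsub>Fib P (Cod C f)\<^esub> \<alpha> \<longleftrightarrow> \<beta> \<sqsubseteq>\<^bsub>Fib P (Dom C f)\<^esub> Reidx P f \<alpha>"
    using assms(1) by (auto simp: is_left_adjoint_iff)
qed

end

section \<open>Equality and existential quantification\<close>

context elementary_doctrine
begin

text \<open>The axioms give adjoints along id \<times> \<Delta> only. The adjoint along \<Delta> is
  the case of the terminal context, conjugated by the isomorphisms that drop a terminal
  factor.\<close>

lemma diag_left_adjoint:
  assumes A: "A \<in> Obj C"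
  shows "has_left_adjoint P (diag C A)"
proof -
  let ?I = "One C" and ?AA = "Prod C A A"
  have obj: "?AA \<in> Obj C" "?I \<in> Obj C" using A by simp_all
  have terminal_arr: "\<exists>t \<in> Arr C. Dom C t = B \<and> Cod C t = ?I" if "B \<in> Obj C" for B
    using base.one_terminal that unfolding is_terminal_def Hom_def by blast
  have term_unique: "t = t'" if "t \<in> Arr C" "t' \<in> Arr C" "Dom C t = Dom C t'" "Cod C t = ?I" "Cod C t' = ?I" for t t'
  proof -
    have "\<exists>!h. h \<in> Hom C (Dom C t) ?I"
      using base.one_terminal that by (simp add: is_terminal_def)
    then show ?thesis using that by (auto simp: Hom_def)
  qed
  obtain s where s: "s \<in> Arr C" "Dom C s = A" "Cod C s = ?I" using terminal_arr A by blast
  obtain t where t: "t \<in> Arr C" "Dom C t = ?AA" "Cod C t = ?I" using terminal_arr obj by blast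
  \<comment> \<open>\<open>i\<close> and \<open>p\<close> are mutually inverse: they identify A
    \<times> A with 1 \<times> (A \<times> A).\<close>
  define i where "i = tuple C t (Ident C ?AA)"
  define p where "p = Pr2 C ?I ?AA"
  have i: "i \<in> Arr C" "Dom C i = ?AA" "Cod C i = Prod C ?I ?AA" 
    and p: "p \<in> Arr C" "Dom C p = Prod C ?I ?AA" "Cod C p = ?AA"
    using t obj by (simp_all add: i_def p_def)
  have "Comp C p i = Ident C ?AA"
    using t obj by (simp add: i_def p_def)
  have "Comp C t p = Pr1 C ?I ?AA"
    by (rule term_unique) (use t p obj in \<open>simp_all\<close>)
  then have "Comp C i p = Ident C (Prod C ?I ?AA)"
    using t p obj by (simp add: i_def) (simp add: p_def)
  define E where "E = ex_along P (id_times_diag C ?I A)"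
  have E_closed: "E \<beta> \<in> preds (Prod C ?I ?AA)" if "\<beta> \<in> preds (Prod C ?I A)" for \<beta>
    using ex_along_adjoint(1)[OF _ eq_left_adjoint[of ?I A], of \<beta>] that A obj by (simp add: E_def)
  have E_adj: "E \<beta> \<sqsubseteq>\<^bsub>Fib P (Prod C ?I ?AA)\<^esub> \<alpha> \<longleftrightarrow>
      \<beta> \<sqsubseteq>\<^bsub>Fib P (Prod C ?I A)\<^esub> Reidx P (id_times_diag C ?I A) \<alpha>"
    if "\<beta> \<in> preds (Prod C ?I A)" "\<alpha> \<in> preds (Prod C ?I ?AA)" for \<beta> \<alpha>
    using ex_along_adjoint(2)[OF _ eq_left_adjoint[of ?I A], of \<beta> \<alpha>] that A obj by (simp add: E_def)
  have "is_left_adjoint P (diag C A) (\<lambda>\<beta>. Reidx P i (E (Reidx P (Pr2 C ?I A) \<beta>)))"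
    unfolding is_left_adjoint_iff[OF base.diag_comp(1)[OF A]]
  proof (intro conjI ballI)
    show "(\<lambda>\<beta>. Reidx P i (E (Reidx P (Pr2 C ?I A) \<beta>))) \<in> preds (Dom C (diag C A)) \<rightarrow> preds (Cod C (diag C A))"
      using A obj E_closed i by simp
    fix \<beta> \<gamma> assume "\<beta> \<in> preds (Dom C (diag C A))" "\<gamma> \<in> preds (Cod C (diag C A))"
    then have \<beta>: "\<beta> \<in> preds A" and \<gamma>: "\<gamma> \<in> preds ?AA" using A by simp_all
    let ?\<beta> = "Reidx P (Pr2 C ?I A) \<beta>"
    have \<beta>': "?\<beta> \<in> preds (Prod C ?I A)" using \<beta> A obj by simp
    \<comment> \<open>Reindexing along \<open>i\<close> and along \<open>p\<close> are inverse order
      isomorphisms, so \<open>i\<close> on the left can be traded for \<open>p\<close> on the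
      right.\<close>
    have "Reidx P i (E ?\<beta>) \<sqsubseteq>\<^bsub>Fib P ?AA\<^esub> \<gamma> \<longleftrightarrow> E ?\<beta> \<sqsubseteq>\<^bsub>Fib P (Prod C ?I ?AA)\<^esub> Reidx P p \<gamma>"
    proof
      assume "Reidx P i (E ?\<beta>) \<sqsubseteq>\<^bsub>Fib P ?AA\<^esub> \<gamma>"
      then have "Reidx P p (Reidx P i (E ?\<beta>)) \<sqsubseteq>\<^bsub>Fib P (Prod C ?I ?AA)\<^esub> Reidx P p \<gamma>"
        using E_closed[OF \<beta>'] i p \<gamma> by (intro reidx_mono[where A = ?AA]) simp_all
      then show "E ?\<beta> \<sqsubseteq>\<^bsub>Fib P (Prod C ?I ?AA)\<^esub> Reidx P p \<gamma>"
        using E_closed[OF \<beta>'] i p obj \<open>Comp C i p = _\<close> by simp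
    next
      assume "E ?\<beta> \<sqsubseteq>\<^bsub>Fib P (Prod C ?I ?AA)\<^esub> Reidx P p \<gamma>"
      then have "Reidx P i (E ?\<beta>) \<sqsubseteq>\<^bsub>Fib P ?AA\<^esub> Reidx P i (Reidx P p \<gamma>)"
        using E_closed[OF \<beta>'] i p \<gamma> by (intro reidx_mono[where A = "Prod C ?I ?AA"]) simp_all
      then show "Reidx P i (E ?\<beta>) \<sqsubseteq>\<^bsub>Fib P ?AA\<^esub> \<gamma>"
        using i p obj \<gamma> \<open>Comp C p i = _\<close> by simp
    qed
    also have "\<dots> \<longleftrightarrow> ?\<beta> \<sqsubseteq>\<^bsub>Fib P (Prod C ?I A)\<^esub> Reidx P (Comp C (diag C A) (Pr2 C ?I A)) \<gamma>"
    proof -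
      have "Comp C p (id_times_diag C ?I A) = Comp C (diag C A) (Pr2 C ?I A)"
        using A obj by (simp add: p_def id_times_diag_def times_arr_def)
      then show ?thesis
        using E_adj[OF \<beta>', of "Reidx P p \<gamma>"] \<gamma> A obj p by simp
    qed
    also have "\<dots> \<longleftrightarrow> \<beta> \<sqsubseteq>\<^bsub>Fib P A\<^esub> Reidx P (diag C A) \<gamma>"
    proof
      assume *: "?\<beta> \<sqsubseteq>\<^bsub>Fib P (Prod C ?I A)\<^esub> Reidx P (Comp C (diag C A) (Pr2 C ?I A)) \<gamma>"
      \<comment> \<open>Pairing \<open>s\<close> with the identity gives a section of the second
        projection from 1 \<times> A, so reindexing along it cancels that projection.\<close>
      have "Reidx P (tuple C s (Ident C A)) ?\<beta> \<sqsubseteq>\<^bsub>Fib P A\<^esub>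
          Reidx P (tuple C s (Ident C A)) (Reidx P (Comp C (diag C A) (Pr2 C ?I A)) \<gamma>)"
        using * A obj s \<beta> \<gamma> by (intro reidx_mono[where A = "Prod C ?I A"]) simp_all
      then show "\<beta> \<sqsubseteq>\<^bsub>Fib P A\<^esub> Reidx P (diag C A) \<gamma>"
        using A obj s \<beta> \<gamma> by (simp add: diag_def)
    next
      assume "\<beta> \<sqsubseteq>\<^bsub>Fib P A\<^esub> Reidx P (diag C A) \<gamma>"
      then have "?\<beta> \<sqsubseteq>\<^bsub>Fib P (Prod C ?I A)\<^esub> Reidx P (Pr2 C ?I A) (Reidx P (diag C A) \<gamma>)"
        using A obj \<beta> \<gamma> by (intro reidx_mono[where A = A]) simp_all
      then show "?\<beta> \<sqsubseteq>\<^bsub>Fib P (Prod C ?I A)\<^esub> Reidx P (Comp C (diag C A) (Pr2 C ?I A)) \<gamma>"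
        using A obj \<beta> \<gamma> by simp
    qed
    finally show "Reidx P i (E ?\<beta>) \<sqsubseteq>\<^bsub>Fib P (Cod C (diag C A))\<^esub> \<gamma> \<longleftrightarrow>
        \<beta> \<sqsubseteq>\<^bsub>Fib P (Dom C (diag C A))\<^esub> Reidx P (diag C A) \<gamma>"
      using A by simp
  qed
  then show ?thesis
    unfolding has_left_adjoint_def by blast
qed

lemma eq_pred_closed [simp]: "A \<in> Obj C \<Longrightarrow> eq_pred P A \<in> preds (Prod C A A)"
  using ex_along_adjoint(1)[OF _ diag_left_adjoint[of A], of "\<top>\<^bsub>Fib P A\<^esub>"] by (simp add: eq_pred_def)

lemma eq_pred_le_iff:
  "A \<in> Obj C \<Longrightarrow> \<rho> \<in> preds (Prod C A A) \<Longrightarrow>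
    eq_pred P A \<sqsubseteq>\<^bsub>Fib P (Prod C A A)\<^esub> \<rho> \<longleftrightarrow> \<top>\<^bsub>Fib P A\<^esub> \<sqsubseteq>\<^bsub>Fib P A\<^esub> Reidx P (diag C A) \<rho>"
  using ex_along_adjoint(2)[OF _ diag_left_adjoint[of A], of "\<top>\<^bsub>Fib P A\<^esub>" \<rho>] by (simp add: eq_pred_def)

lemma forces_refl_of_eq_pred_le:
  assumes "A \<in> Obj C" "\<rho> \<in> preds (Prod C A A)" "eq_pred P A \<sqsubseteq>\<^bsub>Fib P (Prod C A A)\<^esub> \<rho>"
    and "a \<in> Arr C" "Cod C a = A" "\<xi> \<in> preds (Dom C a)"
  shows "forces \<xi> (tuple C a a) \<rho>"
proof -
  have "forces \<xi> a (Reidx P (diag C A) \<rho>)"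
    by (rule forces_mono[where \<alpha> = "\<top>\<^bsub>Fib P A\<^esub>" and A = A]) (use assms eq_pred_le_iff[of A \<rho>] in simp_all)
  then show ?thesis using assms by simp
qed

lemma forces_eq_refl:
  "a \<in> Arr C \<Longrightarrow> Cod C a = A \<Longrightarrow> \<xi> \<in> preds (Dom C a) \<Longrightarrow> forces \<xi> (tuple C a a) (eq_pred P A)"
  by (rule forces_refl_of_eq_pred_le) auto

text \<open>Leibniz's rule with a parameter. By Frobenius and \<open>eq_weakening\<close>, the image
  of \<gamma> along id \<times> \<Delta> is \<gamma> (d, a) \<and> a = b; by adjunction it lies
  below \<gamma> (d, b), because \<gamma> (d, b) restricts to \<gamma> on the diagonal.\<close>

lemma forces_eq_subst:
  assumes "a \<in> Arr C" "b \<in> Arr C" "d \<in> Arr C" "Dom C a = X" "Dom C b = X" "Dom C d = X"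
    "Cod C a = A" "Cod C b = A" "Cod C d = D"
    and \<gamma>: "\<gamma> \<in> preds (Prod C D A)"
    and eq: "forces \<xi> (tuple C a b) (eq_pred P A)" and da: "forces \<xi> (tuple C d a) \<gamma>"
  shows "forces \<xi> (tuple C d b) \<gamma>"
proof -
  have obj [simp]: "A \<in> Obj C" "D \<in> Obj C" using assms by auto
  let ?AA = "Prod C A A"
  let ?p1 = "Pr1 C D ?AA" and ?p2 = "Pr2 C D ?AA"
  let ?q1 = "Comp C (Pr1 C A A) ?p2" and ?q2 = "Comp C (Pr2 C A A) ?p2"
  let ?i = "id_times_diag C D A"
  have adj: "has_left_adjoint P ?i" and frob: "frobenius P ?i"
    by (simp_all add: eq_left_adjoint eq_frobenius)
  have i1: "Comp C ?p1 ?i = Pr1 C D A" and i2: "Comp C ?p2 ?i = tuple C (Pr2 C D A) (Pr2 C D A)"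
    by (simp_all add: id_times_diag_def times_arr_def)
  \<comment> \<open>Over the triples (d, (a, b)), these are \<gamma> (d, a) and \<gamma> (d, b).
    Both restrict to \<gamma> along id \<times> \<Delta>.\<close>
  let ?\<gamma>1 = "Reidx P (tuple C ?p1 ?q1) \<gamma>" and ?\<gamma>2 = "Reidx P (tuple C ?p1 ?q2) \<gamma>"
  have cl: "?\<gamma>1 \<in> preds (Prod C D ?AA)" "?\<gamma>2 \<in> preds (Prod C D ?AA)"
    using \<gamma> by simp_all
  have "Reidx P ?i ?\<gamma>1 = \<gamma>" "Reidx P ?i ?\<gamma>2 = \<gamma>"
    using \<gamma> by (simp_all add: i1 i2)
  moreover have "\<gamma> \<sqinter>\<^bsub>Fib P (Prod C D A)\<^esub> \<top>\<^bsub>Fib P (Prod C D A)\<^esub> = \<gamma>"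
    using \<gamma> by (intro fib_antisym[of "Prod C D A"]) (simp_all add: le_meet_iff)
  \<comment> \<open>Frobenius at \<top>, whose image is the weakened equality predicate.\<close>
  moreover have "ex_along P ?i (Reidx P ?i ?\<gamma>1 \<sqinter>\<^bsub>Fib P (Prod C D A)\<^esub> \<top>\<^bsub>Fib P (Prod C D A)\<^esub>) =
      ?\<gamma>1 \<sqinter>\<^bsub>Fib P (Prod C D ?AA)\<^esub> ex_along P ?i \<top>\<^bsub>Fib P (Prod C D A)\<^esub>"
    using frob cl unfolding frobenius_def by simp
  ultimately have "ex_along P ?i \<gamma> = ?\<gamma>1 \<sqinter>\<^bsub>Fib P (Prod C D ?AA)\<^esub> Reidx P ?p2 (eq_pred P A)"
    by (simp add: eq_weakening)
  moreover have "ex_along P ?i \<gamma> \<sqsubseteq>\<^bsub>Fib P (Prod C D ?AA)\<^esub> ?\<gamma>2"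
    using ex_along_adjoint(2)[OF _ adj, of \<gamma> ?\<gamma>2] \<gamma> cl \<open>Reidx P ?i ?\<gamma>2 = \<gamma>\<close> by simp
  ultimately have le: "?\<gamma>1 \<sqinter>\<^bsub>Fib P (Prod C D ?AA)\<^esub> Reidx P ?p2 (eq_pred P A) \<sqsubseteq>\<^bsub>Fib P (Prod C D ?AA)\<^esub> ?\<gamma>2"
    by simp
  have "forces \<xi> (tuple C d (tuple C a b)) ?\<gamma>2"
    by (rule forces_mono[OF le]) (use assms cl in simp_all)
  then show ?thesis
    using assms by simp
qed

end

section \<open>Introduction and elimination of existential quantifiers\<close>

context existential_doctrine
begin

abbreviation ex where "ex Y A \<equiv> ex_along P (Pr2 C Y A)"

lemma ex_closed [simp]:
  "Y \<in> Obj C \<Longrightarrow> A \<in> Obj C \<Longrightarrow> \<gamma> \<in> preds (Prod C Y A) \<Longrightarrow> ex Y A \<gamma> \<in> preds A"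
  using ex_along_adjoint(1)[OF _ proj_left_adjoint[OF base.projection_pr2[of Y A]], of \<gamma>] by simp

lemma ex_le_iff:
  "Y \<in> Obj C \<Longrightarrow> A \<in> Obj C \<Longrightarrow> \<gamma> \<in> preds (Prod C Y A) \<Longrightarrow> \<alpha> \<in> preds A \<Longrightarrow>
    ex Y A \<gamma> \<sqsubseteq>\<^bsub>Fib P A\<^esub> \<alpha> \<longleftrightarrow> \<gamma> \<sqsubseteq>\<^bsub>Fib P (Prod C Y A)\<^esub> Reidx P (Pr2 C Y A) \<alpha>"
  using ex_along_adjoint(2)[OF _ proj_left_adjoint[OF base.projection_pr2[of Y A]], of \<gamma> \<alpha>] by simp

text \<open>The unit of the adjunction, evaluated at the pair of the witness \<open>y\<close> and
  the element \<open>a\<close>.\<close>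

lemma forces_exI:
  assumes "y \<in> Arr C" "a \<in> Arr C" "Dom C y = Dom C a" "Cod C y = Y" "Cod C a = A"
    "forces \<xi> (tuple C y a) \<gamma>"
  shows "forces \<xi> a (ex Y A \<gamma>)"
proof -
  have obj: "Y \<in> Obj C" "A \<in> Obj C" using assms by auto
  have \<gamma>: "\<gamma> \<in> preds (Prod C Y A)" using forces_typing(2)[OF assms(6)] assms(1-5) by simp
  have "\<gamma> \<sqsubseteq>\<^bsub>Fib P (Prod C Y A)\<^esub> Reidx P (Pr2 C Y A) (ex Y A \<gamma>)"
    using ex_le_iff[of Y A \<gamma> "ex Y A \<gamma>"] obj \<gamma> by simp
  from forces_mono[OF this _ _ assms(6)] show ?thesis
    using assms obj \<gamma> by simp
qed

text \<open>A witness exists only after a change of stage, hence the \<open>h\<close> in the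
  premise. Beck-Chevalley turns the quantified predicate at \<open>a\<close> into a quantified
  predicate over the stage, and Frobenius moves \<xi> under that quantifier. The conclusion concerns
  a separate element \<open>b\<close> over the same domain, so that the rule can prove any
  goal.\<close>

lemma forces_exE:
  assumes ex: "forces \<xi> a (ex Y A \<gamma>)" and a: "Cod C a = A" and \<gamma>: "\<gamma> \<in> preds (Prod C Y A)" and Y: "Y \<in> Obj C"
    and b: "b \<in> Arr C" "Dom C b = Dom C a" and \<psi>: "\<psi> \<in> preds (Cod C b)"
    and step: "\<And>h y \<xi>'. h \<in> Arr C \<Longrightarrow> y \<in> Arr C \<Longrightarrow> Dom C y = Dom C h \<Longrightarrow> Cod C h = Dom C a \<Longrightarrow> Cod C y = Y \<Longrightarrow>
      forces \<xi>' h \<xi> \<Longrightarrow> forces \<xi>' (tuple C y (Comp C a h)) \<gamma> \<Longrightarrow> forces \<xi>' (Comp C b h) \<psi>"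
  shows "forces \<xi> b \<psi>"
proof -
  have a': "a \<in> Arr C" and \<xi>: "\<xi> \<in> preds (Dom C a)" using forces_typing[OF ex] by auto
  have A: "A \<in> Obj C" using a a' by auto
  define X where "X = Dom C a"
  have X: "X \<in> Obj C" "Dom C a = X" "Dom C b = X" "\<xi> \<in> preds X" using a' b \<xi> by (simp_all add: X_def)
  \<comment> \<open>The generic witness is the first projection from Y \<times> X; its stage is
    \<xi> weakened to Y \<times> X and cut down by \<gamma>. It suffices to use the premise
    there.\<close>
  let ?p = "Pr2 C Y X" and ?y = "Pr1 C Y X"
  let ?\<gamma> = "Reidx P (tuple C ?y (Comp C a ?p)) \<gamma>"
  let ?\<xi> = "Reidx P ?p \<xi> \<sqinter>\<^bsub>Fib P (Prod C Y X)\<^esub> ?\<gamma>"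
  have \<gamma>': "?\<gamma> \<in> preds (Prod C Y X)" using \<gamma> a a' X Y by simp
  have \<xi>': "?\<xi> \<in> preds (Prod C Y X)" "Reidx P ?p \<xi> \<in> preds (Prod C Y X)" using \<gamma>' X Y by simp_all
  have id: "forces ?\<xi> (Ident C (Prod C Y X)) (Reidx P ?p \<xi>)" "forces ?\<xi> (Ident C (Prod C Y X)) ?\<gamma>"
    using \<xi>' \<gamma>' X Y by (simp_all add: forces_ident del: forces_reidx)
  have "forces ?\<xi> (Comp C b ?p) \<psi>"
    by (rule step[of ?p ?y]) (use id X Y a a' b \<gamma> in simp_all)
  then have "?\<xi> \<sqsubseteq>\<^bsub>Fib P (Prod C Y X)\<^esub> Reidx P ?p (Reidx P b \<psi>)"
    using X Y b \<psi> by (simp add: forces_def)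
  then have 1: "ex Y X ?\<xi> \<sqsubseteq>\<^bsub>Fib P X\<^esub> Reidx P b \<psi>"
    using ex_le_iff[of Y X ?\<xi> "Reidx P b \<psi>"] X Y b \<psi> \<xi>' by simp
  have 2: "ex Y X ?\<xi> = \<xi> \<sqinter>\<^bsub>Fib P X\<^esub> ex Y X ?\<gamma>"
    using proj_frobenius[OF base.projection_pr2[of Y X]] X Y \<gamma>' unfolding frobenius_def by simp
  have 3: "ex Y X ?\<gamma> = Reidx P a (ex Y A \<gamma>)"
    using proj_beck_chevalley[OF base.projection_pr2 base.pullback_pr2[of Y a], of \<gamma>] a a' A X Y \<gamma> by simp
  have "\<xi> \<sqsubseteq>\<^bsub>Fib P X\<^esub> \<xi> \<sqinter>\<^bsub>Fib P X\<^esub> Reidx P a (ex Y A \<gamma>)"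
    using ex X a a' A Y \<gamma> by (simp add: le_meet_iff forces_def)
  then have "\<xi> \<sqsubseteq>\<^bsub>Fib P X\<^esub> ex Y X ?\<xi>"
    by (simp only: 2 3)
  then have "\<xi> \<sqsubseteq>\<^bsub>Fib P X\<^esub> Reidx P b \<psi>"
    by (rule fib_trans[OF X(1) _ 1]) (use X Y b \<psi> \<xi>' in simp_all)
  then show ?thesis
    using X b \<psi> by (simp add: forces_def)
qed

end

section \<open>Equivalence relations, elementwise\<close>

context elementary_doctrine
begin

text \<open>\<open>x\<close> is a pair of an object and a relation on it. The typing conditions are
  part of the definition because \<open>tuple\<close> is defined by a description and says nothing
  about arrows with different domains.\<close>

definition eqv where
  "eqv x \<xi> a b \<longleftrightarrow> a \<in> Arr C \<and> b \<in> Arr C \<and> Dom C a = Dom C b \<and> Cod C a = fst x \<and> Cod C b = fst x \<and>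
    forces \<xi> (tuple C a b) (snd x)"

lemma eqv_typing:
  assumes "eqv x \<xi> a b"
  shows "a \<in> Arr C" "b \<in> Arr C" "Dom C a = Dom C b" "Cod C a = fst x" "Cod C b = fst x" "\<xi> \<in> preds (Dom C b)"
  using assms forces_typing(3)[of \<xi> "tuple C a b"] by (auto simp: eqv_def)

lemma eqv_stage:
  assumes "eqv x \<xi> a b" "forces \<xi>' h \<xi>" "Cod C h = Dom C b"
  shows "eqv x \<xi>' (Comp C a h) (Comp C b h)"
  using assms forces_stage[of \<xi>' h \<xi> "tuple C a b" "snd x"] forces_typing(1)[of \<xi>' h] by (simp add: eqv_def)

lemma equiv_rel_iff:
  assumes A: "A \<in> Obj C"
  shows "equiv_rel P A \<rho> \<longleftrightarrow> \<rho> \<in> preds (Prod C A A) \<and>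
    (\<forall>\<xi> a. a \<in> Arr C \<longrightarrow> Cod C a = A \<longrightarrow> \<xi> \<in> preds (Dom C a) \<longrightarrow> eqv (A, \<rho>) \<xi> a a) \<and>
    (\<forall>\<xi> a b. eqv (A, \<rho>) \<xi> a b \<longrightarrow> eqv (A, \<rho>) \<xi> b a) \<and>
    (\<forall>\<xi> a b c. eqv (A, \<rho>) \<xi> a b \<longrightarrow> eqv (A, \<rho>) \<xi> b c \<longrightarrow> eqv (A, \<rho>) \<xi> a c)"
    (is "_ \<longleftrightarrow> ?cl \<and> ?refl \<and> ?sym \<and> ?trans")
proof -
  let ?AA = "Prod C A A" and ?AAA = "Prod C A (Prod C A A)"
  let ?S = "Reidx P (tuple C (Pr2 C A A) (Pr1 C A A)) \<rho>"
  let ?T12 = "Reidx P (tuple C (tpr1 C A) (tpr2 C A)) \<rho>"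
  let ?T23 = "Reidx P (tuple C (tpr2 C A) (tpr3 C A)) \<rho>"
  let ?T13 = "Reidx P (tuple C (tpr1 C A) (tpr3 C A)) \<rho>"
  have def: "equiv_rel P A \<rho> \<longleftrightarrow> ?cl \<and> eq_pred P A \<sqsubseteq>\<^bsub>Fib P ?AA\<^esub> \<rho> \<and> \<rho> \<sqsubseteq>\<^bsub>Fib P ?AA\<^esub> ?S \<and>
      ?T12 \<sqinter>\<^bsub>Fib P ?AAA\<^esub> ?T23 \<sqsubseteq>\<^bsub>Fib P ?AAA\<^esub> ?T13"
    by (simp add: equiv_rel_def Let_def)
  note tpr = tpr1_def tpr2_def tpr3_def
  have "eq_pred P A \<sqsubseteq>\<^bsub>Fib P ?AA\<^esub> \<rho> \<longleftrightarrow> ?refl" if \<rho>: ?cl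
  proof
    assume "eq_pred P A \<sqsubseteq>\<^bsub>Fib P ?AA\<^esub> \<rho>"
    then show ?refl
      using A \<rho> forces_refl_of_eq_pred_le by (simp add: eqv_def)
  next
    assume ?refl
    \<comment> \<open>By adjunction, \<rho> lies above fibred equality as soon as it holds on the
      diagonal, that is, of the generic pair at the top stage.\<close>
    then have "eqv (A, \<rho>) \<top>\<^bsub>Fib P A\<^esub> (Ident C A) (Ident C A)" using A by simp
    then show "eq_pred P A \<sqsubseteq>\<^bsub>Fib P ?AA\<^esub> \<rho>"
      using A \<rho> by (simp add: eq_pred_le_iff eqv_def diag_def forces_def)
  qed
  moreover have "\<rho> \<sqsubseteq>\<^bsub>Fib P ?AA\<^esub> ?S \<longleftrightarrow> ?sym" if \<rho>: ?cl
  proof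
    assume le: "\<rho> \<sqsubseteq>\<^bsub>Fib P ?AA\<^esub> ?S"
    show ?sym
    proof (intro allI impI)
      fix \<xi> a b assume ab: "eqv (A, \<rho>) \<xi> a b"
      have "forces \<xi> (tuple C a b) ?S"
        by (rule forces_mono[OF le]) (use ab A \<rho> in \<open>simp_all add: eqv_def\<close>)
      then show "eqv (A, \<rho>) \<xi> b a"
        using ab A \<rho> by (simp add: eqv_def)
    qed
  next
    assume sym: ?sym
    show "\<rho> \<sqsubseteq>\<^bsub>Fib P ?AA\<^esub> ?S"
    proof (rule le_forces_prodI)
      fix a b \<xi> assume ab: "a \<in> Arr C" "b \<in> Arr C" "Dom C a = Dom C b" "Cod C a = A" "Cod C b = A"
        "forces \<xi> (tuple C a b) \<rho>"
      then have "eqv (A, \<rho>) \<xi> b a" using sym by (simp add: eqv_def)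
      then show "forces \<xi> (tuple C a b) ?S" using ab A \<rho> by (simp add: eqv_def)
    qed (use A \<rho> in simp_all)
  qed
  moreover have "?T12 \<sqinter>\<^bsub>Fib P ?AAA\<^esub> ?T23 \<sqsubseteq>\<^bsub>Fib P ?AAA\<^esub> ?T13 \<longleftrightarrow> ?trans" if \<rho>: ?cl
  proof
    assume le: "?T12 \<sqinter>\<^bsub>Fib P ?AAA\<^esub> ?T23 \<sqsubseteq>\<^bsub>Fib P ?AAA\<^esub> ?T13"
    show ?trans
    proof (intro allI impI)
      fix \<xi> a b c assume ab: "eqv (A, \<rho>) \<xi> a b" and bc: "eqv (A, \<rho>) \<xi> b c"
      have "forces \<xi> (tuple C a (tuple C b c)) ?T13"
        by (rule forces_mono[OF le]) (use ab bc A \<rho> in \<open>simp_all add: eqv_def tpr\<close>)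
      then show "eqv (A, \<rho>) \<xi> a c"
        using ab bc A \<rho> by (simp add: eqv_def tpr)
    qed
  next
    assume trans: ?trans
    show "?T12 \<sqinter>\<^bsub>Fib P ?AAA\<^esub> ?T23 \<sqsubseteq>\<^bsub>Fib P ?AAA\<^esub> ?T13"
    proof (rule le_forces_prodI)
      fix a b \<xi> assume ab: "a \<in> Arr C" "b \<in> Arr C" "Dom C a = Dom C b" "Cod C a = A" "Cod C b = ?AA"
        "forces \<xi> (tuple C a b) (?T12 \<sqinter>\<^bsub>Fib P ?AAA\<^esub> ?T23)"
      then have "eqv (A, \<rho>) \<xi> a (Comp C (Pr1 C A A) b)" "eqv (A, \<rho>) \<xi> (Comp C (Pr1 C A A) b) (Comp C (Pr2 C A A) b)"
        using A \<rho> by (simp_all add: eqv_def tpr)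
      then have "eqv (A, \<rho>) \<xi> a (Comp C (Pr2 C A A) b)" using trans by blast
      then show "forces \<xi> (tuple C a b) ?T13" using ab A \<rho> by (simp add: eqv_def tpr)
    qed (use A \<rho> in \<open>simp_all add: tpr\<close>)
  qed
  ultimately show ?thesis
    unfolding def by blast
qed

lemma q_obj_iff: "x \<in> q_obj P \<longleftrightarrow> fst x \<in> Obj C \<and> equiv_rel P (fst x) (snd x)"
  by (cases x) (simp add: q_obj_def)

lemma q_objD [simp]:
  "x \<in> q_obj P \<Longrightarrow> fst x \<in> Obj C"
  "x \<in> q_obj P \<Longrightarrow> fst x = A \<Longrightarrow> snd x \<in> preds (Prod C A A)"
  by (auto simp: q_obj_iff equiv_rel_iff)

lemma eqv_refl: "x \<in> q_obj P \<Longrightarrow> a \<in> Arr C \<Longrightarrow> Cod C a = fst x \<Longrightarrow> \<xi> \<in> preds (Dom C a) \<Longrightarrow> eqv x \<xi> a a"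
  and eqv_sym: "x \<in> q_obj P \<Longrightarrow> eqv x \<xi> a b \<Longrightarrow> eqv x \<xi> b a"
  and eqv_trans: "x \<in> q_obj P \<Longrightarrow> eqv x \<xi> a b \<Longrightarrow> eqv x \<xi> b c \<Longrightarrow> eqv x \<xi> a c"
  using equiv_rel_iff[of "fst x" "snd x"] unfolding q_obj_iff prod.collapse by blast+

lemma q_objI:
  assumes "fst x \<in> Obj C" "snd x \<in> preds (Prod C (fst x) (fst x))"
    "\<And>\<xi> a. a \<in> Arr C \<Longrightarrow> Cod C a = fst x \<Longrightarrow> \<xi> \<in> preds (Dom C a) \<Longrightarrow> eqv x \<xi> a a"
    "\<And>\<xi> a b. eqv x \<xi> a b \<Longrightarrow> eqv x \<xi> b a"
    "\<And>\<xi> a b c. eqv x \<xi> a b \<Longrightarrow> eqv x \<xi> b c \<Longrightarrow> eqv x \<xi> a c"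
  shows "x \<in> q_obj P"
  unfolding q_obj_iff equiv_rel_iff[OF assms(1)] prod.collapse using assms by blast

lemma des_iff:
  assumes x: "x \<in> q_obj P"
  shows "\<alpha> \<in> des P (fst x) (snd x) \<longleftrightarrow> \<alpha> \<in> preds (fst x) \<and>
    (\<forall>\<xi> a b. eqv x \<xi> a b \<longrightarrow> forces \<xi> a \<alpha> \<longrightarrow> forces \<xi> b \<alpha>)"
proof -
  define A where "A = fst x"
  let ?L = "Reidx P (Pr1 C A A) \<alpha> \<sqinter>\<^bsub>Fib P (Prod C A A)\<^esub> snd x" and ?R = "Reidx P (Pr2 C A A) \<alpha>"
  have A: "A \<in> Obj C" "snd x \<in> preds (Prod C A A)" using x by (simp_all add: A_def)
  have "?L \<sqsubseteq>\<^bsub>Fib P (Prod C A A)\<^esub> ?R \<longleftrightarrow>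
      (\<forall>\<xi> a b. eqv x \<xi> a b \<longrightarrow> forces \<xi> a \<alpha> \<longrightarrow> forces \<xi> b \<alpha>)" if \<alpha>: "\<alpha> \<in> preds A"
  proof (intro iffI allI impI)
    fix \<xi> a b assume le: "?L \<sqsubseteq>\<^bsub>Fib P (Prod C A A)\<^esub> ?R" and ab: "eqv x \<xi> a b" "forces \<xi> a \<alpha>"
    have "forces \<xi> (tuple C a b) ?R"
      by (rule forces_mono[OF le]) (use ab A \<alpha> in \<open>simp_all add: eqv_def flip: A_def\<close>)
    then show "forces \<xi> b \<alpha>"
      using ab A \<alpha> by (simp add: eqv_def flip: A_def)
  next
    assume *: "\<forall>\<xi> a b. eqv x \<xi> a b \<longrightarrow> forces \<xi> a \<alpha> \<longrightarrow> forces \<xi> b \<alpha>"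
    show "?L \<sqsubseteq>\<^bsub>Fib P (Prod C A A)\<^esub> ?R"
    proof (rule le_forces_prodI)
      fix a b \<xi> assume "a \<in> Arr C" "b \<in> Arr C" "Dom C a = Dom C b" "Cod C a = A" "Cod C b = A"
        "forces \<xi> (tuple C a b) ?L"
      then show "forces \<xi> (tuple C a b) ?R"
        using *[rule_format, of \<xi> a b] A \<alpha> by (simp add: eqv_def flip: A_def)
    qed (use A \<alpha> in simp_all)
  qed
  then show ?thesis
    by (auto simp: des_def A_def)
qed

lemma desD:
  assumes "x \<in> q_obj P" "\<alpha> \<in> des P (fst x) (snd x)"
  shows "\<alpha> \<in> preds (fst x)" and "eqv x \<xi> a b \<Longrightarrow> forces \<xi> a \<alpha> \<Longrightarrow> forces \<xi> b \<alpha>"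
  using assms by (auto simp: des_iff)

text \<open>With g = f this characterizes the maps of the completion; for two maps it characterizes
  when they represent the same arrow.\<close>

lemma le_times_arr_iff:
  assumes x: "x \<in> q_obj P" and y: "y \<in> q_obj P"
    and f: "f \<in> Arr C" "Dom C f = fst x" "Cod C f = fst y"
    and g: "g \<in> Arr C" "Dom C g = fst x" "Cod C g = fst y"
  shows "snd x \<sqsubseteq>\<^bsub>Fib P (Prod C (fst x) (fst x))\<^esub> Reidx P (times_arr C f g) (snd y) \<longleftrightarrow>
    (\<forall>\<xi> a b. eqv x \<xi> a b \<longrightarrow> eqv y \<xi> (Comp C f a) (Comp C g b))" (is "?le \<longleftrightarrow> _")
proof (intro iffI allI impI)
  fix \<xi> a b assume ?le and ab: "eqv x \<xi> a b"
  have "forces \<xi> (tuple C a b) (Reidx P (times_arr C f g) (snd y))"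
    by (rule forces_mono[OF \<open>?le\<close>]) (use ab x y f g in \<open>simp_all add: eqv_def\<close>)
  then show "eqv y \<xi> (Comp C f a) (Comp C g b)"
    using ab x y f g by (simp add: eqv_def)
next
  assume *: "\<forall>\<xi> a b. eqv x \<xi> a b \<longrightarrow> eqv y \<xi> (Comp C f a) (Comp C g b)"
  show ?le
  proof (rule le_forces_prodI)
    fix a b \<xi> assume ab: "a \<in> Arr C" "b \<in> Arr C" "Dom C a = Dom C b" "Cod C a = fst x" "Cod C b = fst x"
      "forces \<xi> (tuple C a b) (snd x)"
    then have "eqv y \<xi> (Comp C f a) (Comp C g b)" using * by (simp add: eqv_def)
    then show "forces \<xi> (tuple C a b) (Reidx P (times_arr C f g) (snd y))"
      using ab x y f g by (simp add: eqv_def)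
  qed (use x y f g in simp_all)
qed

lemma q_maps_iff:
  assumes "x \<in> q_obj P" "y \<in> q_obj P"
  shows "f \<in> q_maps P x y \<longleftrightarrow> f \<in> Arr C \<and> Dom C f = fst x \<and> Cod C f = fst y \<and>
    (\<forall>\<xi> a b. eqv x \<xi> a b \<longrightarrow> eqv y \<xi> (Comp C f a) (Comp C f b))"
  using le_times_arr_iff[OF assms, of f f] by (auto simp: q_maps_def Hom_def)

lemma q_mapsD:
  assumes "x \<in> q_obj P" "y \<in> q_obj P" "f \<in> q_maps P x y"
  shows "f \<in> Arr C" "Dom C f = fst x" "Cod C f = fst y" "eqv x \<xi> a b \<Longrightarrow> eqv y \<xi> (Comp C f a) (Comp C f b)"
  using assms by (auto simp: q_maps_iff)

text \<open>For maps that preserve the relations it is enough to compare values at equal arguments: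
  f a ~ f b ~ g b.\<close>

lemma q_sim_iff:
  assumes x: "x \<in> q_obj P" and y: "y \<in> q_obj P"
  shows "(f, g) \<in> q_sim P x y \<longleftrightarrow> f \<in> q_maps P x y \<and> g \<in> q_maps P x y \<and>
    (\<forall>\<xi> a. a \<in> Arr C \<longrightarrow> Cod C a = fst x \<longrightarrow> \<xi> \<in> preds (Dom C a) \<longrightarrow> eqv y \<xi> (Comp C f a) (Comp C g a))"
proof -
  have "snd x \<sqsubseteq>\<^bsub>Fib P (Prod C (fst x) (fst x))\<^esub> Reidx P (times_arr C f g) (snd y) \<longleftrightarrow>
    (\<forall>\<xi> a. a \<in> Arr C \<longrightarrow> Cod C a = fst x \<longrightarrow> \<xi> \<in> preds (Dom C a) \<longrightarrow> eqv y \<xi> (Comp C f a) (Comp C g a))"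
    if f: "f \<in> q_maps P x y" and g: "g \<in> q_maps P x y"
    unfolding le_times_arr_iff[OF x y q_mapsD(1-3)[OF x y f] q_mapsD(1-3)[OF x y g]]
    by (meson eqv_refl[OF x] q_mapsD(4)[OF x y f] eqv_trans[OF y] eqv_typing(2,5,6))
  then show ?thesis
    by (auto simp: q_sim_def)
qed

lemma q_simD:
  assumes "x \<in> q_obj P" "y \<in> q_obj P" "(f, g) \<in> q_sim P x y"
    and "a \<in> Arr C" "Cod C a = fst x" "\<xi> \<in> preds (Dom C a)"
  shows "eqv y \<xi> (Comp C f a) (Comp C g a)"
  using assms by (auto simp: q_sim_iff)

section \<open>Fibred equality as an equivalence relation\<close>

lemma fst_J_obj [simp]: "fst (J_obj P A) = A"
  by (simp add: J_obj_def)

text \<open>The usual derivation from reflexivity and substitution: symmetry replaces the first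
  occurrence of a in a = a by b, and transitivity replaces b in a = b by c.\<close>

lemma J_obj_in_q_obj [simp]:
  assumes A: "A \<in> Obj C"
  shows "J_obj P A \<in> q_obj P"
proof -
  have refl: "eqv (J_obj P A) \<xi> a a" if "a \<in> Arr C" "Cod C a = A" "\<xi> \<in> preds (Dom C a)" for \<xi> a
    using that A forces_eq_refl by (simp add: eqv_def J_obj_def)
  have sym: "eqv (J_obj P A) \<xi> b a" if ab: "eqv (J_obj P A) \<xi> a b" for \<xi> a b
  proof -
    let ?S = "Reidx P (tuple C (Pr2 C A A) (Pr1 C A A)) (eq_pred P A)"
    have ab': "a \<in> Arr C" "b \<in> Arr C" "Dom C a = Dom C b" "Cod C a = A" "Cod C b = A" "\<xi> \<in> preds (Dom C b)"
      "forces \<xi> (tuple C a b) (eq_pred P A)"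
      using eqv_typing[OF ab] ab by (simp_all add: eqv_def J_obj_def)
    have "forces \<xi> (tuple C a b) ?S"
      by (rule forces_eq_subst[of a b a "Dom C b" A A]) (use ab' A forces_eq_refl[of a A] in simp_all)
    then show ?thesis using ab' A by (simp add: eqv_def J_obj_def)
  qed
  have trans: "eqv (J_obj P A) \<xi> a c" if ab: "eqv (J_obj P A) \<xi> a b" "eqv (J_obj P A) \<xi> b c" for \<xi> a b c
    using ab A forces_eq_subst[of b c a "Dom C c" A A "eq_pred P A"] by (simp add: eqv_def J_obj_def)
  show ?thesis
    by (rule q_objI[OF _ _ refl sym trans]) (use A in \<open>simp_all add: J_obj_def\<close>)
qed

text \<open>Every arrow of the base respects equality: start from f a ~ f a and substitute b for the
  second a.\<close>

lemma eqv_J_map: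
  assumes x: "x \<in> q_obj P" and ab: "eqv (J_obj P A) \<xi> a b" and f: "f \<in> Arr C" "Dom C f = A" "Cod C f = fst x"
  shows "eqv x \<xi> (Comp C f a) (Comp C f b)"
proof -
  have A: "A \<in> Obj C" using f by auto
  have ab': "a \<in> Arr C" "b \<in> Arr C" "Dom C a = Dom C b" "Cod C a = A" "Cod C b = A" "\<xi> \<in> preds (Dom C b)"
    "forces \<xi> (tuple C a b) (eq_pred P A)"
    using eqv_typing[OF ab] ab by (simp_all add: eqv_def J_obj_def)
  have "forces \<xi> (tuple C a b) (Reidx P (times_arr C f f) (snd x))"
    by (rule forces_eq_subst[of a b a "Dom C b" A A])
      (use ab' A f x eqv_refl[OF x, of "Comp C f a" \<xi>] in \<open>simp_all add: eqv_def\<close>)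
  then show ?thesis using ab' A f x by (simp add: eqv_def)
qed

lemma q_maps_J: "x \<in> q_obj P \<Longrightarrow> A \<in> Obj C \<Longrightarrow> q_maps P (J_obj P A) x = Hom C A (fst x)"
  by (auto simp: q_maps_iff Hom_def eqv_J_map)

text \<open>Every predicate is closed under equality. This is why the components of j can be
  identities.\<close>

lemma des_J: assumes A: "A \<in> Obj C" shows "des P A (eq_pred P A) = preds A"
proof -
  have "forces \<xi> b \<alpha>" if \<alpha>: "\<alpha> \<in> preds A" and ab: "eqv (J_obj P A) \<xi> a b" and a: "forces \<xi> a \<alpha>" for \<xi> a b \<alpha>
  proof -
    have ab': "a \<in> Arr C" "b \<in> Arr C" "Dom C a = Dom C b" "Cod C a = A" "Cod C b = A" "\<xi> \<in> preds (Dom C b)"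
      "forces \<xi> (tuple C a b) (eq_pred P A)"
      using eqv_typing[OF ab] ab by (simp_all add: eqv_def J_obj_def)
    have "forces \<xi> (tuple C a b) (Reidx P (Pr2 C A A) \<alpha>)"
      by (rule forces_eq_subst[of a b a "Dom C b" A A]) (use ab' A \<alpha> a in simp_all)
    then show ?thesis using ab' A \<alpha> by simp
  qed
  then show ?thesis
    using des_iff[OF J_obj_in_q_obj[OF A]] by (auto simp: J_obj_def)
qed

section \<open>Products of objects with an equivalence relation\<close>

lemma q_prod_sel [simp]: "fst (q_prod P x y) = Prod C (fst x) (fst y)"
  by (simp add: q_prod_def)

lemma eqv_q_prod:
  assumes x: "x \<in> q_obj P" and y: "y \<in> q_obj P"
    and u: "u \<in> Arr C" "Cod C u = Prod C (fst x) (fst y)" and v: "v \<in> Arr C" "Cod C v = Prod C (fst x) (fst y)"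
    and uv: "Dom C u = Dom C v"
  shows "eqv (q_prod P x y) \<xi> u v \<longleftrightarrow>
    eqv x \<xi> (Comp C (Pr1 C (fst x) (fst y)) u) (Comp C (Pr1 C (fst x) (fst y)) v) \<and>
    eqv y \<xi> (Comp C (Pr2 C (fst x) (fst y)) u) (Comp C (Pr2 C (fst x) (fst y)) v)"
  using assms by (simp add: eqv_def q_prod_def box_rel_def Let_def)

lemma q_prod_obj [simp]:
  assumes x: "x \<in> q_obj P" and y: "y \<in> q_obj P"
  shows "q_prod P x y \<in> q_obj P"
proof (rule q_objI)
  fix \<xi> a assume "a \<in> Arr C" "Cod C a = fst (q_prod P x y)" "\<xi> \<in> preds (Dom C a)"
  then show "eqv (q_prod P x y) \<xi> a a"
    using x y by (simp add: eqv_q_prod eqv_refl)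
next
  fix \<xi> a b assume ab: "eqv (q_prod P x y) \<xi> a b"
  then show "eqv (q_prod P x y) \<xi> b a"
    using x y eqv_typing[OF ab] by (simp add: eqv_q_prod eqv_sym)
next
  fix \<xi> a b c assume ab: "eqv (q_prod P x y) \<xi> a b" and bc: "eqv (q_prod P x y) \<xi> b c"
  show "eqv (q_prod P x y) \<xi> a c"
    using ab bc x y eqv_typing[OF ab] eqv_typing[OF bc] by (simp add: eqv_q_prod) (blast intro: eqv_trans)
qed (use x y in \<open>simp_all add: q_prod_def box_rel_def Let_def\<close>)

end

section \<open>The category of quotients\<close>

context elementary_doctrine
begin

lemma q_sim_equiv:
  assumes "x \<in> q_obj P" "y \<in> q_obj P"
  shows "f \<in> q_maps P x y \<Longrightarrow> (f, f) \<in> q_sim P x y"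
    and "(f, g) \<in> q_sim P x y \<Longrightarrow> (g, f) \<in> q_sim P x y"
    and "(f, g) \<in> q_sim P x y \<Longrightarrow> (g, h) \<in> q_sim P x y \<Longrightarrow> (f, h) \<in> q_sim P x y"
  using assms eqv_sym eqv_refl
  by (auto simp: q_sim_iff q_maps_iff) (meson eqv_trans)

lemma q_class_eq_iff:
  assumes "x \<in> q_obj P" "y \<in> q_obj P" "f \<in> q_maps P x y"
  shows "q_class P x y f = q_class P x y g \<longleftrightarrow> (f, g) \<in> q_sim P x y"
proof
  assume "q_class P x y f = q_class P x y g"
  then have "f \<in> q_sim P x y `` {g}"
    using q_sim_equiv(1)[OF assms] by (auto simp: q_class_def)
  then show "(f, g) \<in> q_sim P x y"
    using q_sim_equiv(2)[OF assms(1,2)] by blast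
next
  assume "(f, g) \<in> q_sim P x y"
  then have "q_sim P x y `` {f} = q_sim P x y `` {g}"
    by (blast intro: q_sim_equiv(2,3)[OF assms(1,2)])
  then show "q_class P x y f = q_class P x y g"
    by (simp add: q_class_def)
qed

text \<open>Composition and reindexing in the completion go through the chosen \<open>q_rep\<close>;
  this is what allows any representative to replace the chosen one.\<close>

lemma q_rep_sim:
  assumes "x \<in> q_obj P" "y \<in> q_obj P" "f \<in> q_maps P x y"
  shows "(f, q_rep (q_class P x y f)) \<in> q_sim P x y"
proof -
  have "f \<in> snd (snd (q_class P x y f))"
    using q_sim_equiv(1)[OF assms] by (simp add: q_class_def)
  then have "q_rep (q_class P x y f) \<in> snd (snd (q_class P x y f))"
    unfolding q_rep_def by (rule someI[of "\<lambda>g. g \<in> snd (snd (q_class P x y f))"])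
  then show ?thesis by (simp add: q_class_def)
qed

lemma q_rep_maps:
  assumes "x \<in> q_obj P" "y \<in> q_obj P" "f \<in> q_maps P x y"
  shows "q_rep (q_class P x y f) \<in> q_maps P x y"
  using q_rep_sim[OF assms] assms by (simp add: q_sim_iff)

lemma q_cat_sel [simp]:
  "Obj (q_cat P) = q_obj P"
  "Dom (q_cat P) (q_class P x y f) = x"
  "Cod (q_cat P) (q_class P x y f) = y"
  "Ident (q_cat P) x = q_class P x x (Ident C (fst x))"
  "One (q_cat P) = J_obj P (One C)"
  "Prod (q_cat P) = q_prod P"
  "Pr1 (q_cat P) x y = q_class P (q_prod P x y) x (Pr1 C (fst x) (fst y))"
  "Pr2 (q_cat P) x y = q_class P (q_prod P x y) y (Pr2 C (fst x) (fst y))"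
  by (simp_all add: q_cat_def q_class_def J_obj_def)

lemma q_class_arr [simp]:
  "x \<in> q_obj P \<Longrightarrow> y \<in> q_obj P \<Longrightarrow> f \<in> q_maps P x y \<Longrightarrow> q_class P x y f \<in> Arr (q_cat P)"
  by (auto simp: q_cat_def q_class_def quotient_def)

lemma hom_q_cat_iff:
  "\<phi> \<in> Hom (q_cat P) x y \<longleftrightarrow> x \<in> q_obj P \<and> y \<in> q_obj P \<and> (\<exists>f \<in> q_maps P x y. \<phi> = q_class P x y f)"
  by (cases \<phi>) (auto simp: Hom_def q_cat_def q_class_def quotient_def)

lemma q_maps_comp:
  assumes "x \<in> q_obj P" "y \<in> q_obj P" "z \<in> q_obj P" "f \<in> q_maps P x y" "g \<in> q_maps P y z"
  shows "Comp C g f \<in> q_maps P x z"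
proof -
  note f = q_mapsD(1-3)[OF assms(1,2,4)] and g = q_mapsD(1-3)[OF assms(2,3,5)]
  have "eqv z \<xi> (Comp C (Comp C g f) a) (Comp C (Comp C g f) b)" if ab: "eqv x \<xi> a b" for \<xi> a b
    using q_mapsD(4)[OF assms(2,3,5) q_mapsD(4)[OF assms(1,2,4) ab]] eqv_typing[OF ab] f g by simp
  then show ?thesis using assms(1,3) f g by (simp add: q_maps_iff)
qed

text \<open>Independence of representatives: g (f a) ~ g (f' a) because g preserves the relation,
  and g (f' a) ~ g' (f' a) because g and g' are related.\<close>

lemma comp_q_class:
  assumes x: "x \<in> q_obj P" and y: "y \<in> q_obj P" and z: "z \<in> q_obj P"
    and f: "f \<in> q_maps P x y" and g: "g \<in> q_maps P y z"
  shows "Comp (q_cat P) (q_class P y z g) (q_class P x y f) = q_class P x z (Comp C g f)"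
proof -
  define f' g' where "f' = q_rep (q_class P x y f)" and "g' = q_rep (q_class P y z g)"
  have sim: "(f, f') \<in> q_sim P x y" "(g, g') \<in> q_sim P y z"
    using q_rep_sim assms unfolding f'_def g'_def by blast+
  have f'm: "f' \<in> q_maps P x y" and g'm: "g' \<in> q_maps P y z"
    using q_rep_maps assms unfolding f'_def g'_def by blast+
  note fD = q_mapsD(1-3)[OF x y f] and gD = q_mapsD(1-3)[OF y z g]
    and f'D = q_mapsD(1-3)[OF x y f'm] and g'D = q_mapsD(1-3)[OF y z g'm]
  have "eqv z \<xi> (Comp C (Comp C g f) a) (Comp C (Comp C g' f') a)"
    if a: "a \<in> Arr C" "Cod C a = fst x" "\<xi> \<in> preds (Dom C a)" for \<xi> a
  proof -
    have "eqv z \<xi> (Comp C g (Comp C f a)) (Comp C g (Comp C f' a))"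
      by (rule q_mapsD(4)[OF y z g q_simD[OF x y sim(1) a]])
    moreover have "eqv z \<xi> (Comp C g (Comp C f' a)) (Comp C g' (Comp C f' a))"
      by (rule q_simD[OF y z sim(2)]) (use a f'D in simp_all)
    ultimately have "eqv z \<xi> (Comp C g (Comp C f a)) (Comp C g' (Comp C f' a))"
      by (rule eqv_trans[OF z])
    then show ?thesis
      using a fD gD f'D g'D by simp
  qed
  then have "(Comp C g f, Comp C g' f') \<in> q_sim P x z"
    using q_maps_comp[OF x y z] f g f'm g'm x z by (simp add: q_sim_iff)
  then have "q_class P x z (Comp C g f) = q_class P x z (Comp C g' f')"
    using q_class_eq_iff[OF x z q_maps_comp[OF x y z f g]] by simp
  moreover have "Comp (q_cat P) \<psi> \<phi> = q_class P (fst \<phi>) (fst (snd \<psi>)) (Comp C (q_rep \<psi>) (q_rep \<phi>))" for \<psi> \<phi>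
    by (simp add: q_cat_def)
  ultimately show ?thesis
    by (simp add: f'_def g'_def q_class_def[of _ _ _ f] q_class_def[of _ _ _ g])
qed

lemma ident_q_maps: "x \<in> q_obj P \<Longrightarrow> Ident C (fst x) \<in> q_maps P x x"
  using eqv_typing by (simp add: q_maps_iff)

lemma q_cat_category: "category (q_cat P)"
proof
  fix \<phi> assume "\<phi> \<in> Arr (q_cat P)"
  then show "Dom (q_cat P) \<phi> \<in> Obj (q_cat P)" "Cod (q_cat P) \<phi> \<in> Obj (q_cat P)"
    by (auto simp: q_cat_def)
next
  fix x assume "x \<in> Obj (q_cat P)"
  then show "Ident (q_cat P) x \<in> Hom (q_cat P) x x"
    using ident_q_maps[of x] by (auto simp: hom_q_cat_iff)
next
  fix \<phi> \<psi> x y z assume "\<phi> \<in> Hom (q_cat P) x y" "\<psi> \<in> Hom (q_cat P) y z"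
  then show "Comp (q_cat P) \<psi> \<phi> \<in> Hom (q_cat P) x z"
    using q_maps_comp[of x y z] by (auto simp: hom_q_cat_iff comp_q_class)
next
  fix \<phi> x y assume "\<phi> \<in> Hom (q_cat P) x y"
  then obtain f where f: "x \<in> q_obj P" "y \<in> q_obj P" "f \<in> q_maps P x y" "\<phi> = q_class P x y f"
    by (auto simp: hom_q_cat_iff)
  then show "Comp (q_cat P) \<phi> (Ident (q_cat P) x) = \<phi>" "Comp (q_cat P) (Ident (q_cat P) y) \<phi> = \<phi>"
    using q_mapsD(1-3)[of x y f] by (simp_all add: comp_q_class ident_q_maps)
next
  fix \<phi> \<psi> \<chi> x y z w assume "\<phi> \<in> Hom (q_cat P) x y" "\<psi> \<in> Hom (q_cat P) y z" "\<chi> \<in> Hom (q_cat P) z w"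
  then obtain f g h where *: "x \<in> q_obj P" "y \<in> q_obj P" "z \<in> q_obj P" "w \<in> q_obj P"
    "f \<in> q_maps P x y" "g \<in> q_maps P y z" "h \<in> q_maps P z w"
    "\<phi> = q_class P x y f" "\<psi> = q_class P y z g" "\<chi> = q_class P z w h"
    by (auto simp: hom_q_cat_iff)
  then show "Comp (q_cat P) \<chi> (Comp (q_cat P) \<psi> \<phi>) = Comp (q_cat P) (Comp (q_cat P) \<chi> \<psi>) \<phi>"
    using q_mapsD(1-3)[of x y f] q_mapsD(1-3)[of y z g] q_mapsD(1-3)[of z w h]
    by (simp add: comp_q_class q_maps_comp[of x y z] q_maps_comp[of y z w])
qed

text \<open>Arrows are compared only up to the relation of \<open>t\<close>, so uniqueness follows
  when that relation identifies all parallel elements.\<close>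

lemma q_cat_is_terminal:
  assumes t: "t \<in> q_obj P"
    and ex: "\<And>A. A \<in> Obj C \<Longrightarrow> \<exists>h. h \<in> Hom C A (fst t)"
    and all: "\<And>\<xi> u v. u \<in> Arr C \<Longrightarrow> v \<in> Arr C \<Longrightarrow> Dom C u = Dom C v \<Longrightarrow> Cod C u = fst t \<Longrightarrow> Cod C v = fst t \<Longrightarrow>
      \<xi> \<in> preds (Dom C v) \<Longrightarrow> eqv t \<xi> u v"
  shows "is_terminal (q_cat P) t"
  unfolding is_terminal_def
proof (intro conjI ballI)
  show "t \<in> Obj (q_cat P)" using t by simp
  fix x assume "x \<in> Obj (q_cat P)"
  then have x: "x \<in> q_obj P" by simp
  then obtain h where h: "h \<in> Arr C" "Dom C h = fst x" "Cod C h = fst t"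
    using ex[of "fst x"] unfolding Hom_def by auto
  have hom: "f \<in> q_maps P x t" if f: "f \<in> Arr C" "Dom C f = fst x" "Cod C f = fst t" for f
  proof -
    have "eqv t \<xi> (Comp C f a) (Comp C f b)" if ab: "eqv x \<xi> a b" for \<xi> a b
      by (rule all) (use f eqv_typing[OF ab] in simp_all)
    then show ?thesis using x t f by (simp add: q_maps_iff)
  qed
  have "(h, f) \<in> q_sim P x t" if f: "f \<in> q_maps P x t" for f
  proof -
    have "eqv t \<xi> (Comp C h a) (Comp C f a)" if a: "a \<in> Arr C" "Cod C a = fst x" "\<xi> \<in> preds (Dom C a)" for \<xi> a
      by (rule all) (use h a q_mapsD(1-3)[OF x t f] in simp_all)
    then show ?thesis using f hom[OF h] x t by (simp add: q_sim_iff)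
  qed
  then have "q_class P x t h = q_class P x t f" if "f \<in> q_maps P x t" for f
    using q_class_eq_iff[OF x t hom[OF h], of f] that by blast
  then show "\<exists>!\<phi>. \<phi> \<in> Hom (q_cat P) x t"
    unfolding hom_q_cat_iff using hom[OF h] x t by (metis (no_types, lifting))
qed

text \<open>Existence of pairings comes from the base; their uniqueness, and the fact that they
  preserve the relations, come from joint reflection by the legs. The criterion covers both the
  standard products of the completion and the images under J of arbitrary products of the
  base.\<close>

lemma q_cat_is_product:
  assumes x: "x \<in> q_obj P" and y: "y \<in> q_obj P" and z: "z \<in> q_obj P"
    and p: "p \<in> q_maps P z x" and q: "q \<in> q_maps P z y"
    and ex: "\<And>f g. f \<in> Arr C \<Longrightarrow> g \<in> Arr C \<Longrightarrow> Dom C f = Dom C g \<Longrightarrow> Cod C f = fst x \<Longrightarrow> Cod C g = fst y \<Longrightarrow>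
      \<exists>h \<in> Hom C (Dom C g) (fst z). Comp C p h = f \<and> Comp C q h = g"
    and reflect: "\<And>\<xi> u v. u \<in> Arr C \<Longrightarrow> v \<in> Arr C \<Longrightarrow> Dom C u = Dom C v \<Longrightarrow> Cod C u = fst z \<Longrightarrow> Cod C v = fst z \<Longrightarrow>
      eqv x \<xi> (Comp C p u) (Comp C p v) \<Longrightarrow> eqv y \<xi> (Comp C q u) (Comp C q v) \<Longrightarrow> eqv z \<xi> u v"
  shows "is_product (q_cat P) x y z (q_class P z x p) (q_class P z y q)"
  unfolding is_product_def
proof (intro conjI ballI)
  show "x \<in> Obj (q_cat P)" "y \<in> Obj (q_cat P)" "z \<in> Obj (q_cat P)" using x y z by simp_all
  show "q_class P z x p \<in> Hom (q_cat P) z x" "q_class P z y q \<in> Hom (q_cat P) z y"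
    using x y z p q by (auto simp: hom_q_cat_iff)
  note pD = q_mapsD(1-3)[OF z x p] and qD = q_mapsD(1-3)[OF z y q]
  fix w \<phi> \<psi> assume "w \<in> Obj (q_cat P)" "\<phi> \<in> Hom (q_cat P) w x" "\<psi> \<in> Hom (q_cat P) w y"
  then obtain f g where w: "w \<in> q_obj P" and f: "f \<in> q_maps P w x" "\<phi> = q_class P w x f"
    and g: "g \<in> q_maps P w y" "\<psi> = q_class P w y g"
    by (auto simp: hom_q_cat_iff)
  note fD = q_mapsD(1-3)[OF w x f(1)] and gD = q_mapsD(1-3)[OF w y g(1)]
  obtain h where h: "h \<in> Arr C" "Dom C h = fst w" "Cod C h = fst z" "Comp C p h = f" "Comp C q h = g"
    using ex[of f g] fD gD by (auto simp: Hom_def)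
  \<comment> \<open>The components of \<open>h\<close> preserve the relations and the legs reflect
    them jointly, so \<open>h\<close> preserves them as well.\<close>
  have hm: "h \<in> q_maps P w z"
  proof -
    have "eqv z \<xi> (Comp C h a) (Comp C h b)" if ab: "eqv w \<xi> a b" for \<xi> a b
    proof -
      have "eqv x \<xi> (Comp C (Comp C p h) a) (Comp C (Comp C p h) b)" "eqv y \<xi> (Comp C (Comp C q h) a) (Comp C (Comp C q h) b)"
        unfolding h using q_mapsD(4)[OF w x f(1) ab] q_mapsD(4)[OF w y g(1) ab] by blast+
      then show ?thesis
        by (intro reflect) (use h(1-3) pD qD eqv_typing[OF ab] in simp_all)
    qed
    then show ?thesis using w z h by (simp add: q_maps_iff)
  qed
  show "\<exists>!\<theta>. \<theta> \<in> Hom (q_cat P) w z \<and> Comp (q_cat P) (q_class P z x p) \<theta> = \<phi> \<and> Comp (q_cat P) (q_class P z y q) \<theta> = \<psi>"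
  proof (rule ex1I[of _ "q_class P w z h"])
    show "q_class P w z h \<in> Hom (q_cat P) w z \<and> Comp (q_cat P) (q_class P z x p) (q_class P w z h) = \<phi> \<and>
        Comp (q_cat P) (q_class P z y q) (q_class P w z h) = \<psi>"
      using w x y z p q hm h f g by (auto simp: hom_q_cat_iff comp_q_class)
  next
    fix \<theta> assume \<theta>: "\<theta> \<in> Hom (q_cat P) w z \<and> Comp (q_cat P) (q_class P z x p) \<theta> = \<phi> \<and> Comp (q_cat P) (q_class P z y q) \<theta> = \<psi>"
    then obtain k where k: "k \<in> q_maps P w z" "\<theta> = q_class P w z k"
      by (auto simp: hom_q_cat_iff)
    note kD = q_mapsD(1-3)[OF w z k(1)]
    have "q_class P w x (Comp C p k) = q_class P w x (Comp C p h)" "q_class P w y (Comp C q k) = q_class P w y (Comp C q h)"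
      using \<theta> k w x y z p q f g h(4,5) by (simp_all add: comp_q_class)
    then have sim: "(Comp C p k, Comp C p h) \<in> q_sim P w x" "(Comp C q k, Comp C q h) \<in> q_sim P w y"
      using q_class_eq_iff q_maps_comp w x y z k p q by blast+
    have "eqv z \<xi> (Comp C k a) (Comp C h a)" if a: "a \<in> Arr C" "Cod C a = fst w" "\<xi> \<in> preds (Dom C a)" for \<xi> a
    proof -
      have "eqv x \<xi> (Comp C (Comp C p k) a) (Comp C (Comp C p h) a)" "eqv y \<xi> (Comp C (Comp C q k) a) (Comp C (Comp C q h) a)"
        using q_simD[OF w x sim(1) a] q_simD[OF w y sim(2) a] by blast+
      then show ?thesis
        by (intro reflect) (use h(1-3) kD pD qD a in \<open>simp_all\<close>)
    qed
    then have "(k, h) \<in> q_sim P w z"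
      using w z k hm by (simp add: q_sim_iff)
    then show "\<theta> = q_class P w z h"
      using q_class_eq_iff[OF w z k(1)] k by simp
  qed
qed

lemma pr_q_maps:
  assumes "x \<in> q_obj P" "y \<in> q_obj P"
  shows "Pr1 C (fst x) (fst y) \<in> q_maps P (q_prod P x y) x" "Pr2 C (fst x) (fst y) \<in> q_maps P (q_prod P x y) y"
proof -
  have "eqv x \<xi> (Comp C (Pr1 C (fst x) (fst y)) a) (Comp C (Pr1 C (fst x) (fst y)) b)"
    "eqv y \<xi> (Comp C (Pr2 C (fst x) (fst y)) a) (Comp C (Pr2 C (fst x) (fst y)) b)"
    if ab: "eqv (q_prod P x y) \<xi> a b" for \<xi> a b
    using ab assms eqv_typing[OF ab] by (simp_all add: eqv_q_prod)
  then show "Pr1 C (fst x) (fst y) \<in> q_maps P (q_prod P x y) x" "Pr2 C (fst x) (fst y) \<in> q_maps P (q_prod P x y) y"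
    using assms by (simp_all add: q_maps_iff)
qed

lemma J_terminal:
  assumes T: "is_terminal C T"
  shows "is_terminal (q_cat P) (J_obj P T)"
proof (rule q_cat_is_terminal)
  have T_obj: "T \<in> Obj C" and uniq: "\<And>A. A \<in> Obj C \<Longrightarrow> \<exists>!h. h \<in> Hom C A T"
    using T by (auto simp: is_terminal_def)
  show q: "J_obj P T \<in> q_obj P" using T_obj by simp
  show "\<exists>h. h \<in> Hom C A (fst (J_obj P T))" if "A \<in> Obj C" for A
    using uniq[OF that] by auto
  fix \<xi> u v assume *: "u \<in> Arr C" "v \<in> Arr C" "Dom C u = Dom C v" "Cod C u = fst (J_obj P T)"
    "Cod C v = fst (J_obj P T)" "\<xi> \<in> preds (Dom C v)"
  then have "u = v"
    using uniq[of "Dom C u"] by (auto simp: Hom_def)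
  then show "eqv (J_obj P T) \<xi> u v"
    using * q by (simp add: eqv_refl)
qed

lemma q_prod_is_product:
  assumes x: "x \<in> q_obj P" and y: "y \<in> q_obj P"
  shows "is_product (q_cat P) x y (q_prod P x y) (q_class P (q_prod P x y) x (Pr1 C (fst x) (fst y)))
    (q_class P (q_prod P x y) y (Pr2 C (fst x) (fst y)))"
proof (rule q_cat_is_product)
  fix f g assume "f \<in> Arr C" "g \<in> Arr C" "Dom C f = Dom C g" "Cod C f = fst x" "Cod C g = fst y"
  then show "\<exists>h \<in> Hom C (Dom C g) (fst (q_prod P x y)). Comp C (Pr1 C (fst x) (fst y)) h = f \<and> Comp C (Pr2 C (fst x) (fst y)) h = g"
    by (intro bexI[of _ "tuple C f g"]) (simp_all add: Hom_def)
qed (use x y pr_q_maps in \<open>simp_all add: eqv_q_prod\<close>)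

lemma q_cat_fp: "fp_category (q_cat P)"
proof -
  interpret category "q_cat P" by (rule q_cat_category)
  show ?thesis
    using J_terminal[OF base.one_terminal] q_prod_is_product by unfold_locales simp_all
qed

end

section \<open>The doctrine of quotients\<close>

text \<open>Top and meet are picked by choice relative to the carrier, so restricting the carrier
  changes the terms. Antisymmetry identifies the new choices with the old ones once the subset is
  closed under the old operations.\<close>

lemma inf_sl_subset:
  assumes "inf_sl L" and S: "S \<subseteq> carrier L" "\<top>\<^bsub>L\<^esub> \<in> S"
    and closed: "\<And>x y. x \<in> S \<Longrightarrow> y \<in> S \<Longrightarrow> x \<sqinter>\<^bsub>L\<^esub> y \<in> S"
  shows "inf_sl (L\<lparr>carrier := S\<rparr>)"
    and "\<top>\<^bsub>L\<lparr>carrier := S\<rparr>\<^esub> = \<top>\<^bsub>L\<^esub>"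
    and "\<And>x y. x \<in> S \<Longrightarrow> y \<in> S \<Longrightarrow> x \<sqinter>\<^bsub>L\<lparr>carrier := S\<rparr>\<^esub> y = x \<sqinter>\<^bsub>L\<^esub> y"
proof -
  interpret L: inf_sl L by (rule assms(1))
  let ?M = "L\<lparr>carrier := S\<rparr>"
  interpret M: weak_partial_order ?M
    by (rule weak_partial_order_subset[OF L.weak_partial_order_axioms S(1)])
  have eq: "(.=\<^bsub>?M\<^esub>) = (=)"
    using L.eq_is_equal by simp
  have meet: "greatest ?M (x \<sqinter>\<^bsub>L\<^esub> y) (Lower ?M {x, y})" if "x \<in> S" "y \<in> S" for x y
  proof -
    have "x \<in> carrier L" "y \<in> carrier L" using that S by auto
    then show ?thesis
      using that S closed[OF that] by (auto simp: greatest_def Lower_def L.meet_left L.meet_right intro!: L.meet_le)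
  qed
  have top: "greatest ?M \<top>\<^bsub>L\<^esub> (carrier ?M)"
    using S by (auto simp: greatest_def)
  interpret M: inf_sl ?M
    by unfold_locales (use meet top eq in auto)
  show "inf_sl ?M" ..
  show "\<top>\<^bsub>?M\<^esub> = \<top>\<^bsub>L\<^esub>"
    using M.greatest_unique[OF M.top_greatest top] .
  show "x \<sqinter>\<^bsub>?M\<^esub> y = x \<sqinter>\<^bsub>L\<^esub> y" if "x \<in> S" "y \<in> S" for x y
    using M.greatest_unique[OF M.inf_of_two_greatest meet] that by (simp add: meet_def)
qed

context elementary_doctrine
begin

abbreviation Q where "Q \<equiv> quotient_completion P"

lemma q_sel [simp]:
  "Base Q = q_cat P"
  "Fib Q x = (Fib P (fst x))\<lparr>carrier := des P (fst x) (snd x)\<rparr>"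
  "Reidx Q \<phi> = Reidx P (q_rep \<phi>)"
  by (simp_all add: quotient_completion_def)

section \<open>Descent data as fibres of a primary doctrine\<close>

lemma des_subset: "x \<in> q_obj P \<Longrightarrow> des P (fst x) (snd x) \<subseteq> preds (fst x)"
  by (auto simp: des_iff)

lemma des_top [simp]: "x \<in> q_obj P \<Longrightarrow> \<top>\<^bsub>Fib P (fst x)\<^esub> \<in> des P (fst x) (snd x)"
  using eqv_typing by (auto simp: des_iff)

lemma des_meet [simp]:
  assumes x: "x \<in> q_obj P" and \<alpha>: "\<alpha> \<in> des P (fst x) (snd x)" and \<beta>: "\<beta> \<in> des P (fst x) (snd x)"
  shows "\<alpha> \<sqinter>\<^bsub>Fib P (fst x)\<^esub> \<beta> \<in> des P (fst x) (snd x)"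
  unfolding des_iff[OF x]
proof (intro conjI allI impI)
  note cl = desD(1)[OF x \<alpha>] desD(1)[OF x \<beta>]
  then show "\<alpha> \<sqinter>\<^bsub>Fib P (fst x)\<^esub> \<beta> \<in> preds (fst x)" using x by simp
  fix \<xi> a b assume ab: "eqv x \<xi> a b" "forces \<xi> a (\<alpha> \<sqinter>\<^bsub>Fib P (fst x)\<^esub> \<beta>)"
  then show "forces \<xi> b (\<alpha> \<sqinter>\<^bsub>Fib P (fst x)\<^esub> \<beta>)"
    using desD(2)[OF x \<alpha> ab(1)] desD(2)[OF x \<beta> ab(1)] cl eqv_typing[OF ab(1)] by simp
qed

lemma q_fib:
  assumes x: "x \<in> q_obj P"
  shows "inf_sl (Fib Q x)" and "\<top>\<^bsub>Fib Q x\<^esub> = \<top>\<^bsub>Fib P (fst x)\<^esub>"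
    and "\<alpha> \<in> des P (fst x) (snd x) \<Longrightarrow> \<beta> \<in> des P (fst x) (snd x) \<Longrightarrow> \<alpha> \<sqinter>\<^bsub>Fib Q x\<^esub> \<beta> = \<alpha> \<sqinter>\<^bsub>Fib P (fst x)\<^esub> \<beta>"
  unfolding q_sel
  using inf_sl_subset[OF fib_inf_sl des_subset[OF x] des_top[OF x] des_meet[OF x]] x by simp_all

lemma reidx_des:
  assumes x: "x \<in> q_obj P" and y: "y \<in> q_obj P" and f: "f \<in> q_maps P x y" and \<alpha>: "\<alpha> \<in> des P (fst y) (snd y)"
  shows "Reidx P f \<alpha> \<in> des P (fst x) (snd x)"
  unfolding des_iff[OF x]
proof (intro conjI allI impI)
  note fD = q_mapsD(1-3)[OF x y f] and cl = desD(1)[OF y \<alpha>]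
  show "Reidx P f \<alpha> \<in> preds (fst x)" using fD cl by simp
  fix \<xi> a b assume ab: "eqv x \<xi> a b" "forces \<xi> a (Reidx P f \<alpha>)"
  then show "forces \<xi> b (Reidx P f \<alpha>)"
    using desD(2)[OF y \<alpha> q_mapsD(4)[OF x y f ab(1)]] fD cl eqv_typing[OF ab(1)] by simp
qed

text \<open>Since f a ~ g a, descent data cannot tell the two values apart. The relation between the
  maps is symmetric, so one inequality gives both.\<close>

lemma reidx_q_sim:
  assumes x: "x \<in> q_obj P" and y: "y \<in> q_obj P" and fg: "(f, g) \<in> q_sim P x y" and \<alpha>: "\<alpha> \<in> des P (fst y) (snd y)"
  shows "Reidx P f \<alpha> = Reidx P g \<alpha>"
proof -
  have le: "Reidx P f \<alpha> \<sqsubseteq>\<^bsub>Fib P (fst x)\<^esub> Reidx P g \<alpha>" if fg: "(f, g) \<in> q_sim P x y" for f g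
  proof -
    have f: "f \<in> q_maps P x y" and g: "g \<in> q_maps P x y" using fg x y by (simp_all add: q_sim_iff)
    note D = q_mapsD(1-3)[OF x y f] q_mapsD(1-3)[OF x y g] desD(1)[OF y \<alpha>]
    show ?thesis
    proof (rule le_forcesI)
      fix a \<xi> assume a: "a \<in> Arr C" "Cod C a = fst x" "\<xi> \<in> preds (Dom C a)" "forces \<xi> a (Reidx P f \<alpha>)"
      then show "forces \<xi> a (Reidx P g \<alpha>)"
        using desD(2)[OF y \<alpha> q_simD[OF x y fg a(1-3)]] D by simp
    qed (use x D in simp_all)
  qed
  have "f \<in> q_maps P x y" "g \<in> q_maps P x y" using fg x y by (simp_all add: q_sim_iff)
  then show ?thesis
    using le[OF fg] le[OF q_sim_equiv(2)[OF x y fg]] q_mapsD(1-3)[OF x y] desD(1)[OF y \<alpha>] x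
    by (intro fib_antisym[of "fst x"]) simp_all
qed

lemma reidx_q_class [simp]:
  assumes "x \<in> q_obj P" "y \<in> q_obj P" "f \<in> q_maps P x y" "\<alpha> \<in> des P (fst y) (snd y)"
  shows "Reidx P (q_rep (q_class P x y f)) \<alpha> = Reidx P f \<alpha>"
  using reidx_q_sim[OF assms(1,2) q_rep_sim[OF assms(1-3)] assms(4)] by simp

lemma Q_primary: "primary_doctrine Q"
proof (rule primary_doctrine.intro)
  show "fp_category (Base Q)" using q_cat_fp by simp
next
  fix x assume "x \<in> Obj (Base Q)" then show "inf_sl (Fib Q x)" using q_fib(1) by simp
next
  fix \<phi> x y assume "\<phi> \<in> Hom (Base Q) x y"
  then obtain f where x: "x \<in> q_obj P" and y: "y \<in> q_obj P" and f: "f \<in> q_maps P x y" and \<phi>: "\<phi> = q_class P x y f"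
    by (auto simp: hom_q_cat_iff)
  note fD = q_mapsD(1-3)[OF x y f]
  show "inf_sl_hom (Fib Q y) (Fib Q x) (Reidx Q \<phi>)"
    unfolding inf_sl_hom_def
  proof (intro conjI ballI)
    show "Reidx Q \<phi> \<in> carrier (Fib Q y) \<rightarrow> carrier (Fib Q x)"
      using x y f reidx_des by (simp add: \<phi>)
    show "Reidx Q \<phi> \<top>\<^bsub>Fib Q y\<^esub> = \<top>\<^bsub>Fib Q x\<^esub>"
      unfolding q_fib(2)[OF x] q_fib(2)[OF y] using x y f fD by (simp add: \<phi>)
    fix \<alpha> \<beta> assume "\<alpha> \<in> carrier (Fib Q y)" "\<beta> \<in> carrier (Fib Q y)"
    then have *: "\<alpha> \<in> des P (fst y) (snd y)" "\<beta> \<in> des P (fst y) (snd y)" by simp_all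
    have "Reidx Q \<phi> (\<alpha> \<sqinter>\<^bsub>Fib Q y\<^esub> \<beta>) = Reidx P f (\<alpha> \<sqinter>\<^bsub>Fib P (fst y)\<^esub> \<beta>)"
      unfolding q_fib(3)[OF y *] using x y f * by (simp add: \<phi>)
    also have "\<dots> = Reidx P f \<alpha> \<sqinter>\<^bsub>Fib P (fst x)\<^esub> Reidx P f \<beta>"
      using reidx_meet[of f "fst y" \<alpha> \<beta>] fD * des_subset[OF y] by auto
    also have "\<dots> = Reidx P f \<alpha> \<sqinter>\<^bsub>Fib Q x\<^esub> Reidx P f \<beta>"
      using q_fib(3)[OF x reidx_des[OF x y f *(1)] reidx_des[OF x y f *(2)]] by simp
    finally show "Reidx Q \<phi> (\<alpha> \<sqinter>\<^bsub>Fib Q y\<^esub> \<beta>) = Reidx Q \<phi> \<alpha> \<sqinter>\<^bsub>Fib Q x\<^esub> Reidx Q \<phi> \<beta>"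
      using x y f * by (simp add: \<phi>)
  qed
next
  fix x \<alpha> assume "x \<in> Obj (Base Q)" "\<alpha> \<in> carrier (Fib Q x)"
  then show "Reidx Q (Ident (Base Q) x) \<alpha> = \<alpha>"
    using ident_q_maps[of x] des_subset[of x] by auto
next
  fix \<phi> \<psi> x y z \<alpha> assume "\<phi> \<in> Hom (Base Q) x y" "\<psi> \<in> Hom (Base Q) y z" "\<alpha> \<in> carrier (Fib Q z)"
  then obtain f g where x: "x \<in> q_obj P" and y: "y \<in> q_obj P" and z: "z \<in> q_obj P"
    and f: "f \<in> q_maps P x y" and \<phi>: "\<phi> = q_class P x y f"
    and g: "g \<in> q_maps P y z" and \<psi>: "\<psi> = q_class P y z g" and \<alpha>: "\<alpha> \<in> des P (fst z) (snd z)"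
    by (auto simp: hom_q_cat_iff)
  then show "Reidx Q (Comp (Base Q) \<psi> \<phi>) \<alpha> = Reidx Q \<phi> (Reidx Q \<psi> \<alpha>)"
    using q_mapsD(1-3)[OF x y f] q_mapsD(1-3)[OF y z g] des_subset[OF z] q_maps_comp[OF x y z f g]
      reidx_des[OF y z g \<alpha>] by (auto simp: comp_q_class)
qed

section \<open>Left adjoints between descent data\<close>

lemma Q_left_adjoint_iff:
  assumes "x \<in> q_obj P" "y \<in> q_obj P" "f \<in> q_maps P x y"
  shows "is_left_adjoint Q (q_class P x y f) E \<longleftrightarrow>
    E \<in> des P (fst x) (snd x) \<rightarrow> des P (fst y) (snd y) \<and>
    (\<forall>\<beta> \<in> des P (fst x) (snd x). \<forall>\<alpha> \<in> des P (fst y) (snd y).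
      E \<beta> \<sqsubseteq>\<^bsub>Fib P (fst y)\<^esub> \<alpha> \<longleftrightarrow> \<beta> \<sqsubseteq>\<^bsub>Fib P (fst x)\<^esub> Reidx P f \<alpha>)"
  using primary_doctrine.is_left_adjoint_iff[OF Q_primary, of "q_class P x y f" E] assms by simp

lemma Q_ex_along_eq:
  assumes "x \<in> q_obj P" "y \<in> q_obj P" "f \<in> q_maps P x y" "is_left_adjoint Q (q_class P x y f) E"
    "\<beta> \<in> des P (fst x) (snd x)"
  shows "ex_along Q (q_class P x y f) \<beta> = E \<beta>"
  using primary_doctrine.ex_along_eq[OF Q_primary, of "q_class P x y f" E \<beta>] assms by simp

section \<open>Pairings and diagonals of the completion on representatives\<close>

lemma tuple_q_maps:
  assumes w: "w \<in> q_obj P" and x: "x \<in> q_obj P" and y: "y \<in> q_obj P"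
    and f: "f \<in> q_maps P w x" and g: "g \<in> q_maps P w y"
  shows "tuple C f g \<in> q_maps P w (q_prod P x y)"
proof -
  note D = q_mapsD(1-3)[OF w x f] q_mapsD(1-3)[OF w y g]
  have "eqv (q_prod P x y) \<xi> (Comp C (tuple C f g) a) (Comp C (tuple C f g) b)" if ab: "eqv w \<xi> a b" for \<xi> a b
    using q_mapsD(4)[OF w x f ab] q_mapsD(4)[OF w y g ab] D eqv_typing[OF ab] x y by (simp add: eqv_q_prod)
  then show ?thesis using w x y D by (simp add: q_maps_iff)
qed

lemma tuple_q_class:
  assumes w: "w \<in> q_obj P" and x: "x \<in> q_obj P" and y: "y \<in> q_obj P"
    and f: "f \<in> q_maps P w x" and g: "g \<in> q_maps P w y"
  shows "tuple (q_cat P) (q_class P w x f) (q_class P w y g) = q_class P w (q_prod P x y) (tuple C f g)"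
proof -
  interpret q: fp_category "q_cat P" by (rule q_cat_fp)
  note D = q_mapsD(1-3)[OF w x f] q_mapsD(1-3)[OF w y g]
  have 1: "Comp (q_cat P) (Pr1 (q_cat P) x y) (tuple (q_cat P) (q_class P w x f) (q_class P w y g)) = q_class P w x f"
    "Comp (q_cat P) (Pr2 (q_cat P) x y) (tuple (q_cat P) (q_class P w x f) (q_class P w y g)) = q_class P w y g"
    \<comment> \<open>The projections of \<open>q_cat P\<close> are kept folded so that the
      projection rules of \<open>q\<close> still match.\<close>
    using assms by (auto intro!: q.pr1_tuple q.pr2_tuple simp del: q_cat_sel(7,8))
  have 2: "Comp (q_cat P) (Pr1 (q_cat P) x y) (q_class P w (q_prod P x y) (tuple C f g)) = q_class P w x f"
    "Comp (q_cat P) (Pr2 (q_cat P) x y) (q_class P w (q_prod P x y) (tuple C f g)) = q_class P w y g"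
    using assms D tuple_q_maps[OF assms] pr_q_maps[OF x y] by (simp_all add: comp_q_class)
  have 3: "tuple (q_cat P) (q_class P w x f) (q_class P w y g) \<in> Arr (q_cat P)"
    "Dom (q_cat P) (tuple (q_cat P) (q_class P w x f) (q_class P w y g)) = w"
    "Cod (q_cat P) (tuple (q_cat P) (q_class P w x f) (q_class P w y g)) = Prod (q_cat P) x y"
    using assms by (simp_all only: q.tuple_arr q.tuple_dom q.tuple_cod q_class_arr q_cat_sel)
  show ?thesis
    by (rule q.prod_ext[of _ _ x y]) (use assms tuple_q_maps[OF assms] in \<open>simp_all only: 1 2 3 q_class_arr q_cat_sel(1-6) q_prod_obj\<close>)
qed

lemma diag_q_class:
  assumes x: "x \<in> q_obj P"
  shows "diag (q_cat P) x = q_class P x (q_prod P x x) (diag C (fst x))"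
    and "diag C (fst x) \<in> q_maps P x (q_prod P x x)"
  using tuple_q_class[OF x x x] tuple_q_maps[OF x x x] ident_q_maps[OF x] x by (simp_all add: diag_def)

lemma id_times_diag_q_class:
  assumes d: "d \<in> q_obj P" and x: "x \<in> q_obj P"
  shows "id_times_diag (q_cat P) d x =
      q_class P (q_prod P d x) (q_prod P d (q_prod P x x)) (id_times_diag C (fst d) (fst x))"
    and "id_times_diag C (fst d) (fst x) \<in> q_maps P (q_prod P d x) (q_prod P d (q_prod P x x))"
proof -
  note xx = q_prod_obj[OF x x] and dx = q_prod_obj[OF d x]
  let ?f = "Comp C (Ident C (fst d)) (Pr1 C (fst d) (fst x))" and ?g = "Comp C (diag C (fst x)) (Pr2 C (fst d) (fst x))"
  have f: "?f \<in> q_maps P (q_prod P d x) d" and g: "?g \<in> q_maps P (q_prod P d x) (q_prod P x x)"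
    using q_maps_comp[OF dx d d pr_q_maps(1)[OF d x] ident_q_maps[OF d]]
      q_maps_comp[OF dx x xx pr_q_maps(2)[OF d x] diag_q_class(2)[OF x]] by blast+
  have eq: "id_times_diag C (fst d) (fst x) = tuple C ?f ?g"
    using d x by (simp add: id_times_diag_def times_arr_def)
  show "id_times_diag C (fst d) (fst x) \<in> q_maps P (q_prod P d x) (q_prod P d (q_prod P x x))"
    unfolding eq by (rule tuple_q_maps[OF dx d xx f g])
  have "id_times_diag (q_cat P) d x = tuple (q_cat P) (q_class P (q_prod P d x) d ?f) (q_class P (q_prod P d x) (q_prod P x x) ?g)"
    using d x xx dx comp_q_class[OF dx d d pr_q_maps(1)[OF d x] ident_q_maps[OF d]]
      comp_q_class[OF dx x xx pr_q_maps(2)[OF d x] diag_q_class(2)[OF x]]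
    by (simp only: id_times_diag_def times_arr_def diag_q_class(1) q_cat_sel)
  also have "\<dots> = q_class P (q_prod P d x) (q_prod P d (q_prod P x x)) (id_times_diag C (fst d) (fst x))"
    unfolding eq by (rule tuple_q_class[OF dx d xx f g])
  finally show "id_times_diag (q_cat P) d x =
      q_class P (q_prod P d x) (q_prod P d (q_prod P x x)) (id_times_diag C (fst d) (fst x))" .
qed

end

section \<open>Existential quantification along arrows of the quotient completion\<close>

text \<open>A projection may be either leg of a product diagram; by the swap, it can be taken to be
  the first.\<close>

lemma is_product_swap: "is_product C A B X p q \<Longrightarrow> is_product C B A X q p"
  unfolding is_product_def by (simp add: conj_commute)

locale existential_elementary_doctrine = elementary_doctrine P + existential_doctrine P for P
begin

text \<open>In the internal language, \<open>qex x y f \<beta>\<close> is \<open>\<exists>a. \<beta> a \<and> f a \<sim> b\<close>.\<close>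

definition qex where
  "qex x y f \<beta> = ex (fst x) (fst y) (Reidx P (Pr1 C (fst x) (fst y)) \<beta> \<sqinter>\<^bsub>Fib P (Prod C (fst x) (fst y))\<^esub>
    Reidx P (tuple C (Comp C f (Pr1 C (fst x) (fst y))) (Pr2 C (fst x) (fst y))) (snd y))"

context
  fixes x y f \<beta>
  assumes x: "x \<in> q_obj P" and y: "y \<in> q_obj P" and f: "f \<in> q_maps P x y" and \<beta>: "\<beta> \<in> des P (fst x) (snd x)"
begin

lemma qex_closed: "qex x y f \<beta> \<in> preds (fst y)"
  using x y q_mapsD(1-3)[OF x y f] desD(1)[OF x \<beta>] by (simp add: qex_def)

lemma forces_qexI:
  assumes a: "forces \<xi> a \<beta>" and ab: "eqv y \<xi> (Comp C f a) b" and "Cod C a = fst x"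
  shows "forces \<xi> b (qex x y f \<beta>)"
proof -
  note fD = q_mapsD(1-3)[OF x y f]
  have aD: "a \<in> Arr C" "Dom C a = Dom C b" "b \<in> Arr C" "Cod C b = fst y"
    using forces_typing[OF a] eqv_typing[OF ab] fD assms(3) by simp_all
  show ?thesis
    unfolding qex_def
    by (rule forces_exI[of a]) (use ab a aD fD assms(3) desD(1)[OF x \<beta>] x y in \<open>simp_all add: eqv_def\<close>)
qed

lemma forces_qexE:
  assumes b: "forces \<xi> b (qex x y f \<beta>)" "Cod C b = fst y"
    and c: "c \<in> Arr C" "Dom C c = Dom C b" "\<psi> \<in> preds (Cod C c)"
    and step: "\<And>h a \<xi>'. h \<in> Arr C \<Longrightarrow> Cod C h = Dom C b \<Longrightarrow> forces \<xi>' h \<xi> \<Longrightarrow> a \<in> Arr C \<Longrightarrow> Dom C a = Dom C h \<Longrightarrow>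
      Cod C a = fst x \<Longrightarrow> forces \<xi>' a \<beta> \<Longrightarrow> eqv y \<xi>' (Comp C f a) (Comp C b h) \<Longrightarrow> forces \<xi>' (Comp C c h) \<psi>"
  shows "forces \<xi> c \<psi>"
proof (rule forces_exE[OF b(1)[unfolded qex_def] b(2)])
  note fD = q_mapsD(1-3)[OF x y f]
  have bD: "b \<in> Arr C" using forces_typing[OF b(1)] by simp
  fix h a \<xi>' assume h: "h \<in> Arr C" "a \<in> Arr C" "Dom C a = Dom C h" "Cod C h = Dom C b" "Cod C a = fst x"
    "forces \<xi>' h \<xi>" and *: "forces \<xi>' (tuple C a (Comp C b h)) (Reidx P (Pr1 C (fst x) (fst y)) \<beta>
      \<sqinter>\<^bsub>Fib P (Prod C (fst x) (fst y))\<^esub>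
      Reidx P (tuple C (Comp C f (Pr1 C (fst x) (fst y))) (Pr2 C (fst x) (fst y))) (snd y))"
  have "forces \<xi>' a \<beta>" "eqv y \<xi>' (Comp C f a) (Comp C b h)"
    using * h b(2) bD fD desD(1)[OF x \<beta>] x y by (simp_all add: eqv_def)
  then show "forces \<xi>' (Comp C c h) \<psi>"
    using step h by blast
qed (use x y c q_mapsD(1-3)[OF x y f] desD(1)[OF x \<beta>] in simp_all)

text \<open>The same witness serves for an equivalent element: f a ~ b and b ~ b' give f a ~
  b'.\<close>

lemma qex_des: "qex x y f \<beta> \<in> des P (fst y) (snd y)"
  unfolding des_iff[OF y]
proof (intro conjI allI impI)
  show "qex x y f \<beta> \<in> preds (fst y)" by (rule qex_closed)
  fix \<xi> b b' assume bb': "eqv y \<xi> b b'" and b: "forces \<xi> b (qex x y f \<beta>)"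
  note D = eqv_typing[OF bb']
  show "forces \<xi> b' (qex x y f \<beta>)"
  proof (rule forces_qexE[OF b])
    fix h a \<xi>' assume h: "h \<in> Arr C" "Cod C h = Dom C b" "forces \<xi>' h \<xi>" and a: "Cod C a = fst x" "forces \<xi>' a \<beta>"
      and ab: "eqv y \<xi>' (Comp C f a) (Comp C b h)"
    have "eqv y \<xi>' (Comp C b h) (Comp C b' h)"
      by (rule eqv_stage[OF bb' h(3)]) (use h D in simp)
    then show "forces \<xi>' (Comp C b' h) (qex x y f \<beta>)"
      by (intro forces_qexI[OF a(2) _ a(1)]) (rule eqv_trans[OF y ab])
  qed (use D qex_closed in simp_all)
qed

text \<open>From left to right, every a is a witness for b = f a, by reflexivity. From right to
  left, \<alpha> holds at f a and is carried along f a ~ b because it is descent data.\<close>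

lemma qex_le_iff:
  assumes \<alpha>: "\<alpha> \<in> des P (fst y) (snd y)"
  shows "qex x y f \<beta> \<sqsubseteq>\<^bsub>Fib P (fst y)\<^esub> \<alpha> \<longleftrightarrow> \<beta> \<sqsubseteq>\<^bsub>Fib P (fst x)\<^esub> Reidx P f \<alpha>"
proof
  note fD = q_mapsD(1-3)[OF x y f] and cl = desD(1)[OF x \<beta>] desD(1)[OF y \<alpha>]
  assume le: "qex x y f \<beta> \<sqsubseteq>\<^bsub>Fib P (fst y)\<^esub> \<alpha>"
  show "\<beta> \<sqsubseteq>\<^bsub>Fib P (fst x)\<^esub> Reidx P f \<alpha>"
  proof (rule le_forcesI)
    fix a \<xi> assume a: "a \<in> Arr C" "Cod C a = fst x" "\<xi> \<in> preds (Dom C a)" "forces \<xi> a \<beta>"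
    have "forces \<xi> (Comp C f a) (qex x y f \<beta>)"
      by (rule forces_qexI[OF a(4) _ a(2)], rule eqv_refl[OF y]) (use a fD in simp_all)
    then have "forces \<xi> (Comp C f a) \<alpha>"
      by (intro forces_mono[OF le]) (use a fD cl in simp_all)
    then show "forces \<xi> a (Reidx P f \<alpha>)" using a fD cl by simp
  qed (use x fD cl in simp_all)
next
  note fD = q_mapsD(1-3)[OF x y f] and cl = desD(1)[OF x \<beta>] desD(1)[OF y \<alpha>]
  assume le: "\<beta> \<sqsubseteq>\<^bsub>Fib P (fst x)\<^esub> Reidx P f \<alpha>"
  show "qex x y f \<beta> \<sqsubseteq>\<^bsub>Fib P (fst y)\<^esub> \<alpha>"
  proof (rule le_forcesI)
    fix b \<xi> assume b: "b \<in> Arr C" "Cod C b = fst y" "forces \<xi> b (qex x y f \<beta>)"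
    show "forces \<xi> b \<alpha>"
    proof (rule forces_qexE[OF b(3,2)])
      fix h a \<xi>' assume a: "a \<in> Arr C" "Cod C a = fst x" "forces \<xi>' a \<beta>" "eqv y \<xi>' (Comp C f a) (Comp C b h)"
      have "forces \<xi>' a (Reidx P f \<alpha>)"
        by (rule forces_mono[OF le]) (use a fD cl in simp_all)
      then have "forces \<xi>' (Comp C f a) \<alpha>" using a fD cl by simp
      then show "forces \<xi>' (Comp C b h) \<alpha>" by (rule desD(2)[OF y \<alpha> a(4)])
    qed (use b cl in simp_all)
  qed (use y qex_closed cl in simp_all)
qed

end

text \<open>Both sides ask for a witness a with \<beta> a and f a ~ b; they differ in whether
  \<alpha> is required at f a or at b, and descent carries \<alpha> between the two.\<close>

lemma qex_frobenius:
  assumes x: "x \<in> q_obj P" and y: "y \<in> q_obj P" and f: "f \<in> q_maps P x y" and \<beta>: "\<beta> \<in> des P (fst x) (snd x)"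
    and \<alpha>: "\<alpha> \<in> des P (fst y) (snd y)"
  shows "qex x y f (Reidx P f \<alpha> \<sqinter>\<^bsub>Fib P (fst x)\<^esub> \<beta>) = \<alpha> \<sqinter>\<^bsub>Fib P (fst y)\<^esub> qex x y f \<beta>" (is "qex x y f ?\<beta> = ?R")
proof -
  note fD = q_mapsD(1-3)[OF x y f] and cl = desD(1)[OF x \<beta>] desD(1)[OF y \<alpha>]
  have \<beta>': "?\<beta> \<in> des P (fst x) (snd x)" using des_meet[OF x reidx_des[OF x y f \<alpha>] \<beta>] .
  have cl': "qex x y f ?\<beta> \<in> preds (fst y)" "qex x y f \<beta> \<in> preds (fst y)" "?R \<in> preds (fst y)"
    using qex_closed[OF x y f] \<beta> \<beta>' cl y by simp_all
  show ?thesis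
  proof (rule fib_antisym[of "fst y"])
    show "qex x y f ?\<beta> \<sqsubseteq>\<^bsub>Fib P (fst y)\<^esub> ?R"
    proof (rule le_forcesI)
      fix b \<xi> assume b: "b \<in> Arr C" "Cod C b = fst y" "forces \<xi> b (qex x y f ?\<beta>)"
      show "forces \<xi> b ?R"
      proof (rule forces_qexE[OF x y f \<beta>' b(3,2)])
        fix h a \<xi>' assume h: "h \<in> Arr C" "Cod C h = Dom C b" and a: "a \<in> Arr C" "Cod C a = fst x" "forces \<xi>' a ?\<beta>" "eqv y \<xi>' (Comp C f a) (Comp C b h)"
        have "forces \<xi>' (Comp C f a) \<alpha>" "forces \<xi>' a \<beta>" using a fD cl by simp_all
        then have "forces \<xi>' (Comp C b h) \<alpha>" "forces \<xi>' (Comp C b h) (qex x y f \<beta>)"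
          using desD(2)[OF y \<alpha> a(4)] forces_qexI[OF x y f \<beta> _ a(4,2)] by blast+
        then show "forces \<xi>' (Comp C b h) ?R" using b h cl cl' by simp
      qed (use b cl' in simp_all)
    qed (use y cl' in simp_all)
    show "?R \<sqsubseteq>\<^bsub>Fib P (fst y)\<^esub> qex x y f ?\<beta>"
    proof (rule le_forcesI)
      fix b \<xi> assume b: "b \<in> Arr C" "Cod C b = fst y" "forces \<xi> b ?R"
      then have b1: "forces \<xi> b \<alpha>" and b2: "forces \<xi> b (qex x y f \<beta>)" using cl cl' by simp_all
      show "forces \<xi> b (qex x y f ?\<beta>)"
      proof (rule forces_qexE[OF x y f \<beta> b2 b(2)])
        fix h a \<xi>' assume h: "h \<in> Arr C" "Cod C h = Dom C b" "forces \<xi>' h \<xi>"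
          and a: "a \<in> Arr C" "Cod C a = fst x" "forces \<xi>' a \<beta>" "eqv y \<xi>' (Comp C f a) (Comp C b h)"
        have "forces \<xi>' (Comp C b h) \<alpha>" using forces_stage[OF h(3) b1 h(2)] .
        then have "forces \<xi>' (Comp C f a) \<alpha>" by (rule desD(2)[OF y \<alpha> eqv_sym[OF y a(4)]])
        then have "forces \<xi>' a ?\<beta>" using a fD cl by simp
        then show "forces \<xi>' (Comp C b h) (qex x y f ?\<beta>)"
          by (rule forces_qexI[OF x y f \<beta>' _ a(4,2)])
      qed (use b cl' in simp_all)
    qed (use y cl' in simp_all)
  qed (use y cl' in simp_all)
qed

lemma qex_left_adjoint:
  assumes "x \<in> q_obj P" "y \<in> q_obj P" "f \<in> q_maps P x y"
  shows "is_left_adjoint Q (q_class P x y f) (qex x y f)"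
  using assms qex_des qex_le_iff by (simp add: Q_left_adjoint_iff)

lemma Q_has_left_adjoint:
  assumes "\<phi> \<in> Arr (q_cat P)"
  shows "has_left_adjoint Q \<phi>"
proof -
  have "\<phi> \<in> Hom (q_cat P) (Dom (q_cat P) \<phi>) (Cod (q_cat P) \<phi>)" using assms by (simp add: Hom_def)
  then show ?thesis
    unfolding hom_q_cat_iff has_left_adjoint_def using qex_left_adjoint by metis
qed

lemma ex_along_Q:
  assumes "x \<in> q_obj P" "y \<in> q_obj P" "f \<in> q_maps P x y" "\<beta> \<in> des P (fst x) (snd x)"
  shows "ex_along Q (q_class P x y f) \<beta> = qex x y f \<beta>"
  using Q_ex_along_eq[OF assms(1-3) qex_left_adjoint[OF assms(1-3)] assms(4)] .

lemma Q_frobenius_class: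
  assumes x: "x \<in> q_obj P" and y: "y \<in> q_obj P" and f: "f \<in> q_maps P x y"
  shows "frobenius Q (q_class P x y f)"
  unfolding frobenius_def
proof (intro ballI)
  fix \<alpha> \<beta> assume "\<alpha> \<in> carrier (Fib Q (Cod (Base Q) (q_class P x y f)))" "\<beta> \<in> carrier (Fib Q (Dom (Base Q) (q_class P x y f)))"
  then have \<alpha>: "\<alpha> \<in> des P (fst y) (snd y)" and \<beta>: "\<beta> \<in> des P (fst x) (snd x)" by simp_all
  note f\<alpha> = reidx_des[OF x y f \<alpha>]
  have "ex_along Q (q_class P x y f) (Reidx P f \<alpha> \<sqinter>\<^bsub>Fib Q x\<^esub> \<beta>) = \<alpha> \<sqinter>\<^bsub>Fib Q y\<^esub> ex_along Q (q_class P x y f) \<beta>"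
    unfolding q_fib(3)[OF x f\<alpha> \<beta>] ex_along_Q[OF x y f \<beta>] ex_along_Q[OF x y f des_meet[OF x f\<alpha> \<beta>]]
      q_fib(3)[OF y \<alpha> qex_des[OF x y f \<beta>]]
    by (rule qex_frobenius[OF x y f \<beta> \<alpha>])
  then show "ex_along Q (q_class P x y f) (Reidx Q (q_class P x y f) \<alpha>
        \<sqinter>\<^bsub>Fib Q (Dom (Base Q) (q_class P x y f))\<^esub> \<beta>) =
      \<alpha> \<sqinter>\<^bsub>Fib Q (Cod (Base Q) (q_class P x y f))\<^esub> ex_along Q (q_class P x y f) \<beta>"
    using x y f \<alpha> by (simp del: q_sel(2))
qed

lemma Q_frobenius:
  assumes "\<phi> \<in> Arr (q_cat P)"
  shows "frobenius Q \<phi>"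
proof -
  have "\<phi> \<in> Hom (q_cat P) (Dom (q_cat P) \<phi>) (Cod (q_cat P) \<phi>)" using assms by (simp add: Hom_def)
  then show ?thesis
    unfolding hom_q_cat_iff using Q_frobenius_class by metis
qed

text \<open>The adjoint along the diagonal gives the predicate "some a has (a, a) ~ (u, v)". Such an
  a yields u ~ a ~ v; conversely, if u ~ v, then u is a witness.\<close>

lemma eq_pred_Q:
  assumes x: "x \<in> q_obj P"
  shows "eq_pred Q x = snd x"
proof -
  let ?A = "fst x" and ?y = "q_prod P x x"
  have A: "?A \<in> Obj C" using x by simp
  note y = q_prod_obj[OF x x] and f = diag_q_class(2)[OF x] and top = des_top[OF x]
  let ?E = "qex x ?y (diag C ?A) \<top>\<^bsub>Fib P ?A\<^esub>"
  have cl: "?E \<in> preds (Prod C ?A ?A)" "snd x \<in> preds (Prod C ?A ?A)"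
    using qex_closed[OF x y f top] x by simp_all
  have "?E = snd x"
  proof (rule fib_antisym[of "Prod C ?A ?A"])
    show "?E \<sqsubseteq>\<^bsub>Fib P (Prod C ?A ?A)\<^esub> snd x"
    proof (rule le_forces_prodI)
      fix u v \<xi> assume uv: "u \<in> Arr C" "v \<in> Arr C" "Dom C u = Dom C v" "Cod C u = ?A" "Cod C v = ?A"
        and E: "forces \<xi> (tuple C u v) ?E"
      show "forces \<xi> (tuple C u v) (snd x)"
      proof (rule forces_qexE[OF x y f top E])
        fix h a \<xi>' assume h: "h \<in> Arr C" "Cod C h = Dom C (tuple C u v)" and a: "a \<in> Arr C" "Dom C a = Dom C h" "Cod C a = ?A"
          "eqv ?y \<xi>' (Comp C (diag C ?A) a) (Comp C (tuple C u v) h)"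
        have "eqv x \<xi>' a (Comp C u h)" "eqv x \<xi>' a (Comp C v h)"
          using a h uv A x by (simp_all add: eqv_q_prod)
        then have "eqv x \<xi>' (Comp C u h) (Comp C v h)"
          using eqv_sym[OF x] eqv_trans[OF x] by blast
        then show "forces \<xi>' (Comp C (tuple C u v) h) (snd x)"
          using h uv by (simp add: eqv_def)
      qed (use uv cl in simp_all)
    qed (use A cl in simp_all)
    show "snd x \<sqsubseteq>\<^bsub>Fib P (Prod C ?A ?A)\<^esub> ?E"
    proof (rule le_forces_prodI)
      fix u v \<xi> assume uv: "u \<in> Arr C" "v \<in> Arr C" "Dom C u = Dom C v" "Cod C u = ?A" "Cod C v = ?A"
        and \<xi>: "\<xi> \<in> preds (Dom C v)" and E: "forces \<xi> (tuple C u v) (snd x)"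
      have "eqv x \<xi> u v" using uv E by (simp add: eqv_def)
      moreover have "eqv x \<xi> u u" by (rule eqv_refl[OF x]) (use uv \<xi> in simp_all)
      ultimately have "eqv ?y \<xi> (Comp C (diag C ?A) u) (tuple C u v)"
        using uv A x by (simp add: eqv_q_prod)
      then show "forces \<xi> (tuple C u v) ?E"
        by (intro forces_qexI[OF x y f top, of \<xi> u]) (use uv \<xi> in simp_all)
    qed (use A cl in simp_all)
  qed (use A cl in simp_all)
  then show ?thesis
    using ex_along_Q[OF x y f top] q_fib(2)[OF x] x by (simp add: eq_pred_def diag_q_class(1))
qed

text \<open>Since the relation is an image under \<open>qex\<close>, it inherits the descent
  property from \<open>qex_des\<close>.\<close>

lemma eq_pred_Q_des:
  assumes x: "x \<in> q_obj P"
  shows "snd x \<in> des P (fst (q_prod P x x)) (snd (q_prod P x x))"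
proof -
  note xx = q_prod_obj[OF x x] and diag = diag_q_class(2)[OF x] and top = des_top[OF x]
  have "qex x (q_prod P x x) (diag C (fst x)) \<top>\<^bsub>Fib P (fst x)\<^esub> = snd x"
    using eq_pred_Q[OF x] ex_along_Q[OF x xx diag top] q_fib(2)[OF x]
    by (simp add: eq_pred_def diag_q_class(1)[OF x] del: q_sel(2))
  then show ?thesis using qex_des[OF x xx diag top] by simp
qed

text \<open>The computation of the equality predicate, repeated in the context \<open>d\<close>:
  some pair (c, a) has (c, (a, a)) ~ (u, (v1, v2)) exactly when v1 ~ v2, with witness (u,
  v1).\<close>

lemma Q_eq_weakening:
  assumes d: "d \<in> q_obj P" and x: "x \<in> q_obj P"
  shows "ex_along Q (id_times_diag (Base Q) d x) \<top>\<^bsub>Fib Q (Prod (Base Q) d x)\<^esub> =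
    Reidx Q (Pr2 (Base Q) d (Prod (Base Q) x x)) (eq_pred Q x)"
proof -
  let ?D = "fst d" and ?A = "fst x" and ?z = "q_prod P d x" and ?y = "q_prod P d (q_prod P x x)"
  let ?B = "Prod C ?D (Prod C ?A ?A)" and ?f = "id_times_diag C (fst d) (fst x)"
  have A: "?D \<in> Obj C" "?A \<in> Obj C" using d x by simp_all
  note xx = q_prod_obj[OF x x]
  note z = q_prod_obj[OF d x] and y = q_prod_obj[OF d xx] and f = id_times_diag_q_class(2)[OF d x]
  note top = des_top[OF z]
  let ?E = "qex ?z ?y ?f \<top>\<^bsub>Fib P (fst ?z)\<^esub>" and ?R = "Reidx P (Pr2 C ?D (Prod C ?A ?A)) (snd x)"
  have cl: "?E \<in> preds ?B" "?R \<in> preds ?B" "snd x \<in> preds (Prod C ?A ?A)"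
    using qex_closed[OF z y f top] x A by simp_all
  have "?E = ?R"
  proof (rule fib_antisym[of ?B])
    show "?E \<sqsubseteq>\<^bsub>Fib P ?B\<^esub> ?R"
    proof (rule le_forces_prodI)
      fix u v \<xi> assume uv: "u \<in> Arr C" "v \<in> Arr C" "Dom C u = Dom C v" "Cod C u = ?D" "Cod C v = Prod C ?A ?A"
        and E: "forces \<xi> (tuple C u v) ?E"
      show "forces \<xi> (tuple C u v) ?R"
      proof (rule forces_qexE[OF z y f top E])
        fix h a \<xi>' assume h: "h \<in> Arr C" "Cod C h = Dom C (tuple C u v)" and a: "a \<in> Arr C" "Dom C a = Dom C h" "Cod C a = fst ?z"
          "eqv ?y \<xi>' (Comp C ?f a) (Comp C (tuple C u v) h)"
        let ?a1 = "Comp C (Pr1 C ?D ?A) a" and ?a2 = "Comp C (Pr2 C ?D ?A) a"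
        \<comment> \<open>The witness is a single arrow into a product. It is split into its
          components so that id \<times> \<Delta> can be evaluated on it.\<close>
        have "Comp C ?f (tuple C ?a1 ?a2) = tuple C ?a1 (tuple C ?a2 ?a2)"
          using a(1-3) A by (intro base.id_times_diag_comp(4)) simp_all
        then have "Comp C ?f a = tuple C ?a1 (tuple C ?a2 ?a2)"
          using a(1-3) A by simp
        then have "eqv x \<xi>' ?a2 (Comp C (Pr1 C ?A ?A) (Comp C v h))" "eqv x \<xi>' ?a2 (Comp C (Pr2 C ?A ?A) (Comp C v h))"
          using a h uv A d x xx by (simp_all add: eqv_q_prod)
        then have "eqv x \<xi>' (Comp C (Pr1 C ?A ?A) (Comp C v h)) (Comp C (Pr2 C ?A ?A) (Comp C v h))"
          using eqv_sym[OF x] eqv_trans[OF x] by blast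
        then show "forces \<xi>' (Comp C (tuple C u v) h) ?R"
          using h uv A cl by (simp add: eqv_def)
      qed (use uv cl in simp_all)
    qed (use A cl in simp_all)
    show "?R \<sqsubseteq>\<^bsub>Fib P ?B\<^esub> ?E"
    proof (rule le_forces_prodI)
      fix u v \<xi> assume uv: "u \<in> Arr C" "v \<in> Arr C" "Dom C u = Dom C v" "Cod C u = ?D" "Cod C v = Prod C ?A ?A"
        and \<xi>: "\<xi> \<in> preds (Dom C v)" and E: "forces \<xi> (tuple C u v) ?R"
      let ?v1 = "Comp C (Pr1 C ?A ?A) v" and ?v2 = "Comp C (Pr2 C ?A ?A) v"
      have "eqv d \<xi> u u" "eqv x \<xi> ?v1 ?v1"
        using eqv_refl[OF d, of u \<xi>] eqv_refl[OF x, of ?v1 \<xi>] uv \<xi> A by simp_all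
      moreover have "eqv x \<xi> ?v1 ?v2" using uv E A cl by (simp add: eqv_def)
      ultimately have "eqv ?y \<xi> (Comp C ?f (tuple C u ?v1)) (tuple C u v)"
        using uv A d x xx by (simp add: eqv_q_prod)
      then show "forces \<xi> (tuple C u v) ?E"
        by (intro forces_qexI[OF z y f top, of \<xi> "tuple C u ?v1"]) (use uv \<xi> A in simp_all)
    qed (use A cl in simp_all)
  qed (use A cl in simp_all)
  moreover have "ex_along Q (id_times_diag (Base Q) d x) \<top>\<^bsub>Fib Q (Prod (Base Q) d x)\<^esub> = ?E"
    using ex_along_Q[OF z y f top] q_fib(2)[OF z] by (simp add: id_times_diag_q_class(1)[OF d x] del: q_sel(2))
  ultimately show ?thesis
    using reidx_q_class[OF y xx] pr_q_maps(2)[OF d xx] eq_pred_Q_des[OF x] by (simp add: eq_pred_Q[OF x])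
qed

lemma Q_elementary: "elementary_doctrine Q"
proof (intro elementary_doctrine.intro elementary_doctrine_axioms.intro Q_primary)
  interpret q: fp_category "q_cat P" by (rule q_cat_fp)
  fix d x assume "d \<in> Obj (Base Q)" "x \<in> Obj (Base Q)"
  then have *: "d \<in> q_obj P" "x \<in> q_obj P" "id_times_diag (q_cat P) d x \<in> Arr (q_cat P)"
    using q.id_times_diag_comp(1)[of d x] by simp_all
  show "has_left_adjoint Q (id_times_diag (Base Q) d x)" "frobenius Q (id_times_diag (Base Q) d x)"
    using Q_has_left_adjoint[OF *(3)] Q_frobenius[OF *(3)] by simp_all
  show "ex_along Q (id_times_diag (Base Q) d x) \<top>\<^bsub>Fib Q (Prod (Base Q) d x)\<^esub> =
      Reidx Q (Pr2 (Base Q) d (Prod (Base Q) x x)) (eq_pred Q x)"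
    by (rule Q_eq_weakening[OF *(1,2)])
qed

end

section \<open>Beck--Chevalley for projections\<close>

context existential_elementary_doctrine
begin

lemma q_class_eqD:
  "x \<in> q_obj P \<Longrightarrow> y \<in> q_obj P \<Longrightarrow> f \<in> q_maps P x y \<Longrightarrow> q_class P x y f = q_class P x y g \<Longrightarrow> (f, g) \<in> q_sim P x y"
  by (simp add: q_class_eq_iff)

text \<open>The last property, that the legs of a product jointly reflect the equivalence relations, is what
  Beck--Chevalley needs of a projection. Here \<open>k\<close> represents the inverse of the comparison with the
  standard product.\<close>

lemma q_product_pairing:
  assumes z: "z \<in> q_obj P" and w: "w \<in> q_obj P" and y: "y \<in> q_obj P"
    and p: "p \<in> q_maps P y z" and q: "q \<in> q_maps P y w"
    and prod: "is_product (q_cat P) z w y (q_class P y z p) (q_class P y w q)"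
  obtains k where "k \<in> q_maps P (q_prod P z w) y"
    "\<And>v t. v \<in> q_obj P \<Longrightarrow> t \<in> q_maps P v (q_prod P z w) \<Longrightarrow>
      q_class P v z (Comp C p (Comp C k t)) = q_class P v z (Comp C (Pr1 C (fst z) (fst w)) t)"
    "\<And>v t. v \<in> q_obj P \<Longrightarrow> t \<in> q_maps P v (q_prod P z w) \<Longrightarrow>
      q_class P v w (Comp C q (Comp C k t)) = q_class P v w (Comp C (Pr2 C (fst z) (fst w)) t)"
    "\<And>\<xi> u v. u \<in> Arr C \<Longrightarrow> v \<in> Arr C \<Longrightarrow> Cod C u = fst y \<Longrightarrow> Cod C v = fst y \<Longrightarrow>
      eqv z \<xi> (Comp C p u) (Comp C p v) \<Longrightarrow> eqv w \<xi> (Comp C q u) (Comp C q v) \<Longrightarrow> eqv y \<xi> u v"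
proof -
  note zw = q_prod_obj[OF z w]
  let ?pr1 = "Pr1 C (fst z) (fst w)" and ?pr2 = "Pr2 C (fst z) (fst w)"
  note pr = pr_q_maps[OF z w]
  note pD = q_mapsD(1-3)[OF y z p] and qD = q_mapsD(1-3)[OF y w q]
  have univ: "\<exists>!\<theta>. \<theta> \<in> Hom (q_cat P) v y \<and> Comp (q_cat P) (q_class P y z p) \<theta> = q_class P v z f \<and>
      Comp (q_cat P) (q_class P y w q) \<theta> = q_class P v w g"
    if "v \<in> q_obj P" "f \<in> q_maps P v z" "g \<in> q_maps P v w" for v f g
  proof -
    have "q_class P v z f \<in> Hom (q_cat P) v z" "q_class P v w g \<in> Hom (q_cat P) v w" "v \<in> Obj (q_cat P)"
      using that z w by (auto simp: hom_q_cat_iff)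
    then show ?thesis
      using prod unfolding is_product_def by blast
  qed
  \<comment> \<open>The product diagram is arbitrary, so it also has a pairing out of the standard
    product; its representative \<open>k\<close> plays the role of forming pairs.\<close>
  obtain \<theta> where \<theta>: "\<theta> \<in> Hom (q_cat P) (q_prod P z w) y"
    "Comp (q_cat P) (q_class P y z p) \<theta> = q_class P (q_prod P z w) z ?pr1"
    "Comp (q_cat P) (q_class P y w q) \<theta> = q_class P (q_prod P z w) w ?pr2"
    using univ[OF zw pr] by blast
  then obtain k where k: "k \<in> q_maps P (q_prod P z w) y" and \<theta>k: "\<theta> = q_class P (q_prod P z w) y k"
    unfolding hom_q_cat_iff by blast
  note kD = q_mapsD(1-3)[OF zw y k]
  have pk: "q_class P (q_prod P z w) z (Comp C p k) = q_class P (q_prod P z w) z ?pr1"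
    "q_class P (q_prod P z w) w (Comp C q k) = q_class P (q_prod P z w) w ?pr2"
    using \<theta>(2,3) unfolding \<theta>k comp_q_class[OF zw y z k p] comp_q_class[OF zw y w k q] .
  \<comment> \<open>An arbitrary \<open>t\<close> is allowed because two instances are needed: the
    pairing of \<open>p\<close> and \<open>q\<close> below, and the test arrow in the proof of
    Beck-Chevalley.\<close>
  have pkt: "q_class P v z (Comp C p (Comp C k t)) = q_class P v z (Comp C ?pr1 t)"
    "q_class P v w (Comp C q (Comp C k t)) = q_class P v w (Comp C ?pr2 t)"
    if v: "v \<in> q_obj P" and t: "t \<in> q_maps P v (q_prod P z w)" for v t
  proof -
    note tD = q_mapsD(1-3)[OF v zw t]
    show "q_class P v z (Comp C p (Comp C k t)) = q_class P v z (Comp C ?pr1 t)"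
      using comp_q_class[OF v zw z t q_maps_comp[OF zw y z k p]] comp_q_class[OF v zw z t pr(1)] pk(1) tD kD pD by simp
    show "q_class P v w (Comp C q (Comp C k t)) = q_class P v w (Comp C ?pr2 t)"
      using comp_q_class[OF v zw w t q_maps_comp[OF zw y w k q]] comp_q_class[OF v zw w t pr(2)] pk(2) tD kD qD by simp
  qed
  let ?t = "tuple C p q"
  note t = tuple_q_maps[OF y z w p q]
  note kt = q_maps_comp[OF y zw y t k]
  have tD: "?t \<in> Arr C" "Dom C ?t = fst y" "Cod C ?t = Prod C (fst z) (fst w)"
    using pD qD by simp_all
  \<comment> \<open>Taking an element apart and pairing its components again is the identity up to
    the relation of \<open>y\<close>: both arrows have the same composites with the legs, so
    uniqueness of pairings applies.\<close>
  have "q_class P y y (Comp C k ?t) = q_class P y y (Ident C (fst y))"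
  proof -
    have "Comp (q_cat P) (q_class P y z p) (q_class P y y (Comp C k ?t)) = q_class P y z p"
      "Comp (q_cat P) (q_class P y w q) (q_class P y y (Comp C k ?t)) = q_class P y w q"
      "Comp (q_cat P) (q_class P y z p) (q_class P y y (Ident C (fst y))) = q_class P y z p"
      "Comp (q_cat P) (q_class P y w q) (q_class P y y (Ident C (fst y))) = q_class P y w q"
      using comp_q_class[OF y y z kt p] comp_q_class[OF y y w kt q] pkt[OF y t] pD qD
        comp_q_class[OF y y z ident_q_maps[OF y] p] comp_q_class[OF y y w ident_q_maps[OF y] q] by simp_all
    moreover have "q_class P y y (Comp C k ?t) \<in> Hom (q_cat P) y y" "q_class P y y (Ident C (fst y)) \<in> Hom (q_cat P) y y"
      unfolding hom_q_cat_iff using kt ident_q_maps[OF y] y by blast+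
    ultimately show ?thesis
      using univ[OF y p q] by blast
  qed
  then have kt_id: "(Comp C k ?t, Ident C (fst y)) \<in> q_sim P y y"
    by (rule q_class_eqD[OF y y kt])
  \<comment> \<open>Equivalent components give equivalent pairs in the standard product,
    \<open>k\<close> preserves this, and each of u and v is equivalent to its re-paired
    form.\<close>
  have reflect: "eqv y \<xi> u v"
    if uv: "u \<in> Arr C" "v \<in> Arr C" "Cod C u = fst y" "Cod C v = fst y"
      and e: "eqv z \<xi> (Comp C p u) (Comp C p v)" "eqv w \<xi> (Comp C q u) (Comp C q v)" for \<xi> u v
  proof -
    have dom: "Dom C u = Dom C v" "\<xi> \<in> preds (Dom C v)"
      using eqv_typing[OF e(1)] uv pD by simp_all
    have *: "eqv y \<xi> (Comp C k (Comp C ?t a)) a" if a: "a \<in> Arr C" "Cod C a = fst y" "\<xi> \<in> preds (Dom C a)" for a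
      using q_simD[OF y y kt_id a] a kD tD y by (simp del: base.comp_tuple)
    have "eqv (q_prod P z w) \<xi> (Comp C ?t u) (Comp C ?t v)"
      using uv dom e pD qD z w by (simp add: eqv_q_prod)
    then have "eqv y \<xi> (Comp C k (Comp C ?t u)) (Comp C k (Comp C ?t v))"
      by (rule q_mapsD(4)[OF zw y k])
    moreover have "eqv y \<xi> u (Comp C k (Comp C ?t u))" "eqv y \<xi> (Comp C k (Comp C ?t v)) v"
      using eqv_sym[OF y *[of u]] *[of v] uv dom by simp_all
    ultimately show ?thesis
      using eqv_trans[OF y] by blast
  qed
  show thesis
    by (rule that[OF k pkt reflect])
qed

text \<open>One inequality uses only that the square commutes up to the relation of
  \<open>z\<close>. The other uses the pullback property once, at the product of \<open>y\<close>
  and \<open>z'\<close>, and then evaluates the resulting arrow at the given elements.\<close>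

lemma qex_beck_chevalley:
  assumes z: "z \<in> q_obj P" and w: "w \<in> q_obj P" and y: "y \<in> q_obj P" and z': "z' \<in> q_obj P" and y': "y' \<in> q_obj P"
    and p: "p \<in> q_maps P y z" and q: "q \<in> q_maps P y w" and f: "f \<in> q_maps P z' z"
    and p': "p' \<in> q_maps P y' z'" and f': "f' \<in> q_maps P y' y"
    and prod: "is_product (q_cat P) z w y (q_class P y z p) (q_class P y w q)"
    and pb: "is_pullback (q_cat P) (q_class P y z p) (q_class P z' z f) (q_class P y' z' p') (q_class P y' y f')"
    and \<beta>: "\<beta> \<in> des P (fst y) (snd y)"
  shows "qex y' z' p' (Reidx P f' \<beta>) = Reidx P f (qex y z p \<beta>)"
proof -
  note pD = q_mapsD(1-3)[OF y z p] and qD = q_mapsD(1-3)[OF y w q] and fD = q_mapsD(1-3)[OF z' z f]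
    and p'D = q_mapsD(1-3)[OF y' z' p'] and f'D = q_mapsD(1-3)[OF y' y f']
  note zw = q_prod_obj[OF z w] and yz' = q_prod_obj[OF y z']
  note f'\<beta> = reidx_des[OF y' y f' \<beta>]
  let ?L = "qex y' z' p' (Reidx P f' \<beta>)" and ?R = "Reidx P f (qex y z p \<beta>)"
  have cl: "?L \<in> preds (fst z')" "qex y z p \<beta> \<in> preds (fst z)" "\<beta> \<in> preds (fst y)"
    using qex_closed[OF y' z' p' f'\<beta>] qex_closed[OF y z p \<beta>] desD(1)[OF y \<beta>] by simp_all
  then have cl': "?R \<in> preds (fst z')" using fD by simp
  have comm: "(Comp C p f', Comp C f p') \<in> q_sim P y' z"
  proof (rule q_class_eqD[OF y' z q_maps_comp[OF y' y z f' p]])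
    show "q_class P y' z (Comp C p f') = q_class P y' z (Comp C f p')"
      using pb comp_q_class[OF y' y z f' p] comp_q_class[OF y' z' z p' f] by (simp add: is_pullback_def)
  qed
  have le1: "?L \<sqsubseteq>\<^bsub>Fib P (fst z')\<^esub> ?R"
  proof (rule le_forcesI)
    fix b \<xi> assume b: "b \<in> Arr C" "Cod C b = fst z'" "forces \<xi> b ?L"
    show "forces \<xi> b ?R"
    proof (rule forces_qexE[OF y' z' p' f'\<beta> b(3,2)])
      fix h a \<xi>' assume h: "h \<in> Arr C" "Cod C h = Dom C b" and a: "a \<in> Arr C" "Cod C a = fst y'"
        and fa: "forces \<xi>' a (Reidx P f' \<beta>)" and ab: "eqv z' \<xi>' (Comp C p' a) (Comp C b h)"
      have "eqv z \<xi>' (Comp C p (Comp C f' a)) (Comp C f (Comp C p' a))"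
        using q_simD[OF y' z comm a forces_typing(3)[OF fa]] a pD fD p'D f'D by simp
      then have "eqv z \<xi>' (Comp C p (Comp C f' a)) (Comp C f (Comp C b h))"
        using q_mapsD(4)[OF z' z f ab] by (rule eqv_trans[OF z])
      then have "forces \<xi>' (Comp C f (Comp C b h)) (qex y z p \<beta>)"
        by (rule forces_qexI[OF y z p \<beta>, rotated]) (use fa a f'D cl in simp_all)
      then show "forces \<xi>' (Comp C b h) ?R"
        using b h fD cl by simp
    qed (use b cl cl' in simp_all)
  qed (use z' cl cl' in simp_all)
  obtain k where k: "k \<in> q_maps P (q_prod P z w) y"
    and pk: "\<And>v t. v \<in> q_obj P \<Longrightarrow> t \<in> q_maps P v (q_prod P z w) \<Longrightarrow>
      q_class P v z (Comp C p (Comp C k t)) = q_class P v z (Comp C (Pr1 C (fst z) (fst w)) t)"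
    and qk: "\<And>v t. v \<in> q_obj P \<Longrightarrow> t \<in> q_maps P v (q_prod P z w) \<Longrightarrow>
      q_class P v w (Comp C q (Comp C k t)) = q_class P v w (Comp C (Pr2 C (fst z) (fst w)) t)"
    and reflect: "\<And>\<xi> u v. u \<in> Arr C \<Longrightarrow> v \<in> Arr C \<Longrightarrow> Cod C u = fst y \<Longrightarrow> Cod C v = fst y \<Longrightarrow>
      eqv z \<xi> (Comp C p u) (Comp C p v) \<Longrightarrow> eqv w \<xi> (Comp C q u) (Comp C q v) \<Longrightarrow> eqv y \<xi> u v"
    using q_product_pairing[OF z w y p q prod] by blast
  let ?r1 = "Pr1 C (fst y) (fst z')" and ?r2 = "Pr2 C (fst y) (fst z')"
  note r = pr_q_maps[OF y z']
  \<comment> \<open>On the product of \<open>y\<close> and \<open>z'\<close>, \<open>t\<close> is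
    the pair (f z', q y) and \<open>u\<close> is the element of \<open>y\<close> with these
    components. Neither refers to the hypothesis p y ~ f z'.\<close>
  define t where "t = tuple C (Comp C f ?r2) (Comp C q ?r1)"
  define u where "u = Comp C k t"
  have t: "t \<in> q_maps P (q_prod P y z') (q_prod P z w)"
    unfolding t_def
    by (rule tuple_q_maps[OF yz' z w q_maps_comp[OF yz' z' z r(2) f] q_maps_comp[OF yz' y w r(1) q]])
  have u: "u \<in> q_maps P (q_prod P y z') y"
    unfolding u_def by (rule q_maps_comp[OF yz' zw y t k])
  note uD = q_mapsD(1-3)[OF yz' y u]
  have pr_t: "Comp C (Pr1 C (fst z) (fst w)) t = Comp C f ?r2" "Comp C (Pr2 C (fst z) (fst w)) t = Comp C q ?r1"
    using fD qD y z' by (simp_all add: t_def)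
  have pu: "q_class P (q_prod P y z') z (Comp C p u) = q_class P (q_prod P y z') z (Comp C f ?r2)"
    and qu: "q_class P (q_prod P y z') w (Comp C q u) = q_class P (q_prod P y z') w (Comp C q ?r1)"
    using pk[OF yz' t] qk[OF yz' t] unfolding pr_t u_def by blast+
  have pu_sim: "(Comp C p u, Comp C f ?r2) \<in> q_sim P (q_prod P y z') z"
    and qu_sim: "(Comp C q u, Comp C q ?r1) \<in> q_sim P (q_prod P y z') w"
    using q_class_eqD[OF yz' z q_maps_comp[OF yz' y z u p] pu] q_class_eqD[OF yz' w q_maps_comp[OF yz' y w u q] qu] .
  \<comment> \<open>In the completion \<open>u\<close> lies over f z' without any condition, so it
    forms a cone together with the projection to \<open>z'\<close>; the mediating arrow is
    represented by \<open>h\<close>.\<close>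
  have "q_class P (q_prod P y z') y u \<in> Hom (q_cat P) (q_prod P y z') (Dom (q_cat P) (q_class P y z p))"
    "q_class P (q_prod P y z') z' ?r2 \<in> Hom (q_cat P) (q_prod P y z') (Dom (q_cat P) (q_class P z' z f))"
    "q_prod P y z' \<in> Obj (q_cat P)"
    using u r yz' y z' by (auto simp: hom_q_cat_iff)
  moreover have "Comp (q_cat P) (q_class P y z p) (q_class P (q_prod P y z') y u) =
      Comp (q_cat P) (q_class P z' z f) (q_class P (q_prod P y z') z' ?r2)"
    using pu comp_q_class[OF yz' y z u p] comp_q_class[OF yz' z' z r(2) f] by simp
  ultimately obtain \<theta> where \<theta>: "\<theta> \<in> Hom (q_cat P) (q_prod P y z') (Dom (q_cat P) (q_class P y' z' p'))"
    "Comp (q_cat P) (q_class P y' y f') \<theta> = q_class P (q_prod P y z') y u"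
    "Comp (q_cat P) (q_class P y' z' p') \<theta> = q_class P (q_prod P y z') z' ?r2"
    using pb unfolding is_pullback_def by blast
  then obtain h where h: "h \<in> q_maps P (q_prod P y z') y'" and \<theta>h: "\<theta> = q_class P (q_prod P y z') y' h"
    unfolding hom_q_cat_iff q_cat_sel by blast
  note hD = q_mapsD(1-3)[OF yz' y' h]
  have f'h: "(Comp C f' h, u) \<in> q_sim P (q_prod P y z') y"
    and p'h: "(Comp C p' h, ?r2) \<in> q_sim P (q_prod P y z') z'"
    using \<theta>(2,3) unfolding \<theta>h comp_q_class[OF yz' y' y h f'] comp_q_class[OF yz' y' z' h p']
    using q_class_eqD[OF yz' y q_maps_comp[OF yz' y' y h f']] q_class_eqD[OF yz' z' q_maps_comp[OF yz' y' z' h p']]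
    by blast+
  have le2: "?R \<sqsubseteq>\<^bsub>Fib P (fst z')\<^esub> ?L"
  proof (rule le_forcesI)
    fix b \<xi> assume b: "b \<in> Arr C" "Cod C b = fst z'" "forces \<xi> b ?R"
    have fb: "forces \<xi> (Comp C f b) (qex y z p \<beta>)" "Cod C (Comp C f b) = fst z"
      using b fD cl by simp_all
    show "forces \<xi> b ?L"
    proof (rule forces_qexE[OF y z p \<beta> fb])
      fix g a \<xi>' assume g: "g \<in> Arr C" "Cod C g = Dom C (Comp C f b)" and a: "a \<in> Arr C" "Dom C a = Dom C g" "Cod C a = fst y"
        and a\<beta>: "forces \<xi>' a \<beta>" and ab: "eqv z \<xi>' (Comp C p a) (Comp C (Comp C f b) g)"
      define b' where "b' = Comp C b g"
      \<comment> \<open>Evaluating at the pair of the witness \<open>a\<close> and the element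
        \<open>b'\<close> specializes the arrows \<open>u\<close> and \<open>h\<close> to the
        situation at hand.\<close>
      define s where "s = tuple C a b'"
      have g': "Cod C g = Dom C b" using g b fD by simp
      have b': "b' \<in> Arr C" "Dom C b' = Dom C g" "Cod C b' = fst z'" using b g g' by (simp_all add: b'_def)
      have ab': "eqv z \<xi>' (Comp C p a) (Comp C f b')" using ab b g g' fD by (simp add: b'_def)
      have \<xi>': "\<xi>' \<in> preds (Dom C g)" using forces_typing(3)[OF a\<beta>] a by simp
      have s: "s \<in> Arr C" "Dom C s = Dom C g" "Cod C s = Prod C (fst y) (fst z')"
        and rs: "Comp C ?r1 s = a" "Comp C ?r2 s = b'"
        using a b' by (simp_all add: s_def)
      have s': "s \<in> Arr C" "Cod C s = fst (q_prod P y z')" "\<xi>' \<in> preds (Dom C s)" using s \<xi>' by simp_all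
      have 1: "eqv z \<xi>' (Comp C p (Comp C u s)) (Comp C f b')"
        using q_simD[OF yz' z pu_sim s'] s pD uD fD y z' rs by simp
      have 2: "eqv w \<xi>' (Comp C q (Comp C u s)) (Comp C q a)"
        using q_simD[OF yz' w qu_sim s'] s qD uD y z' rs by simp
      have 3: "eqv y \<xi>' (Comp C f' (Comp C h s)) (Comp C u s)"
        using q_simD[OF yz' y f'h s'] s f'D hD by simp
      have 4: "eqv z' \<xi>' (Comp C p' (Comp C h s)) b'"
        using q_simD[OF yz' z' p'h s'] s p'D hD rs by simp
      \<comment> \<open>Here the stagewise hypothesis \<open>ab'\<close> enters: it makes the first
        components of u (a, b') and a equivalent; the second components are equivalent by
        construction.\<close>
      have "eqv y \<xi>' (Comp C u s) a"
        by (rule reflect[OF _ _ _ _ eqv_trans[OF z 1 eqv_sym[OF z ab']] 2]) (use s uD a in simp_all)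
      then have "eqv y \<xi>' a (Comp C f' (Comp C h s))"
        using 3 eqv_sym[OF y] eqv_trans[OF y] by blast
      then have "forces \<xi>' (Comp C f' (Comp C h s)) \<beta>"
        using a\<beta> by (rule desD(2)[OF y \<beta>])
      then have "forces \<xi>' (Comp C h s) (Reidx P f' \<beta>)"
        using s hD f'D cl by simp
      then have "forces \<xi>' b' ?L"
        by (rule forces_qexI[OF y' z' p' f'\<beta> _ 4]) (use s hD in simp)
      then show "forces \<xi>' (Comp C b g) ?L" by (simp add: b'_def)
    qed (use b fD cl in simp_all)
  qed (use z' cl cl' in simp_all)
  show ?thesis
    by (rule fib_antisym[OF _ le1 le2]) (use z' cl cl' in simp_all)
qed

lemma Q_existential: "existential_doctrine Q"
proof (intro existential_doctrine.intro existential_doctrine_axioms.intro Q_primary)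
  fix p assume "is_projection (Base Q) p"
  then have "p \<in> Arr (q_cat P)"
    by (auto simp: is_projection_def is_product_def Hom_def)
  then show "has_left_adjoint Q p" "frobenius Q p"
    by (rule Q_has_left_adjoint Q_frobenius)+
next
  fix p f p' f' \<beta>
  assume proj: "is_projection (Base Q) p" and pb: "is_pullback (Base Q) p f p' f'" and \<beta>: "\<beta> \<in> carrier (Fib Q (Dom (Base Q) p))"
  obtain z w y q where prod: "is_product (q_cat P) z w y p q"
    using proj is_product_swap[of "q_cat P"] unfolding is_projection_def q_sel by blast
  then have "p \<in> Hom (q_cat P) y z" "q \<in> Hom (q_cat P) y w"
    by (simp_all add: is_product_def)
  then obtain p0 q0 where y: "y \<in> q_obj P" and z: "z \<in> q_obj P" and w: "w \<in> q_obj P"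
    and p0: "p0 \<in> q_maps P y z" "p = q_class P y z p0" and q0: "q0 \<in> q_maps P y w" "q = q_class P y w q0"
    unfolding hom_q_cat_iff by blast
  define z' y' where "z' = Dom (q_cat P) f" and "y' = Dom (q_cat P) p'"
  have "Dom (q_cat P) p = y" "Cod (q_cat P) p = z" by (simp_all add: p0(2))
  moreover have "f \<in> Arr (q_cat P)" "Cod (q_cat P) f = Cod (q_cat P) p" "p' \<in> Hom (q_cat P) (Dom (q_cat P) f') z'"
    "f' \<in> Hom (q_cat P) y' (Dom (q_cat P) p)"
    using pb unfolding is_pullback_def q_sel z'_def y'_def by blast+
  ultimately have "f \<in> Hom (q_cat P) z' z" "p' \<in> Hom (q_cat P) y' z'" "f' \<in> Hom (q_cat P) y' y"
    unfolding Hom_def z'_def y'_def by blast+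
  then obtain f0 p0' f0' where z': "z' \<in> q_obj P" and y': "y' \<in> q_obj P"
    and f0: "f0 \<in> q_maps P z' z" "f = q_class P z' z f0" and p0': "p0' \<in> q_maps P y' z'" "p' = q_class P y' z' p0'"
    and f0': "f0' \<in> q_maps P y' y" "f' = q_class P y' y f0'"
    unfolding hom_q_cat_iff by blast
  have \<beta>': "\<beta> \<in> des P (fst y) (snd y)" using \<beta> p0(2) by simp
  have "qex y' z' p0' (Reidx P f0' \<beta>) = Reidx P f0 (qex y z p0 \<beta>)"
    using qex_beck_chevalley[OF z w y z' y' p0(1) q0(1) f0(1) p0'(1) f0'(1) _ _ \<beta>'] prod pb
    unfolding p0(2) q0(2) f0(2) p0'(2) f0'(2) q_sel by blast
  then show "ex_along Q p' (Reidx Q f' \<beta>) = Reidx Q f (ex_along Q p \<beta>)"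
    using ex_along_Q[OF y z p0(1) \<beta>'] ex_along_Q[OF y' z' p0'(1) reidx_des[OF y' y f0'(1) \<beta>']]
      reidx_q_class[OF y' y f0'(1) \<beta>'] reidx_q_class[OF z' z f0(1) qex_des[OF y z p0(1) \<beta>']]
    by (simp add: p0(2) f0(2) p0'(2) f0'(2))
qed

end

section \<open>The embedding into the quotient completion\<close>

context elementary_doctrine
begin

lemma J_arr_hom: "f \<in> Hom C A B \<Longrightarrow> J_arr P f = q_class P (J_obj P A) (J_obj P B) f"
  by (auto simp: J_arr_def Hom_def)

lemma J_maps: "f \<in> Hom C A B \<Longrightarrow> f \<in> q_maps P (J_obj P A) (J_obj P B)"
  by (subst q_maps_J) (auto simp: Hom_def)

text \<open>Fibred equality is a congruence in context: start from g (d, a) = g (d, a) and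
  substitute b for the second a while the first stays fixed.\<close>

lemma eqv_J_context:
  assumes ab: "eqv (J_obj P A) \<xi> a b" and d: "d \<in> Arr C" "Dom C d = Dom C b" "Cod C d = D"
    and g: "g \<in> Arr C" "Dom C g = Prod C D A" "Cod C g = X"
  shows "eqv (J_obj P X) \<xi> (Comp C g (tuple C d a)) (Comp C g (tuple C d b))"
proof -
  have obj: "A \<in> Obj C" "D \<in> Obj C" "X \<in> Obj C"
    using eqv_typing[OF ab] d g by auto
  have ab': "a \<in> Arr C" "b \<in> Arr C" "Dom C a = Dom C b" "Cod C a = A" "Cod C b = A" "\<xi> \<in> preds (Dom C b)"
    "forces \<xi> (tuple C a b) (eq_pred P A)"
    using eqv_typing[OF ab] ab by (simp_all add: eqv_def J_obj_def)
  let ?XD = "Prod C X D"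
  let ?p = "Pr1 C ?XD A" and ?q = "Pr2 C ?XD A"
  \<comment> \<open>\<gamma> ((e, d), c) is the predicate e = g (d, c). The fixed left-hand side e
    is packed into the parameter together with d, so that the substitution affects only c.\<close>
  define \<gamma> where "\<gamma> = Reidx P (tuple C (Comp C (Pr1 C X D) ?p) (Comp C g (tuple C (Comp C (Pr2 C X D) ?p) ?q))) (eq_pred P X)"
  let ?e = "tuple C (Comp C g (tuple C d a)) d"
  have \<gamma>: "forces \<xi> (tuple C ?e c) \<gamma> \<longleftrightarrow> forces \<xi> (tuple C (Comp C g (tuple C d a)) (Comp C g (tuple C d c))) (eq_pred P X)"
    if "c \<in> Arr C" "Dom C c = Dom C b" "Cod C c = A" for c
    using that ab' d g obj by (simp add: \<gamma>_def)
  have "forces \<xi> (tuple C ?e b) \<gamma>"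
  proof (rule forces_eq_subst[of a b ?e "Dom C b" A ?XD])
    show "forces \<xi> (tuple C ?e a) \<gamma>"
      unfolding \<gamma>[OF ab'(1,3,4)] by (rule forces_eq_refl) (use ab' d g in simp_all)
  qed (use ab' d g obj in \<open>simp_all add: \<gamma>_def\<close>)
  then show ?thesis
    using \<gamma>[of b] ab' d g by (simp add: eqv_def J_obj_def)
qed

text \<open>The point is joint reflection. With \<open>k\<close> the inverse of the comparison to
  the standard product, u = k (p u, q u) becomes k (p v, q u) and then k (p v, q v) = v, by
  substituting one component at a time.\<close>

lemma J_product:
  assumes prod: "is_product C A B X p q"
  shows "is_product (q_cat P) (J_obj P A) (J_obj P B) (J_obj P X) (J_arr P p) (J_arr P q)"
proof -
  have hom: "p \<in> Hom C X A" "q \<in> Hom C X B" and obj: "A \<in> Obj C" "B \<in> Obj C" "X \<in> Obj C"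
    and univ: "\<And>Y f g. Y \<in> Obj C \<Longrightarrow> f \<in> Hom C Y A \<Longrightarrow> g \<in> Hom C Y B \<Longrightarrow>
      \<exists>!h. h \<in> Hom C Y X \<and> Comp C p h = f \<and> Comp C q h = g"
    using prod by (auto simp: is_product_def)
  have p: "p \<in> Arr C" "Dom C p = X" "Cod C p = A" and q: "q \<in> Arr C" "Dom C q = X" "Cod C q = B"
    using hom by (simp_all add: Hom_def)
  obtain k where k: "k \<in> Arr C" "Dom C k = Prod C A B" "Cod C k = X"
    and pk: "Comp C p k = Pr1 C A B" "Comp C q k = Pr2 C A B"
    using univ[of "Prod C A B" "Pr1 C A B" "Pr2 C A B"] obj by (auto simp: Hom_def)
  have k_tuple: "Comp C k (tuple C (Comp C p u) (Comp C q u)) = u" if u: "u \<in> Arr C" "Cod C u = X" for u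
  proof -
    let ?v = "Comp C k (tuple C (Comp C p u) (Comp C q u))"
    have v: "?v \<in> Hom C (Dom C u) X" "u \<in> Hom C (Dom C u) X" using u p q k by (simp_all add: Hom_def)
    have "Comp C (Comp C p k) (tuple C (Comp C p u) (Comp C q u)) = Comp C p u"
      "Comp C (Comp C q k) (tuple C (Comp C p u) (Comp C q u)) = Comp C q u"
      unfolding pk using u p q by simp_all
    then have "Comp C p ?v = Comp C p u" "Comp C q ?v = Comp C q u"
      using u p q k by simp_all
    moreover have "Comp C p u \<in> Hom C (Dom C u) A" "Comp C q u \<in> Hom C (Dom C u) B" "Dom C u \<in> Obj C"
      using u p q by (simp_all add: Hom_def)
    ultimately show ?thesis
      using univ[of "Dom C u" "Comp C p u" "Comp C q u"] v by blast
  qed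
  show ?thesis
    unfolding J_arr_hom[OF hom(1)] J_arr_hom[OF hom(2)]
  proof (rule q_cat_is_product)
    fix f g assume "f \<in> Arr C" "g \<in> Arr C" "Dom C f = Dom C g" "Cod C f = fst (J_obj P A)" "Cod C g = fst (J_obj P B)"
    then show "\<exists>h \<in> Hom C (Dom C g) (fst (J_obj P X)). Comp C p h = f \<and> Comp C q h = g"
      using univ[of "Dom C g" f g] by (auto simp: Hom_def)
  next
    fix \<xi> u v
    assume uv: "u \<in> Arr C" "v \<in> Arr C" "Dom C u = Dom C v" "Cod C u = fst (J_obj P X)" "Cod C v = fst (J_obj P X)"
      and e: "eqv (J_obj P A) \<xi> (Comp C p u) (Comp C p v)" "eqv (J_obj P B) \<xi> (Comp C q u) (Comp C q v)"
    \<comment> \<open>Substitution in context changes the last component only, so the pair is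
      swapped before its first component is replaced.\<close>
    let ?s = "tuple C (Pr2 C B A) (Pr1 C B A)"
    have "eqv (J_obj P X) \<xi> (Comp C (Comp C k ?s) (tuple C (Comp C q u) (Comp C p u)))
        (Comp C (Comp C k ?s) (tuple C (Comp C q u) (Comp C p v)))"
      by (rule eqv_J_context[OF e(1)]) (use uv p q k obj in simp_all)
    then have 1: "eqv (J_obj P X) \<xi> (Comp C k (tuple C (Comp C p u) (Comp C q u))) (Comp C k (tuple C (Comp C p v) (Comp C q u)))"
      using uv p q k obj by simp
    have 2: "eqv (J_obj P X) \<xi> (Comp C k (tuple C (Comp C p v) (Comp C q u))) (Comp C k (tuple C (Comp C p v) (Comp C q v)))"
      by (rule eqv_J_context[OF e(2)]) (use uv p q k obj in simp_all)
    show "eqv (J_obj P X) \<xi> u v"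
      using eqv_trans[OF J_obj_in_q_obj[OF obj(3)] 1 2] k_tuple[of u] k_tuple[of v] uv by simp
  qed (use obj J_maps[OF hom(1)] J_maps[OF hom(2)] in simp_all)
qed

section \<open>J as a functor and as a 1-arrow of doctrines\<close>

lemma J_fp_functor: "fp_functor C (q_cat P) (J_obj P) (J_arr P)"
proof (intro fp_functor.intro fp_functor_axioms.intro base_fp q_cat_fp)
  show "J_obj P A \<in> Obj (q_cat P)" if "A \<in> Obj C" for A using that by simp
  show "J_arr P f \<in> Hom (q_cat P) (J_obj P A) (J_obj P B)" if f: "f \<in> Hom C A B" for f A B
  proof -
    have "A \<in> Obj C" "B \<in> Obj C" using f by (auto simp: Hom_def)
    then show ?thesis
      unfolding hom_q_cat_iff using J_maps[OF f] J_arr_hom[OF f] by auto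
  qed
  show "J_arr P (Ident C A) = Ident (q_cat P) (J_obj P A)" if "A \<in> Obj C" for A
    using that J_arr_hom[of "Ident C A" A A] by (simp add: Hom_def)
  show "J_arr P (Comp C g f) = Comp (q_cat P) (J_arr P g) (J_arr P f)" if f: "f \<in> Hom C A B" and g: "g \<in> Hom C B D" for f g A B D
  proof -
    have "A \<in> Obj C" "B \<in> Obj C" "D \<in> Obj C" using f g by (auto simp: Hom_def)
    then show ?thesis
      using J_arr_hom[OF base.comp_hom[OF f g]] J_arr_hom[OF f] J_arr_hom[OF g]
        comp_q_class[OF J_obj_in_q_obj J_obj_in_q_obj J_obj_in_q_obj J_maps[OF f] J_maps[OF g]] by simp
  qed
qed (simp_all add: J_terminal J_product)

lemma Fib_Q_J: "A \<in> Obj C \<Longrightarrow> Fib Q (J_obj P A) = Fib P A"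
  by (simp add: J_obj_def des_J)

lemma reidx_J:
  assumes f: "f \<in> Hom C A B" and \<alpha>: "\<alpha> \<in> preds B"
  shows "Reidx Q (J_arr P f) \<alpha> = Reidx P f \<alpha>"
proof -
  have "A \<in> Obj C" "B \<in> Obj C" using f by (auto simp: Hom_def)
  then show ?thesis
    using J_arr_hom[OF f] reidx_q_class[OF J_obj_in_q_obj J_obj_in_q_obj J_maps[OF f], of \<alpha>] \<alpha>
    by (simp add: J_obj_def des_J)
qed

end

context existential_elementary_doctrine
begin

lemma J_doctrine_arrow: "doctrine_arrow P Q (J_obj P) (J_arr P) j_comp"
proof (intro doctrine_arrow.intro doctrine_arrow_axioms.intro elementary_doctrine_axioms Q_elementary)
  show "fp_functor (Base P) (Base Q) (J_obj P) (J_arr P)" using J_fp_functor by simp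
  show "inf_sl_hom (Fib P A) (Fib Q (J_obj P A)) (j_comp A)" if "A \<in> Obj (Base P)" for A
    unfolding Fib_Q_J[OF that] by (simp add: inf_sl_hom_def j_comp_def)
  show "j_comp A (Reidx P f \<alpha>) = Reidx Q (J_arr P f) (j_comp B \<alpha>)" if "f \<in> Hom (Base P) A B" "\<alpha> \<in> carrier (Fib P B)" for f A B \<alpha>
    using reidx_J[OF that] by (simp add: j_comp_def)
  fix A assume A: "A \<in> Obj (Base P)"
  let ?AA = "Prod C A A"
  note JA = J_obj_in_q_obj[OF A]
  have AA: "?AA \<in> Obj C" using A by simp
  have pr: "Pr1 C A A \<in> Hom C ?AA A" "Pr2 C A A \<in> Hom C ?AA A" using A by (simp_all add: Hom_def)
  \<comment> \<open>The comparison from J (A \<times> A) to J A \<times> J A is represented by the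
    identity of A \<times> A, so reindexing along it leaves the equality predicate
    unchanged.\<close>
  have "tuple (q_cat P) (J_arr P (Pr1 C A A)) (J_arr P (Pr2 C A A)) =
      q_class P (J_obj P ?AA) (q_prod P (J_obj P A) (J_obj P A)) (Ident C ?AA)"
    unfolding J_arr_hom[OF pr(1)] J_arr_hom[OF pr(2)]
    using tuple_q_class[OF J_obj_in_q_obj[OF AA] JA JA J_maps[OF pr(1)] J_maps[OF pr(2)]] A by simp
  moreover have "Ident C ?AA \<in> q_maps P (J_obj P ?AA) (q_prod P (J_obj P A) (J_obj P A))"
    using tuple_q_maps[OF J_obj_in_q_obj[OF AA] JA JA J_maps[OF pr(1)] J_maps[OF pr(2)]] A by simp
  ultimately show "j_comp (Prod (Base P) A A) (eq_pred P A) =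
      Reidx Q (tuple (Base Q) (J_arr P (Pr1 (Base P) A A)) (J_arr P (Pr2 (Base P) A A))) (eq_pred Q (J_obj P A))"
    using reidx_q_class[OF J_obj_in_q_obj[OF AA] q_prod_obj[OF JA JA], of "Ident C ?AA" "eq_pred P A"]
      eq_pred_Q[OF JA] eq_pred_Q_des[OF JA] A AA
    by (simp add: j_comp_def J_obj_def)
qed

text \<open>On objects carrying fibred equality, the fibres and reindexing of the completion are
  those of \<open>P\<close>. Hence the adjoint of \<open>P\<close> is also an adjoint there and
  agrees with the one chosen in the completion.\<close>

lemma J_preserves_proj_adjoints: "preserves_proj_adjoints P Q (J_arr P) j_comp"
  unfolding preserves_proj_adjoints_def
proof (intro allI impI)
  fix p \<beta> assume proj: "is_projection (Base P) p" and \<beta>: "\<beta> \<in> carrier (Fib P (Dom (Base P) p))"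
  let ?X = "Dom C p" and ?A = "Cod C p"
  have p: "p \<in> Arr C" using proj by (auto simp: is_projection_def is_product_def Hom_def)
  then have hom: "p \<in> Hom C ?X ?A" and obj: "?X \<in> Obj C" "?A \<in> Obj C" by (simp_all add: Hom_def)
  note q = J_obj_in_q_obj[OF obj(1)] J_obj_in_q_obj[OF obj(2)] J_maps[OF hom]
  have des: "des P (fst (J_obj P B)) (snd (J_obj P B)) = preds B" if "B \<in> Obj C" for B
    using that by (simp add: J_obj_def des_J)
  have "is_left_adjoint Q (q_class P (J_obj P ?X) (J_obj P ?A) p) (ex_along P p)"
    unfolding Q_left_adjoint_iff[OF q] des[OF obj(1)] des[OF obj(2)]
    using ex_along_adjoint[OF p proj_left_adjoint[OF proj]] by simp
  from Q_ex_along_eq[OF q this, unfolded des[OF obj(1)], OF \<beta>] show "j_comp (Cod (Base P) p) (ex_along P p \<beta>) = ex_along Q (J_arr P p) (j_comp (Dom (Base P) p) \<beta>)"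
    using J_arr_hom[OF hom] by (simp add: j_comp_def)
qed

end

theorem theorem6p1:
  fixes P :: "('o, 'm, 'p) doctrine"
  assumes "elementary_doctrine P"
    and "existential_doctrine P"
  shows "elementary_doctrine (quotient_completion P) \<and>
    existential_doctrine (quotient_completion P) \<and>
    doctrine_arrow P (quotient_completion P) (J_obj P) (J_arr P) j_comp \<and>
    preserves_proj_adjoints P (quotient_completion P) (J_arr P) j_comp"
proof -
  interpret existential_elementary_doctrine P
    using assms by (rule existential_elementary_doctrine.intro)
  show ?thesis
    using Q_elementary Q_existential J_doctrine_arrow J_preserves_proj_adjoints by blast
qed

end
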